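(* Assume that $a\in C^1[0,1]$ and that there are constants $a_0,a_1>0$ with $a(x)\ge a_0$ and $a'(x)\ge a_1$ for all $x\in[0,1]$; assume also that $|\alpha|<\beta$ and $|\alpha|<K<2\beta-|\alpha|$. Then there exists $C>0$ such that for all $t>0$ $$\left\|e^{t\dot{\mathcal{A}}}\right\|_{\mathcal{L}(\mathcal{D}(\dot{\mathcal{A}}),\dot{\mathcal{X}})}\le\frac{C}{\sqrt t}.$$
   Context: Constants: $m,M,\tau,\beta,K>0$ and $\alpha\in\mathbb{R}$; put $\mu=\beta-\alpha$. The state space is $\mathcal{X}=H^1(0,1)\times L^2(0,1)\times L^2(0,1)\times\mathbb{R}^2$, equipped with the inner product $$\langle(y,z,u,\xi,\eta),(\tilde y,\tilde z,\tilde u,\tilde\xi,\tilde\eta)\rangle_{\mathcal{X}}=\int_0^1(a y_x\tilde y_x+z\tilde z)\,dx+K\tau\int_0^1u\tilde u\,dx+m\xi\tilde\xi+M\eta\tilde\eta+\varpi\,\ell(y,z,u,\xi,\eta)\,\ell(\tilde y,\tilde z,\tilde u,\tilde\xi,\tilde\eta),$$ where $\ell(y,z,u,\xi,\eta)=\int_0^1z\,dx+m\xi+M\eta+\mu y(0)+\tau\alpha\int_0^1u\,dx$ and $\varpi>0$ is a constant fixed small enough that $\mathcal{X}$ with this inner product is a Hilbert space whose norm is equivalent to the usual product norm. (The complex case is analogous, with complex conjugates in the second argument.) The linear operator $\mathcal{A}$ is defined by $$\mathcal{D}(\mathcal{A})=\{(y,z,u,\xi,\eta)\in\mathcal{X}:\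 y\in H^2(0,1),\ z,u\in H^1(0,1),\ \xi=u(0)=z(0),\ \eta=z(1)\},$$ $$\mathcal{A}(y,z,u,\xi,\eta)=\Big(z,\ (ay_x)_x,\ -\tfrac{u_x}{\tau},\ \tfrac1m\big[(ay_x)(0)-\beta\xi+\alpha u(1)\big],\ -\tfrac{(ay_x)(1)}{M}\Big).$$ The closed subspace $\dot{\mathcal{X}}\subset\mathcal{X}$ (with the inherited norm) is $$\dot{\mathcal{X}}=\Big\{(y,z,u,\xi,\eta)\in\mathcal{X}:\ \int_0^1z\,dx+\alpha\tau\int_0^1u\,dx+(\beta-\alpha)y(0)+m\xi+M\eta=0\Big\},$$ and $\dot{\mathcal{A}}:\mathcal{D}(\dot{\mathcal{A}})=\mathcal{D}(\mathcal{A})\cap\dot{\mathcal{X}}\to\dot{\mathcal{X}}$ is the restriction of $\mathcal{A}$. It generates a $C_0$-semigroup of contractions $e^{t\dot{\mathcal{A}}}$ on $\dot{\mathcal{X}}$. $\mathcal{D}(\dot{\mathcal{A}})$ carries the graph norm, and $\mathcal{L}(\mathcal{D}(\dot{\mathcal{A}}),\dot{\mathcal{X}})$ denotes the bounded linear operators with the operator norm. *)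

theory Defs
  imports "HOL-Analysis.Analysis"
begin

section \<open>The real Hilbert space \<open>L\<^sup>2(0,1)\<close>\<close>

abbreviation unit_leb :: "real measure" where
  "unit_leb \<equiv> lebesgue_on {0<..<1}"

definition square_integrable :: "(real \<Rightarrow> real) \<Rightarrow> bool" where
  "square_integrable f \<longleftrightarrow> f \<in> borel_measurable unit_leb \<and> integrable unit_leb (\<lambda>x. (f x)\<^sup>2)"

lemma square_integrable_zero: "square_integrable (\<lambda>x. 0)"
  by (simp add: square_integrable_def)

lemma square_integrable_mult:
  assumes "square_integrable f" "square_integrable g"
  shows "integrable unit_leb (\<lambda>x. f x * g x)"
proof (rule Bochner_Integration.integrable_bound)
  show "integrable unit_leb (\<lambda>x. (f x)\<^sup>2 + (g x)\<^sup>2)"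
    using assms by (simp add: square_integrable_def)
  show "(\<lambda>x. f x * g x) \<in> borel_measurable unit_leb"
    using assms by (simp add: square_integrable_def borel_measurable_times)
  have "\<bar>f x * g x\<bar> \<le> (f x)\<^sup>2 + (g x)\<^sup>2" for x
  proof -
    have "0 \<le> (\<bar>f x\<bar> - \<bar>g x\<bar>)\<^sup>2" "0 \<le> \<bar>f x\<bar> * \<bar>g x\<bar>" by simp_all
    then have "\<bar>f x\<bar> * \<bar>g x\<bar> \<le> \<bar>f x\<bar>\<^sup>2 + \<bar>g x\<bar>\<^sup>2" unfolding power2_diff by linarith
    then show ?thesis by (simp add: abs_mult)
  qed
  then show "AE x in unit_leb. norm (f x * g x) \<le> norm ((f x)\<^sup>2 + (g x)\<^sup>2)" by simp
qed

lemma square_integrable_add: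
  assumes "square_integrable f" "square_integrable g"
  shows "square_integrable (\<lambda>x. f x + g x)"
proof -
  have "integrable unit_leb (\<lambda>x. (f x)\<^sup>2 + (g x)\<^sup>2 + 2 * (f x * g x))"
    using assms square_integrable_mult[OF assms] by (simp add: square_integrable_def)
  moreover have "(\<lambda>x. f x + g x) \<in> borel_measurable unit_leb"
    using assms by (simp add: square_integrable_def borel_measurable_add)
  moreover have "(\<lambda>x. (f x + g x)\<^sup>2) = (\<lambda>x. (f x)\<^sup>2 + (g x)\<^sup>2 + 2 * (f x * g x))"
    by (rule ext) (simp add: power2_sum)
  ultimately show ?thesis
    by (simp only: square_integrable_def)
qed

lemma square_integrable_scale:
  "square_integrable f \<Longrightarrow> square_integrable (\<lambda>x. c * f x)"
  by (auto simp: square_integrable_def power_mult_distrib borel_measurable_times)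

definition l2_rel :: "(real \<Rightarrow> real) \<Rightarrow> (real \<Rightarrow> real) \<Rightarrow> bool" where
  "l2_rel f g \<longleftrightarrow> square_integrable f \<and> square_integrable g \<and> (AE x in unit_leb. f x = g x)"

lemma part_equivp_l2_rel: "part_equivp l2_rel"
proof (rule part_equivpI)
  show "\<exists>f. l2_rel f f"
    using square_integrable_zero by (auto simp: l2_rel_def)
  show "symp l2_rel"
    by (auto simp: l2_rel_def symp_def elim: eventually_mono)
  show "transp l2_rel"
    unfolding l2_rel_def transp_def by (auto elim: eventually_elim2)
qed

quotient_type l2 = "real \<Rightarrow> real" / partial: l2_rel
  by (rule part_equivp_l2_rel)

instantiation l2 :: real_vector
begin

lift_definition zero_l2 :: l2 is "\<lambda>x. 0"
  by (simp add: l2_rel_def square_integrable_zero)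

lift_definition plus_l2 :: "l2 \<Rightarrow> l2 \<Rightarrow> l2" is "\<lambda>f g x. f x + g x"
  by (auto simp: l2_rel_def square_integrable_add)

lift_definition scaleR_l2 :: "real \<Rightarrow> l2 \<Rightarrow> l2" is "\<lambda>c f x. c * f x"
  by (auto simp: l2_rel_def square_integrable_scale)

lift_definition uminus_l2 :: "l2 \<Rightarrow> l2" is "\<lambda>f x. - f x"
  using square_integrable_scale[where c = "-1"] by (auto simp: l2_rel_def)

definition minus_l2 :: "l2 \<Rightarrow> l2 \<Rightarrow> l2" where
  "minus_l2 u v = u + - v"

instance
proof
  fix u v w :: l2 and r s :: real
  show "u + v + w = u + (v + w)"
    by transfer (auto simp: l2_rel_def square_integrable_add add.assoc)
  show "u + v = v + u"
    by transfer (auto simp: l2_rel_def square_integrable_add add.commute)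
  show "0 + u = u"
    by transfer (auto simp: l2_rel_def)
  show "- u + u = 0"
    by transfer (auto simp: l2_rel_def square_integrable_zero)
  show "u - v = u + - v"
    by (rule minus_l2_def)
  show "r *\<^sub>R (u + v) = r *\<^sub>R u + r *\<^sub>R v"
    by transfer (auto simp: l2_rel_def distrib_left intro!: square_integrable_add square_integrable_scale)
  show "(r + s) *\<^sub>R u = r *\<^sub>R u + s *\<^sub>R u"
    by transfer (auto simp: l2_rel_def distrib_right intro!: square_integrable_add square_integrable_scale)
  show "r *\<^sub>R s *\<^sub>R u = (r * s) *\<^sub>R u"
    by transfer (auto simp: l2_rel_def mult.assoc intro!: square_integrable_scale)
  show "1 *\<^sub>R u = u"
    by transfer (auto simp: l2_rel_def)
qed

end

instantiation l2 :: real_inner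
begin

lift_definition inner_l2 :: "l2 \<Rightarrow> l2 \<Rightarrow> real" is "\<lambda>f g. LINT x|unit_leb. f x * g x"
  unfolding l2_rel_def square_integrable_def
  by (intro integral_cong_AE borel_measurable_times) auto

definition norm_l2 :: "l2 \<Rightarrow> real" where
  "norm_l2 u = sqrt (inner u u)"

definition sgn_l2 :: "l2 \<Rightarrow> l2" where
  "sgn_l2 u = u /\<^sub>R norm u"

definition dist_l2 :: "l2 \<Rightarrow> l2 \<Rightarrow> real" where
  "dist_l2 u v = norm (u - v)"

definition uniformity_l2 :: "(l2 \<times> l2) filter" where
  "uniformity_l2 = (INF e\<in>{0<..}. principal {(u, v). dist u v < e})"

definition open_l2 :: "l2 set \<Rightarrow> bool" where
  "open_l2 U \<longleftrightarrow> (\<forall>u\<in>U. eventually (\<lambda>(u', v). u' = u \<longrightarrow> v \<in> U) uniformity)"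

instance
proof
  fix u v w :: l2 and r s :: real
  show "sgn u = u /\<^sub>R norm u"
    by (rule sgn_l2_def)
  show "dist u v = norm (u - v)"
    by (rule dist_l2_def)
  show "uniformity = (INF e\<in>{0<..}. principal {(u, v). dist u (v::l2) < e})"
    by (rule uniformity_l2_def)
  show "open U \<longleftrightarrow> (\<forall>u\<in>U. eventually (\<lambda>(u', v). u' = u \<longrightarrow> v \<in> U) uniformity)" for U :: "l2 set"
    by (rule open_l2_def)
  show "norm u = sqrt (inner u u)"
    by (rule norm_l2_def)
  show "inner u v = inner v u"
    by transfer (simp add: mult.commute)
  show "inner (u + v) w = inner u w + inner v w"
    by transfer (simp add: l2_rel_def distrib_right square_integrable_mult)
  show "inner (r *\<^sub>R u) v = r * inner u v"
    by transfer (simp add: mult.assoc)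
  show "0 \<le> inner u u"
    by transfer simp
  show "inner u u = 0 \<longleftrightarrow> u = 0"
  proof transfer
    fix f assume "l2_rel f f"
    then have f: "square_integrable f" by (simp add: l2_rel_def)
    have "(LINT x|unit_leb. f x * f x) = 0 \<longleftrightarrow> (AE x in unit_leb. f x * f x = 0)"
      by (rule integral_nonneg_eq_0_iff_AE) (auto intro: square_integrable_mult f)
    then show "(LINT x|unit_leb. f x * f x) = 0 \<longleftrightarrow> l2_rel f (\<lambda>x. 0)"
      using f by (simp add: l2_rel_def square_integrable_zero)
  qed
qed

end

text \<open>Class of a function; the zero class if the function is not square integrable.\<close>
definition l2_of :: "(real \<Rightarrow> real) \<Rightarrow> l2" where
  "l2_of f = (if square_integrable f then abs_l2 f else 0)"

text \<open>In the following, \<open>rep_l2 u\<close> is an arbitrary representative of the class \<open>u\<close>;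
  everything defined through it depends on the class only.\<close>

definition l2_integral :: "l2 \<Rightarrow> real" where
  "l2_integral u = (LINT x|unit_leb. rep_l2 u x)"

definition l2_mult :: "(real \<Rightarrow> real) \<Rightarrow> l2 \<Rightarrow> l2" where
  "l2_mult a u = l2_of (\<lambda>x. a x * rep_l2 u x)"


section \<open>The Sobolev spaces \<open>H\<^sup>1(0,1)\<close> and \<open>H\<^sup>2(0,1)\<close>\<close>

text \<open>\<open>C\<close>-infinity functions with compact support in \<open>(0,1)\<close>\<close>
definition test_function :: "(real \<Rightarrow> real) \<Rightarrow> bool" where
  "test_function \<phi> \<longleftrightarrow> (\<forall>n. (deriv ^^ n) \<phi> differentiable_on UNIV) \<and>
     (\<exists>S. compact S \<and> S \<subseteq> {0<..<1} \<and> (\<forall>x. x \<notin> S \<longrightarrow> \<phi> x = 0))"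

definition has_weak_deriv :: "l2 \<Rightarrow> l2 \<Rightarrow> bool" where
  "has_weak_deriv u v \<longleftrightarrow> (\<forall>\<phi>. test_function \<phi> \<longrightarrow>
     (LINT x|unit_leb. rep_l2 u x * deriv \<phi> x) = - (LINT x|unit_leb. rep_l2 v x * \<phi> x))"

definition weak_deriv :: "l2 \<Rightarrow> l2" where
  "weak_deriv u = (THE v. has_weak_deriv u v)"

definition H1 :: "l2 set" where
  "H1 = {u. \<exists>v. has_weak_deriv u v}"

definition H2 :: "l2 set" where
  "H2 = {u \<in> H1. weak_deriv u \<in> H1}"

text \<open>Value at \<open>p \<in> [0,1]\<close> of the continuous representative of an \<open>H1\<close> class\<close>
definition point_value :: "l2 \<Rightarrow> real \<Rightarrow> real" where
  "point_value u p = (THE c. \<exists>g. continuous_on {0..1} g \<and> (AE x in unit_leb. rep_l2 u x = g x) \<and> c = g p)"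


section \<open>Strongly continuous semigroups and operator norms\<close>

text \<open>A normed space is given here by a linear subspace \<open>S\<close> of a real vector space together with a
  norm \<open>N\<close> on \<open>S\<close>, since the norm of the state space depends on parameters.\<close>

definition bounded_operator_on :: "'a::real_vector set \<Rightarrow> ('a \<Rightarrow> real) \<Rightarrow> ('a \<Rightarrow> 'a) \<Rightarrow> bool" where
  "bounded_operator_on S N F \<longleftrightarrow> F ` S \<subseteq> S \<and>
     (\<forall>x\<in>S. \<forall>y\<in>S. F (x + y) = F x + F y) \<and> (\<forall>x\<in>S. \<forall>c. F (c *\<^sub>R x) = c *\<^sub>R F x) \<and>
     (\<exists>B. \<forall>x\<in>S. N (F x) \<le> B * N x)"

definition C0_semigroup :: "'a::real_vector set \<Rightarrow> ('a \<Rightarrow> real) \<Rightarrow> (real \<Rightarrow> 'a \<Rightarrow> 'a) \<Rightarrow> bool" where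
  "C0_semigroup S N T \<longleftrightarrow> (\<forall>t\<ge>0. bounded_operator_on S N (T t)) \<and>
     (\<forall>x\<in>S. T 0 x = x) \<and> (\<forall>s\<ge>0. \<forall>t\<ge>0. \<forall>x\<in>S. T (s + t) x = T s (T t x)) \<and>
     (\<forall>x\<in>S. ((\<lambda>t. N (T t x - x)) \<longlongrightarrow> 0) (at_right 0))"

text \<open>The operator \<open>A\<close> with domain \<open>D\<close> is the infinitesimal generator of the semigroup \<open>T\<close>.\<close>
definition generates ::
  "'a::real_vector set \<Rightarrow> ('a \<Rightarrow> real) \<Rightarrow> 'a set \<Rightarrow> ('a \<Rightarrow> 'a) \<Rightarrow> (real \<Rightarrow> 'a \<Rightarrow> 'a) \<Rightarrow> bool" where
  "generates S N D A T \<longleftrightarrow> C0_semigroup S N T \<and> D \<subseteq> S \<and>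
     (\<forall>x\<in>S. \<forall>w\<in>S. ((\<lambda>h. N ((1 / h) *\<^sub>R (T h x - x) - w)) \<longlongrightarrow> 0) (at_right 0) \<longleftrightarrow> x \<in> D \<and> w = A x)"

definition graph_norm :: "('a \<Rightarrow> real) \<Rightarrow> ('a \<Rightarrow> 'a) \<Rightarrow> 'a \<Rightarrow> real" where
  "graph_norm N A x = N x + N (A x)"

text \<open>Norm of \<open>F\<close> as an operator from \<open>D\<close> with norm \<open>G\<close> into a space with norm \<open>N\<close>
  (compare \<open>onorm\<close>); for linear \<open>F\<close> it is infinite exactly if \<open>F\<close> is unbounded.\<close>
definition op_norm :: "'a set \<Rightarrow> ('a \<Rightarrow> real) \<Rightarrow> ('b \<Rightarrow> real) \<Rightarrow> ('a \<Rightarrow> 'b) \<Rightarrow> ereal" where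
  "op_norm D G N F = (SUP x\<in>D. ereal (N (F x) / G x))"


section \<open>State space and system operator\<close>

type_synonym state = "l2 \<times> l2 \<times> l2 \<times> real \<times> real"

definition X_space :: "state set" where
  "X_space = {(y, z, u, \<xi>, \<eta>). y \<in> H1}"

text \<open>Usual norm of \<open>H\<^sup>1 \<times> L\<^sup>2 \<times> L\<^sup>2 \<times> \<real>\<^sup>2\<close>\<close>
definition X_product_norm :: "state \<Rightarrow> real" where
  "X_product_norm = (\<lambda>(y, z, u, \<xi>, \<eta>).
     sqrt ((norm y)\<^sup>2 + (norm (weak_deriv y))\<^sup>2 + (norm z)\<^sup>2 + (norm u)\<^sup>2 + \<xi>\<^sup>2 + \<eta>\<^sup>2))"

definition ell :: "real \<Rightarrow> real \<Rightarrow> real \<Rightarrow> real \<Rightarrow> real \<Rightarrow> state \<Rightarrow> real" where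
  "ell m M \<tau> \<alpha> \<beta> = (\<lambda>(y, z, u, \<xi>, \<eta>).
     l2_integral z + m * \<xi> + M * \<eta> + (\<beta> - \<alpha>) * point_value y 0 + \<tau> * \<alpha> * l2_integral u)"

definition X_inner ::
  "(real \<Rightarrow> real) \<Rightarrow> real \<Rightarrow> real \<Rightarrow> real \<Rightarrow> real \<Rightarrow> real \<Rightarrow> real \<Rightarrow> real \<Rightarrow> state \<Rightarrow> state \<Rightarrow> real" where
  "X_inner a m M \<tau> \<alpha> \<beta> K \<omega> = (\<lambda>(y, z, u, \<xi>, \<eta>) (y', z', u', \<xi>', \<eta>').
     inner (l2_mult a (weak_deriv y)) (weak_deriv y') + inner z z' + K * \<tau> * inner u u'
       + m * \<xi> * \<xi>' + M * \<eta> * \<eta>'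
       + \<omega> * ell m M \<tau> \<alpha> \<beta> (y, z, u, \<xi>, \<eta>) * ell m M \<tau> \<alpha> \<beta> (y', z', u', \<xi>', \<eta>'))"

definition X_norm ::
  "(real \<Rightarrow> real) \<Rightarrow> real \<Rightarrow> real \<Rightarrow> real \<Rightarrow> real \<Rightarrow> real \<Rightarrow> real \<Rightarrow> real \<Rightarrow> state \<Rightarrow> real" where
  "X_norm a m M \<tau> \<alpha> \<beta> K \<omega> v = sqrt (X_inner a m M \<tau> \<alpha> \<beta> K \<omega> v v)"

text \<open>Admissibility of the weight \<open>\<omega>\<close>. Completeness is not listed: it is inherited from the
  product norm through the equivalence of norms.\<close>
definition admissible_weight ::
  "(real \<Rightarrow> real) \<Rightarrow> real \<Rightarrow> real \<Rightarrow> real \<Rightarrow> real \<Rightarrow> real \<Rightarrow> real \<Rightarrow> real \<Rightarrow> bool" where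
  "admissible_weight a m M \<tau> \<alpha> \<beta> K \<omega> \<longleftrightarrow> \<omega> > 0 \<and>
     (\<exists>c1>0. \<exists>c2>0. \<forall>v\<in>X_space. c1 * X_product_norm v \<le> X_norm a m M \<tau> \<alpha> \<beta> K \<omega> v \<and>
        X_norm a m M \<tau> \<alpha> \<beta> K \<omega> v \<le> c2 * X_product_norm v)"

definition A_dom :: "state set" where
  "A_dom = {(y, z, u, \<xi>, \<eta>). y \<in> H2 \<and> z \<in> H1 \<and> u \<in> H1 \<and>
     \<xi> = point_value u 0 \<and> \<xi> = point_value z 0 \<and> \<eta> = point_value z 1}"

definition A_op ::
  "(real \<Rightarrow> real) \<Rightarrow> real \<Rightarrow> real \<Rightarrow> real \<Rightarrow> real \<Rightarrow> real \<Rightarrow> state \<Rightarrow> state" where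
  "A_op a m M \<tau> \<alpha> \<beta> = (\<lambda>(y, z, u, \<xi>, \<eta>).
     let \<sigma> = l2_mult a (weak_deriv y)
     in (z, weak_deriv \<sigma>, - (1 / \<tau>) *\<^sub>R weak_deriv u,
         1 / m * (point_value \<sigma> 0 - \<beta> * \<xi> + \<alpha> * point_value u 1),
         - (point_value \<sigma> 1 / M)))"

definition X_dot :: "real \<Rightarrow> real \<Rightarrow> real \<Rightarrow> real \<Rightarrow> real \<Rightarrow> state set" where
  "X_dot m M \<tau> \<alpha> \<beta> = {(y, z, u, \<xi>, \<eta>) \<in> X_space.
     l2_integral z + \<alpha> * \<tau> * l2_integral u + (\<beta> - \<alpha>) * point_value y 0 + m * \<xi> + M * \<eta> = 0}"

definition A_dot_dom :: "real \<Rightarrow> real \<Rightarrow> real \<Rightarrow> real \<Rightarrow> real \<Rightarrow> state set" where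
  "A_dot_dom m M \<tau> \<alpha> \<beta> = A_dom \<inter> X_dot m M \<tau> \<alpha> \<beta>"

end

theory Submission
  imports Defs "HOL-Computational_Algebra.Polynomial"
begin

text \<open>
  The decay rate comes from an observability estimate that loses one time derivative, proved with
  multipliers in the time domain; neither the spectrum of the generator nor its resolvent enters.

  On the subspace \<open>X_dot\<close> the functional \<open>ell\<close> vanishes, so the squared norm of a state is twice the
  energy stored in the string, the two masses and the delay line. Along a solution this quantity decreases at a
  rate that dominates \<open>\<xi>\<^sup>2 + u(1)\<^sup>2\<close>, where \<open>\<xi>\<close> is the velocity of the left end
  (\<open>dissipation\<close>; this is where \<open>\<bar>\<alpha>\<bar> < K < 2 \<beta> - \<bar>\<alpha>\<bar>\<close> is used). Put \<open>\<sigma> = a y\<^sub>x\<close>.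
  The multiplier \<open>(2 - x) y\<^sub>x\<close>, whose weight decreases and stays positive while \<open>1 / a\<close> does not
  increase, bounds the whole mechanical energy, including that of the mass at \<open>x = 1\<close>, by
  the time derivative of a bounded functional plus a multiple of \<open>\<xi>\<^sup>2 + \<sigma>(0)\<^sup>2\<close>. The same weight treats
  the transport equation of the delay line (\<open>lyapunov_estimate\<close>). The trace \<open>\<sigma>(0)\<close> is not dissipated.
  The equation of motion of the left mass expresses it through \<open>\<xi>'\<close>, \<open>\<xi>\<close> and \<open>u(1)\<close>, and \<open>\<xi>'\<close> is the
  dissipated quantity of the differentiated solution. Hence the time integral of the energy is bounded by
  the squared graph norm of the initial state. Since the energy does not increase, after time \<open>t\<close> it is
  at most this bound divided by \<open>t\<close>, and its square root decays like \<open>1 / \<surd>t\<close>.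

  The argument is carried out for an abstract dissipative semigroup with a bounded observation \<open>q\<close>
  and a bounded bilinear form \<open>b\<close> (\<open>inverse_sqrt_decay\<close>). Solutions are a priori only
  differentiable from the right, and the semigroup is only known to be strongly continuous at time \<open>0\<close>
  with each operator bounded. Completeness of the state space and a gliding hump argument give local
  uniform boundedness (\<open>locally_bounded\<close>), hence continuous orbits, and a continuous function with
  nonpositive right derivatives does not increase. The differentiated solution need not lie
  in the domain of the generator, so it is replaced by difference quotients, which do.

  The rest is analysis on \<open>(0,1)\<close>. An \<open>H\<^sup>1\<close> class has a representative that is the primitive of its weak
  derivative (\<open>has_weak_deriv_obtain_primitive\<close>). Products of such primitives obey the product rule,
  which gives integration by parts with boundary values and all multiplier identities. \<open>L\<^sup>2(0,1)\<close> is
  shown to be complete along sequences with geometrically decreasing steps, which suffices for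
  the gliding hump.
\<close>

section \<open>Smooth functions with compact support\<close>

text \<open>
  With \<open>q x = (x - s) * (t - x)\<close>, functions of the form \<open>P / q ^ n * exp (- k / q)\<close> on \<open>(s, t)\<close>, extended by
  zero, are closed under differentiation. So all of them are smooth once each is seen to be differentiable.
\<close>

definition bump :: "real \<Rightarrow> real \<Rightarrow> real \<Rightarrow> real poly \<Rightarrow> nat \<Rightarrow> real \<Rightarrow> real" where
  "bump k s t P n x = (if s < x \<and> x < t
     then poly P x / ((x - s) * (t - x)) ^ n * exp (- k / ((x - s) * (t - x))) else 0)"

text \<open>The factor \<open>exp (- k / q)\<close> beats every power of \<open>1 / q\<close>; two powers of \<open>q\<close> are left over, which is
  what differentiability at the end points of the support needs.\<close>
lemma exp_minus_inverse_le:
  fixes k q :: real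
  assumes "k > 0" "q > 0"
  shows "exp (- k / q) / q ^ n \<le> (real (n + 2) / k) ^ (n + 2) * q\<^sup>2"
proof -
  define N where "N = n + 2"
  have "(k / q / real N) ^ N \<le> (1 + (k / q) / real N) ^ N"
    using assms by (intro power_mono) (auto simp: N_def)
  also have "\<dots> \<le> exp (k / q)"
    using assms by (intro exp_ge_one_plus_x_over_n_power_n) (auto simp: N_def intro: order_trans[of _ 0])
  finally have "exp (- k / q) * (k / q / real N) ^ N \<le> exp (- k / q) * exp (k / q)"
    by (intro mult_left_mono) auto
  then have le: "exp (- k / q) * (k / q / real N) ^ N \<le> 1"
    by (simp flip: exp_add)
  have "(k / q / real N) ^ N * (real N / k) ^ N = (1 / q) ^ N"
    using assms by (simp add: N_def flip: power_mult_distrib)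
  also have "\<dots> * q\<^sup>2 = 1 / q ^ n"
    using assms by (simp add: N_def power_divide power_add power2_eq_square)
  finally have "exp (- k / q) / q ^ n = exp (- k / q) * (k / q / real N) ^ N * ((real N / k) ^ N * q\<^sup>2)"
    by (simp add: mult.assoc)
  also have "\<dots> \<le> 1 * ((real N / k) ^ N * q\<^sup>2)"
    using le assms by (intro mult_right_mono) auto
  finally show ?thesis
    by (simp add: N_def)
qed

lemma bump_has_derivative_inside:
  assumes "s < x" "x < t" 
  shows "(bump k s t P n has_real_derivative
     bump k s t (pderiv P * [:- s * t, s + t, -1:]\<^sup>2 - smult (of_nat n) (P * [:s + t, -2:] * [:- s * t, s + t, -1:])
       + smult k (P * [:s + t, -2:])) (n + 2) x) (at x)"
proof -
  define q where "q = (\<lambda>x. (x - s) * (t - x))"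
  define f where "f = (\<lambda>x. poly P x / q x ^ n * exp (- k / q x))"
  have q0: "q x \<noteq> 0"
    using assms by (simp add: q_def)
  have polyq: "poly [:- s * t, s + t, -1:] y = q y" for y
    by (simp add: q_def algebra_simps)
  define Q where "Q = pderiv P * [:- s * t, s + t, -1:]\<^sup>2 - smult (of_nat n) (P * [:s + t, -2:] * [:- s * t, s + t, -1:])
       + smult k (P * [:s + t, -2:])"
  have "poly [:s + t, -2:] x = s + t - 2 * x"
    by simp
  then have polyQ: "poly Q x = poly (pderiv P) x * (q x)\<^sup>2 - real n * (poly P x * (s + t - 2 * x) * q x)
      + k * (poly P x * (s + t - 2 * x))"
    by (simp only: Q_def poly_add poly_diff poly_mult poly_smult poly_power polyq of_nat_id)
  have dq: "(q has_real_derivative s + t - 2 * x) (at x)"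
    unfolding q_def by (auto intro!: derivative_eq_intros)
  have "(f has_real_derivative
     ((poly (pderiv P) x * q x ^ n - poly P x * (real n * q x ^ (n - 1) * (s + t - 2 * x))) / (q x ^ n)\<^sup>2) * exp (- k / q x)
      + poly P x / q x ^ n * (exp (- k / q x) * (k * (s + t - 2 * x) / (q x)\<^sup>2))) (at x)"
    unfolding f_def
  proof (rule DERIV_cong[OF DERIV_mult[where s = UNIV]])
    show "((\<lambda>x. poly P x / q x ^ n) has_real_derivative
       (poly (pderiv P) x * q x ^ n - poly P x * (real n * q x ^ (n - 1) * (s + t - 2 * x))) / (q x ^ n)\<^sup>2) (at x)"
      using q0 by (auto intro!: derivative_eq_intros poly_DERIV dq simp: power2_eq_square)
    show "((\<lambda>x. exp (- k / q x)) has_real_derivative exp (- k / q x) * (k * (s + t - 2 * x) / (q x)\<^sup>2)) (at x)"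
      using q0 by (auto intro!: derivative_eq_intros dq simp: power2_eq_square)
  qed (simp add: mult_ac)
  moreover have "(p' * r ^ n - p * (real n * r ^ (n - 1) * d)) / (r ^ n)\<^sup>2 * e + p / r ^ n * (e * (k * d / r\<^sup>2))
    = (p' * r\<^sup>2 - real n * (p * d * r) + k * (p * d)) / r ^ (n + 2) * e" if "r \<noteq> 0" for p p' r d e :: real
  proof -
    have "(p' * r ^ n - p * (real n * r ^ (n - 1) * d)) / (r ^ n)\<^sup>2 = (p' * r\<^sup>2 - real n * (p * d * r)) / r ^ (n + 2)"
    proof (cases n)
      case (Suc j)
      define R where "R = r ^ j"
      have "R \<noteq> 0"
        using that by (simp add: R_def)
      then show ?thesis
        using that by (simp add: Suc power2_eq_square R_def[symmetric] divide_simps) algebra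
    qed (use that in \<open>simp add: power2_eq_square\<close>)
    moreover have "p / r ^ n * (e * (k * d / r\<^sup>2)) = k * (p * d) / r ^ (n + 2) * e"
      by (simp add: power_add power2_eq_square mult_ac)
    ultimately show ?thesis
      by (simp add: add_divide_distrib distrib_right)
  qed
  note this[OF q0, of "poly (pderiv P) x" "poly P x" "s + t - 2 * x" "exp (- k / q x)"]
  moreover have "bump k s t Q (n + 2) x = (poly (pderiv P) x * (q x)\<^sup>2 - real n * (poly P x * (s + t - 2 * x) * q x)
      + k * (poly P x * (s + t - 2 * x))) / q x ^ (n + 2) * exp (- k / q x)"
    using assms by (simp only: bump_def polyQ q_def if_True simp_thms)
  ultimately have "(f has_real_derivative bump k s t Q (n + 2) x) (at x)"
    by (simp only:)
  then show ?thesis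
    unfolding Q_def
    by (rule has_field_derivative_transform_within_open[where S = "{s<..<t}"])
       (use assms in \<open>auto simp: f_def bump_def q_def Q_def\<close>)
qed

text \<open>Near a point outside \<open>(s, t)\<close> the function is bounded by a multiple of the squared distance to that point.\<close>
lemma bump_has_derivative_outside:
  assumes "k > 0" "s < t" "x \<le> s \<or> t \<le> x"
  shows "(bump k s t P n has_real_derivative 0) (at x)"
proof -
  have "bounded (poly P ` {s..t})"
    by (intro compact_imp_bounded compact_continuous_image continuous_intros) auto
  then obtain B where B: "\<And>y. y \<in> {s..t} \<Longrightarrow> \<bar>poly P y\<bar> \<le> B"
    unfolding bounded_iff by (metis image_eqI real_norm_def)
  define c where "c = B * ((real (n + 2) / k) ^ (n + 2) * (t - s)\<^sup>2)"
  have B0: "B \<ge> 0"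
    using B[of s] assms by simp
  then have c0: "c \<ge> 0"
    using assms by (simp add: c_def)
  have bound: "\<bar>bump k s t P n y\<bar> \<le> c * (y - x)\<^sup>2" for y
  proof (cases "s < y \<and> y < t")
    case True
    define q where "q = (y - s) * (t - y)"
    have q: "0 < q"
      using True by (simp add: q_def)
    have "q \<le> \<bar>y - x\<bar> * (t - s)"
    proof (cases "x \<le> s")
      case True
      then show ?thesis unfolding q_def using \<open>s < y \<and> y < t\<close>
        by (intro mult_mono) auto
    next
      case False
      then have "(t - y) * (y - s) \<le> \<bar>y - x\<bar> * (t - s)"
        using \<open>s < y \<and> y < t\<close> assms by (intro mult_mono) auto
      then show ?thesis by (simp add: q_def mult.commute)
    qed
    then have q2: "q\<^sup>2 \<le> (\<bar>y - x\<bar> * (t - s))\<^sup>2"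
      using q by (intro power_mono) auto
    have "\<bar>bump k s t P n y\<bar> = \<bar>poly P y\<bar> * (exp (- k / q) / q ^ n)"
      using True q by (simp add: bump_def abs_mult q_def[symmetric])
    also have "\<dots> \<le> B * ((real (n + 2) / k) ^ (n + 2) * q\<^sup>2)"
      using B[of y] True q assms B0 by (intro mult_mono exp_minus_inverse_le) auto
    also have "\<dots> \<le> B * ((real (n + 2) / k) ^ (n + 2) * (\<bar>y - x\<bar> * (t - s))\<^sup>2)"
      using B0 assms q2 by (intro mult_left_mono) auto
    finally show ?thesis
      by (simp add: c_def power_mult_distrib mult_ac)
  next
    case False
    then show ?thesis
      using c0 by (simp only: bump_def if_False abs_zero) simp
  qed
  have "bump k s t P n x = 0"
    using assms by (auto simp: bump_def)
  moreover have "((\<lambda>y. bump k s t P n y / (y - x)) \<longlongrightarrow> 0) (at x)"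
  proof (rule Lim_null_comparison)
    show "\<forall>\<^sub>F y in at x. norm (bump k s t P n y / (y - x)) \<le> c * \<bar>y - x\<bar>"
    proof (rule eventually_at[THEN iffD2], rule exI[of _ 1], intro conjI ballI impI)
      fix y :: real assume "y \<noteq> x \<and> dist y x < 1"
      then show "norm (bump k s t P n y / (y - x)) \<le> c * \<bar>y - x\<bar>"
        using bound[of y] by (simp add: divide_le_eq power2_eq_square mult.assoc flip: abs_mult)
    qed auto
    show "((\<lambda>y. c * \<bar>y - x\<bar>) \<longlongrightarrow> 0) (at x)"
      by (auto intro!: tendsto_eq_intros)
  qed
  ultimately show ?thesis
    by (simp add: has_field_derivative_iff)
qed

lemma deriv_bump:
  assumes "k > 0" "s < t"
  shows "\<exists>Q l. \<forall>x. (bump k s t P n has_real_derivative bump k s t Q l x) (at x)"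
proof (intro exI allI)
  fix x
  show "(bump k s t P n has_real_derivative
     bump k s t (pderiv P * [:- s * t, s + t, -1:]\<^sup>2 - smult (of_nat n) (P * [:s + t, -2:] * [:- s * t, s + t, -1:])
       + smult k (P * [:s + t, -2:])) (n + 2) x) (at x)"
  proof (cases "s < x \<and> x < t")
    case True
    then show ?thesis using bump_has_derivative_inside by blast
  next
    case False
    then show ?thesis using bump_has_derivative_outside[OF assms, of x P n]
      by (auto simp: bump_def)
  qed
qed

lemma iterated_deriv_bump:
  assumes "k > 0" "s < t"
  shows "\<exists>Q l. (deriv ^^ j) (bump k s t P n) = bump k s t Q l"
proof (induction j)
  case 0
  then show ?case by auto
next
  case (Suc j)
  then obtain Q l where "(deriv ^^ j) (bump k s t P n) = bump k s t Q l" by auto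
  moreover obtain Q' l' where "\<And>x. (bump k s t Q l has_real_derivative bump k s t Q' l' x) (at x)"
    using deriv_bump[OF assms] by blast
  then have "deriv (bump k s t Q l) = bump k s t Q' l'"
    by (intro ext DERIV_imp_deriv)
  ultimately show ?case by auto
qed

lemma bump_smooth:
  assumes "k > 0" "s < t"
  shows "(deriv ^^ j) (bump k s t P n) differentiable_on UNIV"
proof -
  obtain Q l where "(deriv ^^ j) (bump k s t P n) = bump k s t Q l"
    using iterated_deriv_bump[OF assms] by blast
  moreover obtain Q' l' where "\<And>x. (bump k s t Q l has_real_derivative bump k s t Q' l' x) (at x)"
    using deriv_bump[OF assms] by blast
  then have "bump k s t Q l differentiable_on UNIV"
    by (auto simp: differentiable_on_def real_differentiable_def)
  ultimately show ?thesis by simp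
qed

text \<open>As \<open>k\<close> tends to \<open>0\<close> these functions increase to the indicator of \<open>(s, t)\<close>.\<close>
definition mollified_indicator :: "real \<Rightarrow> real \<Rightarrow> real \<Rightarrow> real \<Rightarrow> real" where
  "mollified_indicator k s t = bump k s t 1 0"

lemma continuous_mollified_indicator:
  assumes "k > 0" "s < t"
  shows "continuous_on UNIV (mollified_indicator k s t)"
  using bump_smooth[OF assms, where j = 0] by (auto simp: mollified_indicator_def intro: differentiable_imp_continuous_on)

lemma test_function_mollified_indicator:
  assumes "k > 0" "0 < s" "s < t" "t < 1"
  shows "test_function (mollified_indicator k s t)"
  unfolding test_function_def mollified_indicator_def
proof (intro conjI allI)
  show "\<exists>S. compact S \<and> S \<subseteq> {0<..<1} \<and> (\<forall>x. x \<notin> S \<longrightarrow> bump k s t 1 0 x = 0)"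
    by (rule exI[of _ "{s..t}"]) (use assms in \<open>auto simp: bump_def\<close>)
qed (use assms bump_smooth in auto)

lemma deriv_differentiable_on_cong:
  "deriv F = g \<Longrightarrow> F differentiable_on UNIV \<Longrightarrow> (\<And>j. (deriv ^^ j) g differentiable_on UNIV) \<Longrightarrow>
    (deriv ^^ j) F differentiable_on UNIV"
  by (cases j) (auto simp: funpow_swap1)

lemma iterated_deriv_linear:
  fixes f g :: "real \<Rightarrow> real"
  assumes "\<And>j. (deriv ^^ j) f differentiable_on UNIV" "\<And>j. (deriv ^^ j) g differentiable_on UNIV"
  shows "(deriv ^^ j) (\<lambda>x. f x - c * g x) = (\<lambda>x. (deriv ^^ j) f x - c * (deriv ^^ j) g x)"
proof (induction j)
  case (Suc j)
  have "((\<lambda>x. (deriv ^^ j) f x - c * (deriv ^^ j) g x) has_real_derivative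
      deriv ((deriv ^^ j) f) x - c * deriv ((deriv ^^ j) g) x) (at x)" for x
    using assms[of j] by (intro DERIV_diff DERIV_cmult)
      (auto simp: differentiable_on_def DERIV_deriv_iff_real_differentiable real_differentiable_def)
  then have "deriv (\<lambda>x. (deriv ^^ j) f x - c * (deriv ^^ j) g x) =
      (\<lambda>x. deriv ((deriv ^^ j) f) x - c * deriv ((deriv ^^ j) g) x)"
    by (intro ext DERIV_imp_deriv)
  with Suc show ?case by simp
qed simp

lemma test_function_antiderivative:
  assumes f: "\<And>j. (deriv ^^ j) f differentiable_on UNIV"
    and st: "0 < s" "s < t" "t < 1" "\<And>x. x \<notin> {s..t} \<Longrightarrow> f x = 0"
    and int: "integral {0..1} f = 0"
  shows "\<exists>F. test_function F \<and> deriv F = f"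
proof -
  have cont: "continuous_on UNIV f"
    using f[of 0] by (auto intro: differentiable_imp_continuous_on)
  obtain G where G: "\<And>x. -1 \<le> x \<Longrightarrow> x \<le> 2 \<Longrightarrow> (G has_vector_derivative f x) (at x within {-1..2})"
    using antiderivative_continuous[of "-1" 2 f] cont continuous_on_subset
    by (metis atLeastAtMost_iff subset_UNIV)
  \<comment> \<open>The antiderivative \<open>G\<close> is constant on either side of \<open>[s, t]\<close>, with the same value because the mean vanishes.\<close>
  define F where "F = (\<lambda>x. if x \<in> {s..t} then G x - G s else 0)"
  have G': "(G has_real_derivative f x) (at x)" if "-1 < x" "x < 2" for x
    using G[of x] that at_within_interior[of x "{-1..2}"]
    by (simp add: has_real_derivative_iff_has_vector_derivative)
  have eqc: "G x = G y" if "-1 < x" "x \<le> y" "y < 2" and zero: "\<And>z. x < z \<Longrightarrow> z < y \<Longrightarrow> f z = 0" for x y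
  proof (cases "x = y")
    case False
    then have "x < y" using that by simp
    moreover have "continuous_on {x..y} G"
      using that by (intro DERIV_continuous_on[of _ _ f] has_field_derivative_at_within[OF G']) auto
    moreover have "(G has_real_derivative 0) (at z)" if "x < z" "z < y" for z
      using G'[of z] \<open>- 1 < x\<close> \<open>y < 2\<close> zero[of z] that by simp
    ultimately show ?thesis
      using DERIV_isconst_end[of x y G] by simp
  qed simp
  have "(f has_integral (G 1 - G 0)) {0..1}"
  proof (rule fundamental_theorem_of_calculus)
    show "(G has_vector_derivative f x) (at x within {0..1})" if "x \<in> {0..1}" for x
      using G'[of x] that by (simp add: has_real_derivative_iff_has_vector_derivative has_vector_derivative_at_within)
  qed simp
  from integral_unique[OF this] have "G 1 - G 0 = 0"
    using int by simp
  moreover have "G 0 = G s" "G t = G 1"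
    using st by (auto intro!: eqc)
  ultimately have Gst: "G t = G s" by simp
  have FG: "F x = G x - G s" if "-1 < x" "x < 2" for x
  proof -
    have "x < s \<Longrightarrow> G x = G s" "t < x \<Longrightarrow> G t = G x"
      using that st by (auto intro!: eqc)
    then show ?thesis using Gst by (auto simp: F_def not_le)
  qed
  have F': "(F has_real_derivative f x) (at x)" for x
  proof (cases "-1 < x \<and> x < 2")
    case True
    have "((\<lambda>x. G x - G s) has_real_derivative f x) (at x)"
      using G'[of x] True by (auto intro!: derivative_eq_intros)
    then show ?thesis
      by (rule has_field_derivative_transform_within_open[where S = "{-1<..<2}"]) (use True FG in auto)
  next
    case False
    have "((\<lambda>x. 0) has_real_derivative f x) (at x)"
      using st False by auto
    then show ?thesis
      by (rule has_field_derivative_transform_within_open[where S = "- {s..t}"]) (use False st in \<open>auto simp: F_def\<close>)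
  qed
  then have dF: "deriv F = f"
    by (intro ext DERIV_imp_deriv)
  have "F differentiable_on UNIV"
    using F' by (auto simp: differentiable_on_def real_differentiable_def)
  then have "\<forall>n. (deriv ^^ n) F differentiable_on UNIV"
    using dF f by (auto intro: deriv_differentiable_on_cong)
  moreover have "\<exists>S. compact S \<and> S \<subseteq> {0<..<1} \<and> (\<forall>x. x \<notin> S \<longrightarrow> F x = 0)"
    by (rule exI[of _ "{s..t}"]) (use st in \<open>auto simp: F_def\<close>)
  ultimately show ?thesis
    using dF unfolding test_function_def by blast
qed

section \<open>Lebesgue measure on the unit interval\<close>

lemma space_unit_leb [simp]: "space unit_leb = {0<..<1}"
  by (simp add: space_restrict_space)

lemma AE_unit_leb_in: "AE x in unit_leb. 0 < x \<and> x < 1"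
  by (rule AE_I2) simp

lemma finite_measure_unit_leb: "finite_measure unit_leb"
  by (rule finite_measure_lebesgue_on) auto

interpretation unit_leb: finite_measure unit_leb
  by (rule finite_measure_unit_leb)

interpretation unit_leb_pair: pair_sigma_finite unit_leb unit_leb
  by unfold_locales

lemma borel_measurable_unit_lebI:
  "f \<in> borel_measurable borel \<Longrightarrow> f \<in> borel_measurable unit_leb"
  by (intro measurable_restrict_space1 measurable_completion) simp

lemma continuous_on_imp_measurable_unit_leb:
  fixes f :: "real \<Rightarrow> real"
  assumes "continuous_on {0..1} f"
  shows "f \<in> borel_measurable unit_leb"
  by (rule continuous_imp_measurable_on_sets_lebesgue)
    (auto intro: continuous_on_subset[OF assms])

lemma continuous_on_unit_bounded:
  fixes f :: "real \<Rightarrow> real"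
  assumes "continuous_on {0..1} f"
  obtains B where "B \<ge> 0" "\<And>x. 0 \<le> x \<Longrightarrow> x \<le> 1 \<Longrightarrow> \<bar>f x\<bar> \<le> B"
proof -
  have "bounded (f ` {0..1})"
    by (intro compact_imp_bounded compact_continuous_image assms) auto
  then obtain B where B: "\<And>x. x \<in> {0..1} \<Longrightarrow> \<bar>f x\<bar> \<le> B"
    unfolding bounded_iff by (metis image_eqI real_norm_def)
  show thesis
    using B[of 0] by (intro that[of B] B) auto
qed

lemma integrable_mult_continuous:
  fixes f g :: "real \<Rightarrow> real"
  assumes "integrable unit_leb f" "continuous_on {0..1} g"
  shows "integrable unit_leb (\<lambda>x. f x * g x)"
proof -
  obtain B where B: "B \<ge> 0" "\<And>x. 0 \<le> x \<Longrightarrow> x \<le> 1 \<Longrightarrow> \<bar>g x\<bar> \<le> B"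
    using continuous_on_unit_bounded[OF assms(2)] by blast
  show ?thesis
  proof (rule Bochner_Integration.integrable_bound)
    show "integrable unit_leb (\<lambda>x. B * f x)"
      using assms by simp
    show "(\<lambda>x. f x * g x) \<in> borel_measurable unit_leb"
      using assms continuous_on_imp_measurable_unit_leb by (auto intro!: borel_measurable_times)
    show "AE x in unit_leb. norm (f x * g x) \<le> norm (B * f x)"
      by (rule AE_I2) (use B in \<open>auto simp: abs_mult mult.commute[of B] intro!: mult_left_mono\<close>)
  qed
qed

lemma integrable_indicator_mult:
  fixes f :: "real \<Rightarrow> real"
  assumes "integrable unit_leb f" "A \<in> sets borel"
  shows "integrable unit_leb (\<lambda>x. indicator A x * f x)"
proof (rule Bochner_Integration.integrable_bound[OF assms(1)])
  show "(\<lambda>x. indicator A x * f x) \<in> borel_measurable unit_leb"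
    using assms by (intro borel_measurable_times borel_measurable_unit_lebI[of "indicator A"]) auto
qed (auto simp: indicator_def)

lemma integrable_continuous_unit:
  fixes g :: "real \<Rightarrow> real"
  assumes "continuous_on {0..1} g"
  shows "integrable unit_leb g"
  using integrable_mult_continuous[of "\<lambda>x. 1" g] assms by simp

section \<open>Test functions separate integrable functions\<close>

lemma mollified_indicator_tendsto:
  assumes "s < t"
  shows "(\<lambda>n. mollified_indicator (1 / real (Suc n)) s t x) \<longlonglongrightarrow> indicator {s<..<t} x"
proof (cases "s < x \<and> x < t")
  case True
  have "(\<lambda>n. exp (- (1 / real (Suc n)) / ((x - s) * (t - x)))) \<longlonglongrightarrow> exp (- 0 / ((x - s) * (t - x)))"
    using True by (intro tendsto_intros LIMSEQ_Suc lim_1_over_n) auto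
  then show ?thesis
    using True by (simp add: mollified_indicator_def bump_def)
qed (auto simp: mollified_indicator_def bump_def)

lemma mollified_indicator_bounds:
  assumes "k > 0"
  shows "0 \<le> mollified_indicator k s t x" "mollified_indicator k s t x \<le> 1"
  using assms by (auto simp: mollified_indicator_def bump_def)

text \<open>Mollified indicators reach intervals that are compactly contained in \<open>(0,1)\<close>; arbitrary intervals are
  exhausted by these.\<close>
lemma integral_interval_eq_zero:
  fixes f :: "real \<Rightarrow> real"
  assumes f: "integrable unit_leb f"
    and test: "\<And>\<phi>. test_function \<phi> \<Longrightarrow> (LINT x|unit_leb. f x * \<phi> x) = 0"
  shows "(LINT x|unit_leb. indicator {a<..<b} x * f x) = 0"
proof -
  have inner: "(LINT x|unit_leb. indicator {s<..<t} x * f x) = 0" if "0 < s" "t < 1" for s t :: real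
  proof (cases "s < t")
    case True
    have "(\<lambda>n. LINT x|unit_leb. mollified_indicator (1 / real (Suc n)) s t x * f x)
        \<longlonglongrightarrow> (LINT x|unit_leb. indicator {s<..<t} x * f x)"
    proof (rule integral_dominated_convergence[where w = "\<lambda>x. \<bar>f x\<bar>"])
      show "AE x in unit_leb. (\<lambda>n. mollified_indicator (1 / real (Suc n)) s t x * f x) \<longlonglongrightarrow> indicator {s<..<t} x * f x"
        by (intro AE_I2 tendsto_intros mollified_indicator_tendsto True)
      show "AE x in unit_leb. norm (mollified_indicator (1 / real (Suc n)) s t x * f x) \<le> \<bar>f x\<bar>" for n
        using mollified_indicator_bounds[of "1 / real (Suc n)" s t]
        by (intro AE_I2) (auto simp: abs_mult mult_left_le_one_le)
      show "(\<lambda>x. indicator {s<..<t} x * f x) \<in> borel_measurable unit_leb"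
        by (intro borel_measurable_integrable integrable_indicator_mult f) auto
      show "(\<lambda>x. mollified_indicator (1 / real (Suc n)) s t x * f x) \<in> borel_measurable unit_leb" for n
        using f True continuous_mollified_indicator[of "1 / real (Suc n)" s t]
        by (intro borel_measurable_times borel_measurable_integrable[OF f] borel_measurable_unit_lebI
            borel_measurable_continuous_onI) auto
    qed (use f in auto)
    moreover have "(LINT x|unit_leb. mollified_indicator (1 / real (Suc n)) s t x * f x) = 0" for n
      using test[OF test_function_mollified_indicator[of "1 / real (Suc n)" s t]] that True
      by (simp add: mult.commute)
    ultimately show ?thesis
      by (simp add: LIMSEQ_const_iff)
  qed simp
  define e where "e = (\<lambda>n. 1 / real (n + 2))"
  have e: "e \<longlonglongrightarrow> 0" unfolding e_def
    using LIMSEQ_ignore_initial_segment[OF lim_1_over_n, of 2] by simp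
  have "(\<lambda>n. LINT x|unit_leb. indicator {max a (e n)<..<min b (1 - e n)} x * f x)
        \<longlonglongrightarrow> (LINT x|unit_leb. indicator {a<..<b} x * f x)"
  proof (rule integral_dominated_convergence[where w = "\<lambda>x. \<bar>f x\<bar>"])
    show "AE x in unit_leb. (\<lambda>n. indicator {max a (e n)<..<min b (1 - e n)} x * f x) \<longlonglongrightarrow> indicator {a<..<b} x * f x"
    proof (rule AE_I2)
      fix x assume "x \<in> space unit_leb"
      then have x: "0 < x" "0 < 1 - x" by auto
      have "\<forall>\<^sub>F n in sequentially. indicator {max a (e n)<..<min b (1 - e n)} x * f x = indicator {a<..<b} x * f x"
        using order_tendstoD(2)[OF e x(1)] order_tendstoD(2)[OF e x(2)]
        by eventually_elim (auto simp: indicator_def)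
      then show "(\<lambda>n. indicator {max a (e n)<..<min b (1 - e n)} x * f x) \<longlonglongrightarrow> indicator {a<..<b} x * f x"
        by (rule tendsto_eventually)
    qed
    show "(\<lambda>x. indicator {a<..<b} x * f x) \<in> borel_measurable unit_leb"
      by (intro borel_measurable_integrable integrable_indicator_mult f) auto
    show "(\<lambda>x. indicator {max a (e n)<..<min b (1 - e n)} x * f x) \<in> borel_measurable unit_leb" for n
      by (intro borel_measurable_integrable integrable_indicator_mult f) auto
  qed (use f in \<open>auto simp: indicator_def\<close>)
  moreover have "(LINT x|unit_leb. indicator {max a (e n)<..<min b (1 - e n)} x * f x) = 0" for n
    by (rule inner) (auto simp: e_def less_max_iff_disj min_less_iff_disj)
  ultimately show ?thesis
    by (simp add: LIMSEQ_const_iff)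
qed

text \<open>Intervals generate the Borel sets, so the integral over every Borel set vanishes, and Lebesgue sets differ
  from Borel sets by null sets only.\<close>
lemma AE_zero_if_interval_integrals_zero:
  fixes f :: "real \<Rightarrow> real"
  assumes f: "integrable unit_leb f"
    and zero: "\<And>a b. (LINT x|unit_leb. indicator {a<..<b} x * f x) = 0"
  shows "AE x in unit_leb. f x = 0"
proof -
  let ?G = "range (\<lambda>(a, b). box a (b::real))"
  have all: "(LINT x|unit_leb. f x) = 0"
    using zero[of 0 1] by (subst (asm) Bochner_Integration.integral_cong[of _ unit_leb _ f]) auto
  have borel: "(LINT x|unit_leb. indicator A x * f x) = 0" if "A \<in> sets borel" for A :: "real set"
  proof -
    have sb: "sets borel = sigma_sets UNIV ?G"
      by (simp add: borel_eq_box)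
    have "Int_stable ?G"
      by (auto simp: Int_stable_def box_real)
    moreover have "?G \<subseteq> Pow UNIV"
      by simp
    ultimately show ?thesis
      using that[unfolded sb]
    proof (induction rule: sigma_sets_induct_disjoint)
      case (basic A)
      then show ?case using zero by (auto simp: box_real)
    next
      case (compl A)
      have "A \<in> sets borel"
        using compl.hyps by (simp only: sb)
      then have "(LINT x|unit_leb. f x - indicator A x * f x) = 0"
        using compl.IH all f integrable_indicator_mult[OF f] by simp
      then show ?case
        by (subst Bochner_Integration.integral_cong[of _ unit_leb _ "\<lambda>x. f x - indicator A x * f x"])
          (auto simp: indicator_def)
    next
      case (union A)
      have A: "A i \<in> sets borel" for i
        using union.hyps by (auto simp only: sb)
      have "(\<lambda>n. LINT x|unit_leb. (\<Sum>i<n. indicator (A i) x * f x))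
          \<longlonglongrightarrow> (LINT x|unit_leb. indicator (\<Union>i. A i) x * f x)"
      proof (rule integral_dominated_convergence[where w = "\<lambda>x. \<bar>f x\<bar>"])
        have sum: "(\<Sum>i<n. indicator (A i) x * f x) = indicator (\<Union>i<n. A i) x * f x" for n x
          using union.hyps(1)
          by (subst indicator_UN_disjoint) (auto simp: sum_distrib_right disjoint_family_on_def)
        show "AE x in unit_leb. (\<lambda>n. \<Sum>i<n. indicator (A i) x * f x) \<longlonglongrightarrow> indicator (\<Union>i. A i) x * f x"
          unfolding sum by (intro AE_I2 tendsto_intros LIMSEQ_indicator_UN)
        show "AE x in unit_leb. norm (\<Sum>i<n. indicator (A i) x * f x) \<le> \<bar>f x\<bar>" for n
          unfolding sum by (auto simp: indicator_def)
        show "(\<lambda>x. indicator (\<Union>i. A i) x * f x) \<in> borel_measurable unit_leb"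
          using A by (intro borel_measurable_integrable integrable_indicator_mult f) auto
        show "(\<lambda>x. \<Sum>i<n. indicator (A i) x * f x) \<in> borel_measurable unit_leb" for n
          unfolding sum using A by (intro borel_measurable_integrable integrable_indicator_mult f) auto
      qed (use f in auto)
      moreover have "(LINT x|unit_leb. (\<Sum>i<n. indicator (A i) x * f x)) = 0" for n
        using union.IH integrable_indicator_mult[OF f A] by (subst Bochner_Integration.integral_sum) auto
      ultimately show ?case
        by (simp add: LIMSEQ_const_iff)
    qed auto
  qed
  have "(LINT x:A|unit_leb. f x) = (LINT x:A|unit_leb. 0)" if "A \<in> sets unit_leb" for A
  proof -
    have "A \<in> sets (completion lborel)"
      using that by (auto simp: sets_restrict_space)
    then obtain S N N' where A: "A = S \<union> N" "N \<subseteq> N'" "N' \<in> null_sets lborel" "S \<in> sets lborel"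
      by (rule sets_completionE) auto
    have "AE x in lebesgue. x \<notin> N'"
      using A by (intro AE_completion AE_not_in)
    then have "AE x in unit_leb. x \<notin> N'"
      by (subst AE_restrict_space_iff) auto
    then have eq: "AE x in unit_leb. indicator S x * f x = indicator A x *\<^sub>R f x"
      by eventually_elim (use A in \<open>auto simp: indicator_def\<close>)
    have "(LINT x|unit_leb. indicator A x *\<^sub>R f x) = (LINT x|unit_leb. indicator S x * f x)"
    proof (rule integral_cong_AE)
      show "(\<lambda>x. indicator A x *\<^sub>R f x) \<in> borel_measurable unit_leb"
        using that f by (intro borel_measurable_scaleR) auto
      show "(\<lambda>x. indicator S x * f x) \<in> borel_measurable unit_leb"
        using A by (intro borel_measurable_integrable integrable_indicator_mult f) auto
    qed (use eq in \<open>auto elim: eventually_mono\<close>)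
    then show ?thesis
      using borel[of S] A by (simp add: set_lebesgue_integral_def)
  qed
  then show ?thesis
    by (rule density_unique_real[OF f integrable_zero])
qed

lemma AE_zero_if_orthogonal_to_test_functions:
  fixes f :: "real \<Rightarrow> real"
  assumes "integrable unit_leb f"
    and "\<And>\<phi>. test_function \<phi> \<Longrightarrow> (LINT x|unit_leb. f x * \<phi> x) = 0"
  shows "AE x in unit_leb. f x = 0"
  using AE_zero_if_interval_integrals_zero integral_interval_eq_zero assms by blast

section \<open>Primitives of integrable functions\<close>

text \<open>The integral runs over the whole of \<open>(0,1)\<close> with a cut-off, so that \<open>primitive f\<close> is constant to the left of \<open>0\<close>
  and to the right of \<open>1\<close>, and so that Fubini applies on a square.\<close>
definition primitive :: "(real \<Rightarrow> real) \<Rightarrow> real \<Rightarrow> real" where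
  "primitive f x = (LINT t|unit_leb. indicator {..<x} t * f t)"

text \<open>On \<open>[0,1]\<close> this says that \<open>F\<close> is absolutely continuous with derivative \<open>f\<close> almost everywhere.\<close>
definition is_primitive :: "(real \<Rightarrow> real) \<Rightarrow> (real \<Rightarrow> real) \<Rightarrow> bool" where
  "is_primitive F f \<longleftrightarrow> integrable unit_leb f \<and> (\<forall>x\<in>{0..1}. F x = F 0 + primitive f x)"

lemma primitive_0 [simp]: "primitive f 0 = 0"
  unfolding primitive_def
  by (rule Bochner_Integration.integral_eq_zero_AE) (auto simp: indicator_def)

lemma primitive_1: "primitive f 1 = (LINT x|unit_leb. f x)"
  unfolding primitive_def by (rule Bochner_Integration.integral_cong) (auto simp: indicator_def)

lemma AE_unit_leb_neq: "AE t in unit_leb. t \<noteq> x"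
proof -
  have "AE t in lebesgue. t \<noteq> x"
    using AE_not_in[of "{x}" lebesgue] by simp
  then show ?thesis
    by (subst AE_restrict_space_iff) auto
qed

lemma continuous_on_primitive:
  assumes f: "integrable unit_leb f"
  shows "continuous_on UNIV (primitive f)"
  unfolding continuous_on_sequentially
proof (intro ballI allI impI, elim conjE)
  fix X :: "nat \<Rightarrow> real" and x assume X: "X \<longlonglongrightarrow> x"
  show "(primitive f \<circ> X) \<longlonglongrightarrow> primitive f x"
    unfolding primitive_def comp_def
  proof (rule integral_dominated_convergence[where w = "\<lambda>t. \<bar>f t\<bar>"])
    show "AE t in unit_leb. (\<lambda>n. indicator {..<X n} t * f t) \<longlonglongrightarrow> indicator {..<x} t * f t"
      using AE_unit_leb_neq[of x]
    proof eventually_elim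
      case (elim t)
      then consider "t < x" | "x < t" by linarith
      then have "\<forall>\<^sub>F n in sequentially. indicator {..<X n} t * f t = indicator {..<x} t * f t"
      proof cases
        case 1
        show ?thesis
          using order_tendstoD(1)[OF X 1] by eventually_elim (use 1 in \<open>simp add: indicator_def\<close>)
      next
        case 2
        show ?thesis
          using order_tendstoD(2)[OF X 2] by eventually_elim (use 2 in \<open>simp add: indicator_def\<close>)
      qed
      then show ?case by (rule tendsto_eventually)
    qed
    show "(\<lambda>t. indicator {..<x} t * f t) \<in> borel_measurable unit_leb" for x
      by (intro borel_measurable_integrable integrable_indicator_mult f) auto
    then show "(\<lambda>t. indicator {..<X n} t * f t) \<in> borel_measurable unit_leb" for n .
  qed (use f in \<open>auto simp: indicator_def\<close>)
qed

lemma is_primitiveD: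
  assumes "is_primitive F f"
  shows "integrable unit_leb f" "x \<in> {0..1} \<Longrightarrow> F x = F 0 + primitive f x"
  using assms by (simp add: is_primitive_def, unfold is_primitive_def, blast)

lemma continuous_on_is_primitive:
  assumes "is_primitive F f"
  shows "continuous_on {0..1} F"
proof -
  have "continuous_on {0..1} (\<lambda>x. F 0 + primitive f x)"
    by (intro continuous_intros continuous_on_subset[OF continuous_on_primitive[OF is_primitiveD(1)[OF assms]]]) simp
  then show ?thesis
    by (rule continuous_on_eq) (rule is_primitiveD(2)[OF assms, symmetric])
qed

lemma is_primitive_C1:
  fixes F f :: "real \<Rightarrow> real"
  assumes F: "\<And>x. x \<in> {0..1} \<Longrightarrow> (F has_real_derivative f x) (at x within {0..1})"
    and f: "continuous_on {0..1} f"
  shows "is_primitive F f"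
  unfolding is_primitive_def
proof (intro conjI ballI)
  show int: "integrable unit_leb f"
    using f by (rule integrable_continuous_unit)
  fix x :: real assume x: "x \<in> {0..1}"
  have "(f has_integral (F x - F 0)) {0..x}"
  proof (rule fundamental_theorem_of_calculus)
    fix y assume "y \<in> {0..x}"
    then have "(F has_vector_derivative f y) (at y within {0..1})"
      using F[of y] x by (simp add: has_real_derivative_iff_has_vector_derivative)
    then show "(F has_vector_derivative f y) (at y within {0..x})"
      by (rule has_vector_derivative_within_subset) (use x in auto)
  qed (use x in auto)
  then have "F x - F 0 = integral {0..x} f"
    by (simp add: integral_unique)
  also have "\<dots> = integral {0<..<x} f"
    by (simp add: integral_open_interval_real)
  also have "\<dots> = integral ({0<..<x} \<inter> {0<..<1}) f"
    using x by (simp add: Int_absorb2)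
  also have "\<dots> = integral {0<..<1} (\<lambda>t. if t \<in> {0<..<x} then f t else 0)"
    by (rule Henstock_Kurzweil_Integration.integral_restrict_Int[symmetric])
  also have "\<dots> = integral {0<..<1} (\<lambda>t. indicator {..<x} t * f t)"
    by (intro integral_cong) (auto simp: indicator_def)
  also have "\<dots> = primitive f x"
    unfolding primitive_def
    by (intro lebesgue_integral_eq_integral[symmetric] integrable_indicator_mult int) auto
  finally show "F x = F 0 + primitive f x" by simp
qed

text \<open>The product of the integrals is the integral of \<open>f x * g t\<close> over the unit square. The two summands on the left
  are its parts below and above the diagonal, which is a null set.\<close>
lemma integral_primitive_by_parts:
  assumes f: "integrable unit_leb f" and g: "integrable unit_leb g"
  shows "(LINT x|unit_leb. f x * primitive g x + primitive f x * g x)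
    = (LINT x|unit_leb. f x) * (LINT x|unit_leb. g x)"
proof -
  define k where "k = (\<lambda>x t. f x * g t)"
  define lo where "lo = (\<lambda>x t. indicator {t. t < x} t * k x t)"
  define up where "up = (\<lambda>x t. indicator {x. x < t} x * k x t)"
  have [measurable]: "f \<in> borel_measurable unit_leb" "g \<in> borel_measurable unit_leb"
    using f g by auto
  have [measurable]: "(\<lambda>x. x) \<in> borel_measurable unit_leb"
    by (rule borel_measurable_unit_lebI) auto
  have k: "integrable (unit_leb \<Otimes>\<^sub>M unit_leb) (\<lambda>(x, t). k x t)"
  proof (rule unit_leb_pair.Fubini_integrable)
    show "(\<lambda>(x, t). k x t) \<in> borel_measurable (unit_leb \<Otimes>\<^sub>M unit_leb)"
      unfolding k_def by measurable
  qed (use f g in \<open>auto simp: k_def abs_mult\<close>)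
  have [measurable]: "(\<lambda>(x, t). k x t) \<in> borel_measurable (unit_leb \<Otimes>\<^sub>M unit_leb)"
    using k by auto
  have fst: "(\<lambda>p. fst p) \<in> borel_measurable (unit_leb \<Otimes>\<^sub>M unit_leb)"
     and snd: "(\<lambda>p. snd p) \<in> borel_measurable (unit_leb \<Otimes>\<^sub>M unit_leb)"
    by measurable
  have cut: "integrable (unit_leb \<Otimes>\<^sub>M unit_leb) (\<lambda>p. indicator A p * (case p of (x, t) \<Rightarrow> k x t))"
    if "A = {p. fst p < snd p} \<or> A = {p. snd p < fst p}" for A :: "(real \<times> real) set"
  proof -
    have "{p \<in> space (unit_leb \<Otimes>\<^sub>M unit_leb). fst p < snd p} \<in> sets (unit_leb \<Otimes>\<^sub>M unit_leb)"
      "{p \<in> space (unit_leb \<Otimes>\<^sub>M unit_leb). snd p < fst p} \<in> sets (unit_leb \<Otimes>\<^sub>M unit_leb)"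
      using fst snd by (auto intro: borel_measurable_less)
    then have "space (unit_leb \<Otimes>\<^sub>M unit_leb) \<inter> A \<in> sets (unit_leb \<Otimes>\<^sub>M unit_leb)"
      using that by (auto simp: Int_def)
    from integrable_mult_indicator[OF this k]
    show ?thesis
      by (rule Bochner_Integration.integrable_cong[THEN iffD1, rotated 2]) (auto simp: indicator_def)
  qed
  have lo: "integrable (unit_leb \<Otimes>\<^sub>M unit_leb) (\<lambda>(x, t). lo x t)"
    using cut[of "{p. snd p < fst p}"]
    by (rule Bochner_Integration.integrable_cong[THEN iffD1, rotated 2]) (auto simp: lo_def indicator_def)
  have up: "integrable (unit_leb \<Otimes>\<^sub>M unit_leb) (\<lambda>(x, t). up x t)"
    using cut[of "{p. fst p < snd p}"]
    by (rule Bochner_Integration.integrable_cong[THEN iffD1, rotated 2]) (auto simp: up_def indicator_def)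
  have 1: "(LINT t|unit_leb. lo x t) = f x * primitive g x" for x
    unfolding primitive_def
    by (subst integral_mult_right_zero[symmetric]) (rule Bochner_Integration.integral_cong, auto simp: lo_def k_def indicator_def)
  have 2: "(LINT x|unit_leb. up x t) = primitive f t * g t" for t
    unfolding primitive_def
    by (subst integral_mult_left_zero[symmetric]) (rule Bochner_Integration.integral_cong, auto simp: up_def k_def indicator_def)
  have 3: "(LINT t|unit_leb. lo x t + up x t) = f x * (LINT t|unit_leb. g t)" for x
  proof -
    have "(LINT t|unit_leb. lo x t + up x t) = (LINT t|unit_leb. f x * g t)"
    proof (rule integral_cong_AE)
      show "AE t in unit_leb. lo x t + up x t = f x * g t"
        using AE_unit_leb_neq[of x] by eventually_elim (auto simp: lo_def up_def k_def indicator_def)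
      have "(\<lambda>t. indicator {..<x} t * (f x * g t) + indicator {x<..} t * (f x * g t)) \<in> borel_measurable unit_leb"
        using g by (intro borel_measurable_add borel_measurable_integrable integrable_indicator_mult) auto
      then show "(\<lambda>t. lo x t + up x t) \<in> borel_measurable unit_leb"
        by (rule measurable_cong[THEN iffD1, rotated]) (auto simp: lo_def up_def k_def indicator_def)
    qed auto
    then show ?thesis by simp
  qed
  have "(LINT x|unit_leb. f x * primitive g x + primitive f x * g x)
    = (LINT x|unit_leb. f x * primitive g x) + (LINT x|unit_leb. primitive f x * g x)"
  proof (rule Bochner_Integration.integral_add)
    show "integrable unit_leb (\<lambda>x. f x * primitive g x)"
      by (intro integrable_mult_continuous f continuous_on_subset[OF continuous_on_primitive[OF g]]) simp
    have "integrable unit_leb (\<lambda>x. g x * primitive f x)"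
      by (intro integrable_mult_continuous g continuous_on_subset[OF continuous_on_primitive[OF f]]) simp
    then show "integrable unit_leb (\<lambda>x. primitive f x * g x)"
      by (simp only: mult.commute)
  qed
  also have "\<dots> = (LINT x|unit_leb. LINT t|unit_leb. lo x t) + (LINT t|unit_leb. LINT x|unit_leb. up x t)"
    by (simp add: 1 2)
  also have "(LINT t|unit_leb. LINT x|unit_leb. up x t) = (LINT x|unit_leb. LINT t|unit_leb. up x t)"
    using up by (rule unit_leb_pair.Fubini_integral)
  also have "(LINT x|unit_leb. LINT t|unit_leb. lo x t) + \<dots> = (LINT p|(unit_leb \<Otimes>\<^sub>M unit_leb). (case p of (x, t) \<Rightarrow> lo x t + up x t))"
    unfolding unit_leb_pair.integral_fst'[OF lo, simplified] unit_leb_pair.integral_fst'[OF up, simplified]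
    by (subst Bochner_Integration.integral_add[OF lo up, symmetric]) (rule Bochner_Integration.integral_cong, auto)
  also have "\<dots> = (LINT x|unit_leb. LINT t|unit_leb. lo x t + up x t)"
    using unit_leb_pair.integral_fst'[OF Bochner_Integration.integrable_add[OF lo up]]
    by (simp add: case_prod_unfold)
  also have "\<dots> = (LINT x|unit_leb. f x) * (LINT x|unit_leb. g x)"
    by (simp add: 3)
  finally show ?thesis .
qed

lemma primitive_cut:
  assumes "0 \<le> t"
  shows "primitive (\<lambda>s. indicator {..<x} s * f s) t = primitive f (min x t)"
  unfolding primitive_def by (rule Bochner_Integration.integral_cong) (auto simp: indicator_def)

lemma primitive_add:
  assumes "integrable unit_leb f" "integrable unit_leb g"
  shows "primitive (\<lambda>s. f s + g s) x = primitive f x + primitive g x"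
  unfolding primitive_def distrib_left
  by (intro Bochner_Integration.integral_add integrable_indicator_mult assms) auto

lemma primitive_cmult: "primitive (\<lambda>s. c * f s) x = c * primitive f x"
  unfolding primitive_def mult.left_commute[of _ c] by simp

lemma is_primitiveI:
  assumes "integrable unit_leb f" "\<And>x. 0 \<le> x \<Longrightarrow> x \<le> 1 \<Longrightarrow> F x = c + primitive f x"
  shows "is_primitive F f"
  using assms(2)[of 0] assms by (simp add: is_primitive_def)

text \<open>Integration by parts on \<open>(0, x)\<close> instead of \<open>(0, 1)\<close>, obtained by cutting both derivatives off at \<open>x\<close>.\<close>
lemma is_primitive_mult:
  assumes F: "is_primitive F f" and G: "is_primitive G g"
  shows "is_primitive (\<lambda>x. F x * G x) (\<lambda>x. f x * G x + F x * g x)"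
proof -
  note f = is_primitiveD(1)[OF F] and g = is_primitiveD(1)[OF G]
  have fG: "integrable unit_leb (\<lambda>x. f x * G x)"
    by (intro integrable_mult_continuous f continuous_on_is_primitive[OF G])
  have "integrable unit_leb (\<lambda>x. g x * F x)"
    by (intro integrable_mult_continuous g continuous_on_is_primitive[OF F])
  then have Fg: "integrable unit_leb (\<lambda>x. F x * g x)"
    by (simp only: mult.commute)
  show ?thesis
  proof (rule is_primitiveI)
    show "integrable unit_leb (\<lambda>x. f x * G x + F x * g x)"
      using fG Fg by simp
    fix x :: real assume x: "0 \<le> x" "x \<le> 1"
    define f' where "f' = (\<lambda>s. indicator {..<x} s * f s)"
    define g' where "g' = (\<lambda>s. indicator {..<x} s * g s)"
    have f': "integrable unit_leb f'" and g': "integrable unit_leb g'"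
      unfolding f'_def g'_def by (intro integrable_indicator_mult f g; simp)+
    have "(LINT s|unit_leb. f' s * primitive g' s + primitive f' s * g' s)
        = (LINT s|unit_leb. f' s) * (LINT s|unit_leb. g' s)"
      by (rule integral_primitive_by_parts[OF f' g'])
    also have "\<dots> = primitive f x * primitive g x"
      by (simp add: f'_def g'_def primitive_def)
    also have "(LINT s|unit_leb. f' s * primitive g' s + primitive f' s * g' s)
        = (LINT s|unit_leb. indicator {..<x} s * ((f s * G s + F s * g s) + ((- G 0) * f s + (- F 0) * g s)))"
    proof (rule Bochner_Integration.integral_cong[OF refl])
      fix s assume "s \<in> space unit_leb"
      then have s: "0 \<le> s" "s \<in> {0..1}" by auto
      have "primitive g' s = primitive g (min x s)" "primitive f' s = primitive f (min x s)"
        unfolding f'_def g'_def using s by (intro primitive_cut; simp)+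
      moreover have "F s = F 0 + primitive f s" "G s = G 0 + primitive g s"
        using is_primitiveD(2)[OF F s(2)] is_primitiveD(2)[OF G s(2)] .
      ultimately show "f' s * primitive g' s + primitive f' s * g' s =
          indicator {..<x} s * ((f s * G s + F s * g s) + ((- G 0) * f s + (- F 0) * g s))"
        by (cases "s < x") (simp_all add: f'_def g'_def algebra_simps)
    qed
    also have "\<dots> = primitive (\<lambda>s. (f s * G s + F s * g s) + ((- G 0) * f s + (- F 0) * g s)) x"
      by (simp add: primitive_def)
    also have "\<dots> = primitive (\<lambda>s. f s * G s + F s * g s) x + ((- G 0) * primitive f x + (- F 0) * primitive g x)"
    proof (subst primitive_add)
      show "integrable unit_leb (\<lambda>s. f s * G s + F s * g s)" "integrable unit_leb (\<lambda>s. - G 0 * f s + - F 0 * g s)"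
        using f g fG Fg by auto
      have "primitive (\<lambda>s. - G 0 * f s + - F 0 * g s) x = primitive (\<lambda>s. - G 0 * f s) x + primitive (\<lambda>s. - F 0 * g s) x"
        using f g by (intro primitive_add) auto
      then show "primitive (\<lambda>s. f s * G s + F s * g s) x + primitive (\<lambda>s. - G 0 * f s + - F 0 * g s) x =
          primitive (\<lambda>s. f s * G s + F s * g s) x + ((- G 0) * primitive f x + (- F 0) * primitive g x)"
        by (simp only: primitive_cmult)
    qed
    finally show "F x * G x = F 0 * G 0 + primitive (\<lambda>x. f x * G x + F x * g x) x"
      using is_primitiveD(2)[OF F, of x] is_primitiveD(2)[OF G, of x] x by (simp add: algebra_simps)
  qed
qed

lemma is_primitive_integral:
  assumes "is_primitive F f"
  shows "(LINT x|unit_leb. f x) = F 1 - F 0"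
  using is_primitiveD(2)[OF assms, of 1] by (simp add: primitive_1)

text \<open>A nonempty open set is not negligible; the end points follow by continuity.\<close>
lemma continuous_eq_if_AE_eq:
  fixes F G :: "real \<Rightarrow> real"
  assumes "continuous_on {0..1} F" "continuous_on {0..1} G" "AE x in unit_leb. F x = G x" "x \<in> {0..1}"
  shows "F x = G x"
proof -
  have 1: "F y = G y" if y: "0 < y" "y < 1" for y
  proof (rule ccontr)
    assume ne: "F y \<noteq> G y"
    have "continuous_on {0<..<1} (\<lambda>x. F x - G x)"
      using assms(1,2) by (intro continuous_intros) (auto intro: continuous_on_subset)
    then have "open ({0<..<1} \<inter> (\<lambda>x. F x - G x) -` (- {0}))"
      by (rule continuous_open_preimage) auto
    moreover have "y \<in> {0<..<1} \<inter> (\<lambda>x. F x - G x) -` (- {0})"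
      using y ne by simp
    ultimately have "{0<..<1} \<inter> (\<lambda>x. F x - G x) -` (- {0}) \<notin> null_sets lebesgue"
      using open_not_negligible negligible_iff_null_sets by blast
    moreover have "{0<..<1} \<inter> (\<lambda>x. F x - G x) -` (- {0}) \<in> null_sets lebesgue"
    proof -
      have "AE x in lebesgue. x \<in> {0<..<1} \<longrightarrow> F x = G x"
        using assms(3) by (subst (asm) AE_restrict_space_iff) auto
      then have "AE x in lebesgue. x \<notin> {0<..<1} \<inter> (\<lambda>x. F x - G x) -` (- {0})"
        by eventually_elim auto
      then show ?thesis
        using \<open>open ({0<..<1} \<inter> (\<lambda>x. F x - G x) -` (- {0}))\<close>
        by (subst AE_iff_null_sets) auto
    qed
    ultimately show False by contradiction
  qed
  have "F x - G x = 0"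
    by (rule continuous_constant_on_closure[of "{0<..<1}" "\<lambda>x. F x - G x"])
      (use 1 assms in \<open>auto intro!: continuous_intros\<close>)
  then show ?thesis by simp
qed

section \<open>Representatives of square integrable classes\<close>

lemma square_integrable_rep [simp]: "square_integrable (rep_l2 u)"
  using Quotient3_rep_reflp[OF Quotient3_l2, of u] by (simp add: l2_rel_def)

lemma rep_l2_of:
  assumes "square_integrable f"
  shows "AE x in unit_leb. rep_l2 (l2_of f) x = f x"
proof -
  have "l2_rel f f"
    using assms by (simp add: l2_rel_def)
  then have "l2_rel (rep_l2 (abs_l2 f)) f"
    by (rule rep_abs_rsp_left[OF Quotient3_l2])
  then show ?thesis
    using assms by (simp add: l2_rel_def l2_of_def)
qed

lemma l2_eqI:
  assumes "AE x in unit_leb. rep_l2 u x = rep_l2 v x"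
  shows "u = v"
  using Quotient3_rel_rep[OF Quotient3_l2, of u v] assms by (simp add: l2_rel_def)

lemma l2_of_eqI:
  assumes "square_integrable f" "AE x in unit_leb. rep_l2 u x = f x"
  shows "l2_of f = u"
  by (rule l2_eqI) (use assms(2) rep_l2_of[OF assms(1)] in eventually_elim, simp)

lemma rep_l2_add: "AE x in unit_leb. rep_l2 (u + v) x = rep_l2 u x + rep_l2 v x"
proof -
  have "u + v = l2_of (\<lambda>x. rep_l2 u x + rep_l2 v x)"
    by (simp add: plus_l2_def l2_of_def square_integrable_add)
  then show ?thesis
    using rep_l2_of[of "\<lambda>x. rep_l2 u x + rep_l2 v x"] by (simp add: square_integrable_add)
qed

lemma rep_l2_scaleR: "AE x in unit_leb. rep_l2 (c *\<^sub>R u) x = c * rep_l2 u x"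
proof -
  have "c *\<^sub>R u = l2_of (\<lambda>x. c * rep_l2 u x)"
    by (simp add: scaleR_l2_def l2_of_def square_integrable_scale)
  then show ?thesis
    using rep_l2_of[of "\<lambda>x. c * rep_l2 u x"] by (simp add: square_integrable_scale)
qed

lemma inner_l2_rep: "inner u v = (LINT x|unit_leb. rep_l2 u x * rep_l2 v x)"
  by (simp add: inner_l2_def)

lemma rep_l2_measurable [measurable]: "rep_l2 u \<in> borel_measurable unit_leb"
  using square_integrable_rep[of u] by (simp add: square_integrable_def)

lemma square_integrable_imp_integrable:
  assumes "square_integrable f"
  shows "integrable unit_leb f"
  using square_integrable_mult[OF assms, of "\<lambda>x. 1"] by (simp add: square_integrable_def)

lemma square_integrable_continuous:
  assumes "continuous_on {0..1} f"
  shows "square_integrable f"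
  unfolding square_integrable_def
  by (intro conjI continuous_on_imp_measurable_unit_leb integrable_continuous_unit continuous_intros assms)

lemma square_integrable_mult_continuous:
  assumes "continuous_on {0..1} a" "square_integrable f"
  shows "square_integrable (\<lambda>x. a x * f x)"
proof -
  have "integrable unit_leb (\<lambda>x. (f x)\<^sup>2 * (a x)\<^sup>2)"
    using assms by (intro integrable_mult_continuous continuous_intros) (auto simp: square_integrable_def)
  then show ?thesis
    using assms continuous_on_imp_measurable_unit_leb[OF assms(1)]
    by (auto simp: square_integrable_def power_mult_distrib mult.commute intro!: borel_measurable_times)
qed

lemma integral_rep_mult_eq:
  assumes "square_integrable f" "AE x in unit_leb. rep_l2 u x = f x"
    "square_integrable g" "AE x in unit_leb. rep_l2 v x = g x"
  shows "inner u v = (LINT x|unit_leb. f x * g x)"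
  unfolding inner_l2_rep
proof (rule integral_cong_AE)
  show "AE x in unit_leb. rep_l2 u x * rep_l2 v x = f x * g x"
    using assms(2,4) by eventually_elim simp
qed (use assms in \<open>auto simp: square_integrable_def intro!: borel_measurable_times\<close>)

lemma inner_l2_of:
  "square_integrable f \<Longrightarrow> square_integrable g \<Longrightarrow> inner (l2_of f) (l2_of g) = (LINT x|unit_leb. f x * g x)"
  by (intro integral_rep_mult_eq rep_l2_of)

lemma inner_rep_l2_of:
  "square_integrable g \<Longrightarrow> inner u (l2_of g) = (LINT x|unit_leb. rep_l2 u x * g x)"
  by (intro integral_rep_mult_eq rep_l2_of) auto

lemma l2_integral_eq_inner: "l2_integral u = inner u (l2_of (\<lambda>x. 1))"
  by (subst inner_rep_l2_of) (auto simp: l2_integral_def intro!: square_integrable_continuous continuous_intros)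

lemma rep_l2_mult:
  assumes "continuous_on {0..1} a"
  shows "AE x in unit_leb. rep_l2 (l2_mult a u) x = a x * rep_l2 u x"
  unfolding l2_mult_def by (rule rep_l2_of) (simp add: square_integrable_mult_continuous assms)

lemma inner_l2_mult:
  assumes "continuous_on {0..1} a"
  shows "inner (l2_mult a u) v = (LINT x|unit_leb. a x * rep_l2 u x * rep_l2 v x)"
  by (rule integral_rep_mult_eq) (auto simp: square_integrable_mult_continuous assms rep_l2_mult)

section \<open>Weak derivatives\<close>

lemma test_function_primitive:
  assumes "test_function \<phi>"
  shows "is_primitive \<phi> (deriv \<phi>)" "\<phi> 0 = 0" "\<phi> 1 = 0"
    "continuous_on UNIV \<phi>" "continuous_on UNIV (deriv \<phi>)"
proof -
  have d: "(deriv ^^ n) \<phi> differentiable_on UNIV" for n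
    using assms by (simp add: test_function_def)
  show "\<phi> 0 = 0" "\<phi> 1 = 0"
  proof -
    obtain S where "S \<subseteq> {0<..<1}" "\<And>x. x \<notin> S \<Longrightarrow> \<phi> x = 0"
      using assms unfolding test_function_def by blast
    then show "\<phi> 0 = 0" "\<phi> 1 = 0"
      by force+
  qed
  show 1: "continuous_on UNIV \<phi>" "continuous_on UNIV (deriv \<phi>)"
    using d[of 0] d[of 1] by (simp_all add: differentiable_imp_continuous_on)
  show "is_primitive \<phi> (deriv \<phi>)"
  proof (rule is_primitive_C1)
    fix x
    have "\<phi> differentiable at x"
      using d[of 0] by (simp add: differentiable_on_def)
    then have "(\<phi> has_real_derivative deriv \<phi> x) (at x)"
      by (simp only: DERIV_deriv_iff_real_differentiable)
    then show "(\<phi> has_real_derivative deriv \<phi> x) (at x within {0..1})"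
      by (rule has_field_derivative_at_within)
  qed (rule continuous_on_subset[OF 1(2) subset_UNIV])
qed

lemma primitive_has_weak_deriv:
  assumes "is_primitive W w" "AE x in unit_leb. rep_l2 u x = W x" "AE x in unit_leb. rep_l2 v x = w x"
  shows "has_weak_deriv u v"
  unfolding has_weak_deriv_def
proof (intro allI impI)
  fix \<phi> assume "test_function \<phi>"
  note \<phi> = test_function_primitive[OF this]
  have c: "continuous_on {0..1} \<phi>" "continuous_on {0..1} (deriv \<phi>)"
    by (rule continuous_on_subset[OF \<phi>(4) subset_UNIV] continuous_on_subset[OF \<phi>(5) subset_UNIV])+
  have [measurable]: "\<phi> \<in> borel_measurable unit_leb" "deriv \<phi> \<in> borel_measurable unit_leb"
      "w \<in> borel_measurable unit_leb" "W \<in> borel_measurable unit_leb"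
    using c is_primitiveD(1)[OF assms(1)] continuous_on_is_primitive[OF assms(1)]
    by (auto intro: continuous_on_imp_measurable_unit_leb)
  have "(LINT x|unit_leb. w x * \<phi> x + W x * deriv \<phi> x) = 0"
    using is_primitive_integral[OF is_primitive_mult[OF assms(1) \<phi>(1)]] \<phi> by simp
  moreover have "(LINT x|unit_leb. w x * \<phi> x + W x * deriv \<phi> x) =
      (LINT x|unit_leb. w x * \<phi> x) + (LINT x|unit_leb. W x * deriv \<phi> x)"
    by (intro Bochner_Integration.integral_add integrable_mult_continuous c is_primitiveD(1)[OF assms(1)]
        integrable_continuous_unit continuous_on_is_primitive[OF assms(1)])
  moreover have "(LINT x|unit_leb. rep_l2 u x * deriv \<phi> x) = (LINT x|unit_leb. W x * deriv \<phi> x)"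
  proof (rule integral_cong_AE)
    show "AE x in unit_leb. rep_l2 u x * deriv \<phi> x = W x * deriv \<phi> x"
      using assms(2) by eventually_elim simp
  qed measurable
  moreover have "(LINT x|unit_leb. rep_l2 v x * \<phi> x) = (LINT x|unit_leb. w x * \<phi> x)"
  proof (rule integral_cong_AE)
    show "AE x in unit_leb. rep_l2 v x * \<phi> x = w x * \<phi> x"
      using assms(3) by eventually_elim simp
  qed measurable
  ultimately show "(LINT x|unit_leb. rep_l2 u x * deriv \<phi> x) = - (LINT x|unit_leb. rep_l2 v x * \<phi> x)"
    by simp
qed

lemma has_weak_deriv_unique:
  assumes "has_weak_deriv u v" "has_weak_deriv u w"
  shows "v = w"
proof (rule l2_eqI)
  have i: "integrable unit_leb (rep_l2 v)" "integrable unit_leb (rep_l2 w)"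
    by (simp_all add: square_integrable_imp_integrable)
  have "AE x in unit_leb. rep_l2 v x - rep_l2 w x = 0"
  proof (rule AE_zero_if_orthogonal_to_test_functions)
    fix \<phi> assume \<phi>: "test_function \<phi>"
    have c: "continuous_on {0..1} \<phi>"
      by (rule continuous_on_subset[OF test_function_primitive(4)[OF \<phi>] subset_UNIV])
    have "(LINT x|unit_leb. rep_l2 v x * \<phi> x) = (LINT x|unit_leb. rep_l2 w x * \<phi> x)"
      using assms \<phi> by (simp add: has_weak_deriv_def)
    then show "(LINT x|unit_leb. (rep_l2 v x - rep_l2 w x) * \<phi> x) = 0"
      using i c by (simp add: left_diff_distrib integrable_mult_continuous)
  qed (use i in auto)
  then show "AE x in unit_leb. rep_l2 v x = rep_l2 w x"
    by eventually_elim simp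
qed

lemma weak_deriv_eqI: "has_weak_deriv u v \<Longrightarrow> weak_deriv u = v"
  unfolding weak_deriv_def using has_weak_deriv_unique by blast

lemma H1_has_weak_deriv: "u \<in> H1 \<Longrightarrow> has_weak_deriv u (weak_deriv u)"
  using weak_deriv_eqI by (auto simp: H1_def)

text \<open>The lemma of du Bois-Reymond. A test function minus a suitable multiple of a fixed bump has mean
  zero and is therefore the derivative of a test function; so \<open>g\<close> minus a constant annihilates all test functions.\<close>
lemma AE_const_if_weak_deriv_zero:
  fixes g :: "real \<Rightarrow> real"
  assumes g: "integrable unit_leb g"
    and zero: "\<And>\<phi>. test_function \<phi> \<Longrightarrow> (LINT x|unit_leb. g x * deriv \<phi> x) = 0"
  shows "\<exists>c. AE x in unit_leb. g x = c"
proof -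
  define \<rho> where "\<rho> = mollified_indicator 1 (1/4) (3/4)"
  define I where "I = integral {0..1} \<rho>"
  have \<rho>: "test_function \<rho>"
    unfolding \<rho>_def by (rule test_function_mollified_indicator) auto
  have c\<rho>: "continuous_on UNIV \<rho>"
    unfolding \<rho>_def by (rule continuous_mollified_indicator) auto
  have "I \<noteq> 0"
  proof
    assume "I = 0"
    then have "\<rho> (1/2) = 0"
      unfolding I_def
      by (subst (asm) integral_eq_0_iff) (auto simp: \<rho>_def mollified_indicator_bounds intro!: continuous_on_subset[OF c\<rho>[unfolded \<rho>_def]])
    then show False
      by (simp add: \<rho>_def mollified_indicator_def bump_def)
  qed
  define c where "c = (LINT x|unit_leb. g x * \<rho> x) / I"
  have "AE x in unit_leb. g x - c = 0"
  proof (rule AE_zero_if_orthogonal_to_test_functions)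
    fix \<psi> assume \<psi>: "test_function \<psi>"
    define J where "J = integral {0..1} \<psi> / I"
    define h where "h = (\<lambda>x. \<psi> x - J * \<rho> x)"
    have c\<psi>: "continuous_on UNIV \<psi>"
      using test_function_primitive[OF \<psi>] by simp
    have C: "continuous_on {0..1} \<psi>" "continuous_on {0..1} \<rho>"
      by (rule continuous_on_subset[OF c\<psi> subset_UNIV] continuous_on_subset[OF c\<rho> subset_UNIV])+
    obtain S where S: "compact S" "S \<subseteq> {0<..<1}" "\<And>x. x \<notin> S \<Longrightarrow> \<psi> x = 0"
      using \<psi> by (auto simp: test_function_def)
    define S' where "S' = insert (1/4) (insert (3/4) S)"
    have S': "compact S'" "S' \<noteq> {}" "S' \<subseteq> {0<..<1}"
      using S by (auto simp: S'_def)
    obtain s where s: "s \<in> S'" "\<And>x. x \<in> S' \<Longrightarrow> s \<le> x"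
      using compact_attains_inf[OF S'(1,2)] by blast
    obtain t where t: "t \<in> S'" "\<And>x. x \<in> S' \<Longrightarrow> x \<le> t"
      using compact_attains_sup[OF S'(1,2)] by blast
    have st: "s \<le> 1/4" "3/4 \<le> t" "0 < s" "t < 1"
      using s(2)[of "1/4"] t(2)[of "3/4"] subsetD[OF S'(3) s(1)] subsetD[OF S'(3) t(1)] by (auto simp: S'_def)
    have "\<exists>F. test_function F \<and> deriv F = h"
    proof (rule test_function_antiderivative[of h s t])
      have "(deriv ^^ n) h = (\<lambda>x. (deriv ^^ n) \<psi> x - J * (deriv ^^ n) \<rho> x)" for n
        unfolding h_def using \<psi> \<rho> by (intro iterated_deriv_linear) (auto simp: test_function_def)
      then show "(deriv ^^ n) h differentiable_on UNIV" for n
        using \<psi> \<rho> by (auto simp: test_function_def intro!: differentiable_on_diff differentiable_on_mult differentiable_on_const)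
      show "h x = 0" if "x \<notin> {s..t}" for x
      proof -
        have "x \<notin> S"
          using that s t by (auto simp: S'_def)
        moreover have "\<rho> x = 0"
          using that st by (auto simp: \<rho>_def mollified_indicator_def bump_def)
        ultimately show ?thesis
          using S(3) by (simp add: h_def)
      qed
      show "integral {0..1} h = 0"
        unfolding h_def using C \<open>I \<noteq> 0\<close>
        by (subst integral_diff)
          (auto simp: J_def I_def intro!: integrable_continuous_interval continuous_intros)
    qed (use st in auto)
    then have "(LINT x|unit_leb. g x * h x) = 0"
      using zero by auto
    moreover have "(LINT x|unit_leb. g x * h x) = (LINT x|unit_leb. g x * \<psi> x) - J * (LINT x|unit_leb. g x * \<rho> x)"
    proof -
      have "(LINT x|unit_leb. g x * h x) = (LINT x|unit_leb. g x * \<psi> x - J * (g x * \<rho> x))"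
        by (simp add: h_def algebra_simps)
      also have "\<dots> = (LINT x|unit_leb. g x * \<psi> x) - (LINT x|unit_leb. J * (g x * \<rho> x))"
        by (intro Bochner_Integration.integral_diff integrable_mult_right integrable_mult_continuous g C)
      finally show ?thesis by simp
    qed
    moreover have "J * (LINT x|unit_leb. g x * \<rho> x) = c * (LINT x|unit_leb. \<psi> x)"
    proof -
      have "(LINT x|unit_leb. \<psi> x) = integral {0<..<1} \<psi>"
        by (intro lebesgue_integral_eq_integral integrable_continuous_unit C) auto
      then have "(LINT x|unit_leb. \<psi> x) = integral {0..1} \<psi>"
        by (simp add: integral_open_interval_real)
      then show ?thesis by (simp add: J_def c_def)
    qed
    moreover have "(LINT x|unit_leb. (g x - c) * \<psi> x) = (LINT x|unit_leb. g x * \<psi> x) - c * (LINT x|unit_leb. \<psi> x)"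
      using g C by (simp add: left_diff_distrib integrable_mult_continuous integrable_continuous_unit)
    ultimately show "(LINT x|unit_leb. (g x - c) * \<psi> x) = 0"
      by simp
  qed (use g in simp)
  then show ?thesis
    by (intro exI[of _ c]) (auto elim: eventually_mono)
qed

text \<open>The difference of \<open>u\<close> and the primitive of \<open>v\<close> has weak derivative zero, hence is constant.\<close>
lemma has_weak_deriv_obtain_primitive:
  assumes "has_weak_deriv u v"
  obtains W where "is_primitive W (rep_l2 v)" "AE x in unit_leb. rep_l2 u x = W x"
proof -
  define P where "P = primitive (rep_l2 v)"
  have v: "integrable unit_leb (rep_l2 v)" and u: "integrable unit_leb (rep_l2 u)"
    by (simp_all add: square_integrable_imp_integrable)
  have P: "is_primitive P (rep_l2 v)"
    unfolding P_def by (rule is_primitiveI[of _ _ 0]) (use v in auto)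
  note cP = continuous_on_is_primitive[OF P]
  have "\<exists>c. AE x in unit_leb. rep_l2 u x - P x = c"
  proof (rule AE_const_if_weak_deriv_zero)
    show "integrable unit_leb (\<lambda>x. rep_l2 u x - P x)"
      by (intro Bochner_Integration.integrable_diff u integrable_continuous_unit cP)
    fix \<phi> assume \<phi>: "test_function \<phi>"
    note * = test_function_primitive[OF \<phi>]
    have c: "continuous_on {0..1} \<phi>" "continuous_on {0..1} (deriv \<phi>)"
      by (rule continuous_on_subset[OF *(4) subset_UNIV] continuous_on_subset[OF *(5) subset_UNIV])+
    have "(LINT x|unit_leb. rep_l2 v x * \<phi> x + P x * deriv \<phi> x) = 0"
      using is_primitive_integral[OF is_primitive_mult[OF P *(1)]] * by simp
    moreover have "(LINT x|unit_leb. rep_l2 v x * \<phi> x + P x * deriv \<phi> x) =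
       (LINT x|unit_leb. rep_l2 v x * \<phi> x) + (LINT x|unit_leb. P x * deriv \<phi> x)"
      by (intro Bochner_Integration.integral_add integrable_mult_continuous v c integrable_continuous_unit cP)
    moreover have "(LINT x|unit_leb. (rep_l2 u x - P x) * deriv \<phi> x) =
        (LINT x|unit_leb. rep_l2 u x * deriv \<phi> x) - (LINT x|unit_leb. P x * deriv \<phi> x)"
      unfolding left_diff_distrib
      by (intro Bochner_Integration.integral_diff integrable_mult_continuous u c integrable_continuous_unit cP)
    ultimately show "(LINT x|unit_leb. (rep_l2 u x - P x) * deriv \<phi> x) = 0"
      using assms \<phi> by (simp add: has_weak_deriv_def)
  qed
  then obtain c where c: "AE x in unit_leb. rep_l2 u x - P x = c" by blast
  show thesis
  proof (rule that[of "\<lambda>x. c + P x"])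
    show "is_primitive (\<lambda>x. c + P x) (rep_l2 v)"
      by (rule is_primitiveI[of _ _ c]) (use v in \<open>auto simp: P_def\<close>)
    show "AE x in unit_leb. rep_l2 u x = c + P x"
      using c by eventually_elim simp
  qed
qed

section \<open>Calculus in the Sobolev spaces\<close>

lemma has_weak_deriv_iff_inner:
  "has_weak_deriv u v \<longleftrightarrow>
     (\<forall>\<phi>. test_function \<phi> \<longrightarrow> inner u (l2_of (deriv \<phi>)) = - inner v (l2_of \<phi>))"
proof -
  have "inner u (l2_of (deriv \<phi>)) = (LINT x|unit_leb. rep_l2 u x * deriv \<phi> x)"
    "inner v (l2_of \<phi>) = (LINT x|unit_leb. rep_l2 v x * \<phi> x)" if "test_function \<phi>" for \<phi>
    using test_function_primitive(4,5)[OF that]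
    by (auto intro!: inner_rep_l2_of square_integrable_continuous intro: continuous_on_subset)
  then show ?thesis
    by (auto simp: has_weak_deriv_def)
qed

lemma has_weak_deriv_add:
  "has_weak_deriv u u' \<Longrightarrow> has_weak_deriv v v' \<Longrightarrow> has_weak_deriv (u + v) (u' + v')"
  by (simp add: has_weak_deriv_iff_inner inner_add_left)

lemma has_weak_deriv_scaleR:
  "has_weak_deriv u u' \<Longrightarrow> has_weak_deriv (c *\<^sub>R u) (c *\<^sub>R u')"
  by (simp add: has_weak_deriv_iff_inner)

lemma H1_add: "u \<in> H1 \<Longrightarrow> v \<in> H1 \<Longrightarrow> u + v \<in> H1"
  by (auto simp: H1_def intro: has_weak_deriv_add)

lemma H1_scaleR: "u \<in> H1 \<Longrightarrow> c *\<^sub>R u \<in> H1"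
  by (auto simp: H1_def intro: has_weak_deriv_scaleR)

lemma weak_deriv_add: "u \<in> H1 \<Longrightarrow> v \<in> H1 \<Longrightarrow> weak_deriv (u + v) = weak_deriv u + weak_deriv v"
  by (intro weak_deriv_eqI has_weak_deriv_add H1_has_weak_deriv)

lemma weak_deriv_scaleR: "u \<in> H1 \<Longrightarrow> weak_deriv (c *\<^sub>R u) = c *\<^sub>R weak_deriv u"
  by (intro weak_deriv_eqI has_weak_deriv_scaleR H1_has_weak_deriv)

text \<open>The weak derivative is a closed operator, since testing is an inner product.\<close>
lemma has_weak_deriv_limit:
  assumes "\<And>n. has_weak_deriv (u n) (v n)" "u \<longlonglongrightarrow> u'" "v \<longlonglongrightarrow> v'"
  shows "has_weak_deriv u' v'"
  unfolding has_weak_deriv_iff_inner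
proof (intro allI impI)
  fix \<phi> assume "test_function \<phi>"
  then have "inner (u n) (l2_of (deriv \<phi>)) = - inner (v n) (l2_of \<phi>)" for n
    using assms(1) by (simp add: has_weak_deriv_iff_inner)
  moreover have "(\<lambda>n. inner (u n) (l2_of (deriv \<phi>))) \<longlonglongrightarrow> inner u' (l2_of (deriv \<phi>))"
    "(\<lambda>n. - inner (v n) (l2_of \<phi>)) \<longlonglongrightarrow> - inner v' (l2_of \<phi>)"
    by (intro tendsto_intros assms)+
  ultimately show "inner u' (l2_of (deriv \<phi>)) = - inner v' (l2_of \<phi>)"
    by (simp add: LIMSEQ_unique)
qed

lemma point_value_eqI:
  assumes "continuous_on {0..1} W" "AE x in unit_leb. rep_l2 u x = W x" "p \<in> {0..1}"
  shows "point_value u p = W p"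
  unfolding point_value_def
proof (rule the_equality)
  show "\<exists>g. continuous_on {0..1} g \<and> (AE x in unit_leb. rep_l2 u x = g x) \<and> W p = g p"
    using assms by blast
  fix c assume "\<exists>g. continuous_on {0..1} g \<and> (AE x in unit_leb. rep_l2 u x = g x) \<and> c = g p"
  then obtain g where g: "continuous_on {0..1} g" "AE x in unit_leb. rep_l2 u x = g x" "c = g p"
    by blast
  have "AE x in unit_leb. g x = W x"
    using g(2) assms(2) by eventually_elim simp
  from continuous_eq_if_AE_eq[OF g(1) assms(1) this assms(3)] show "c = W p"
    using g(3) by simp
qed

lemma H1_obtain_primitive:
  assumes "u \<in> H1"
  obtains W where "is_primitive W (rep_l2 (weak_deriv u))" "AE x in unit_leb. rep_l2 u x = W x"
    "\<And>p. p \<in> {0..1} \<Longrightarrow> point_value u p = W p"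
proof -
  obtain W where W: "is_primitive W (rep_l2 (weak_deriv u))" "AE x in unit_leb. rep_l2 u x = W x"
    using has_weak_deriv_obtain_primitive[OF H1_has_weak_deriv[OF assms]] by blast
  show thesis
    by (rule that[OF W point_value_eqI[OF continuous_on_is_primitive[OF W(1)] W(2)]])
qed

lemma point_value_add:
  assumes "u \<in> H1" "v \<in> H1" "p \<in> {0..1}"
  shows "point_value (u + v) p = point_value u p + point_value v p"
proof -
  obtain W where W: "is_primitive W (rep_l2 (weak_deriv u))" "AE x in unit_leb. rep_l2 u x = W x"
    "\<And>p. p \<in> {0..1} \<Longrightarrow> point_value u p = W p" using H1_obtain_primitive[OF assms(1)] by blast
  obtain V where V: "is_primitive V (rep_l2 (weak_deriv v))" "AE x in unit_leb. rep_l2 v x = V x"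
    "\<And>p. p \<in> {0..1} \<Longrightarrow> point_value v p = V p" using H1_obtain_primitive[OF assms(2)] by blast
  have "AE x in unit_leb. rep_l2 (u + v) x = W x + V x"
    using rep_l2_add[of u v] W(2) V(2) by eventually_elim simp
  then show ?thesis
    using W(3) V(3) assms(3) continuous_on_is_primitive[OF W(1)] continuous_on_is_primitive[OF V(1)]
    by (subst point_value_eqI[of "\<lambda>x. W x + V x"]) (auto intro: continuous_on_add)
qed

lemma point_value_scaleR:
  assumes "u \<in> H1" "p \<in> {0..1}"
  shows "point_value (c *\<^sub>R u) p = c * point_value u p"
proof -
  obtain W where W: "is_primitive W (rep_l2 (weak_deriv u))" "AE x in unit_leb. rep_l2 u x = W x"
    "\<And>p. p \<in> {0..1} \<Longrightarrow> point_value u p = W p" using H1_obtain_primitive[OF assms(1)] by blast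
  have "AE x in unit_leb. rep_l2 (c *\<^sub>R u) x = c * W x"
    using rep_l2_scaleR[of c u] W(2) by eventually_elim simp
  then show ?thesis
    using W(3) assms(2) continuous_on_is_primitive[OF W(1)]
    by (subst point_value_eqI[of "\<lambda>x. c * W x"]) (auto intro: continuous_on_mult_left)
qed

lemma inner_weak_deriv_by_parts:
  assumes "u \<in> H1" "v \<in> H1"
  shows "inner (weak_deriv u) v + inner u (weak_deriv v)
    = point_value u 1 * point_value v 1 - point_value u 0 * point_value v 0"
proof -
  obtain W where W: "is_primitive W (rep_l2 (weak_deriv u))" "AE x in unit_leb. rep_l2 u x = W x"
    "\<And>p. p \<in> {0..1} \<Longrightarrow> point_value u p = W p" using H1_obtain_primitive[OF assms(1)] by blast
  obtain V where V: "is_primitive V (rep_l2 (weak_deriv v))" "AE x in unit_leb. rep_l2 v x = V x"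
    "\<And>p. p \<in> {0..1} \<Longrightarrow> point_value v p = V p" using H1_obtain_primitive[OF assms(2)] by blast
  note c = continuous_on_is_primitive[OF W(1)] continuous_on_is_primitive[OF V(1)]
  have "inner (weak_deriv u) v = (LINT x|unit_leb. rep_l2 (weak_deriv u) x * V x)"
    by (intro integral_rep_mult_eq square_integrable_rep AE_I2 refl V(2) square_integrable_continuous c)
  moreover have "inner u (weak_deriv v) = (LINT x|unit_leb. W x * rep_l2 (weak_deriv v) x)"
    by (intro integral_rep_mult_eq square_integrable_rep AE_I2 refl W(2) square_integrable_continuous c)
  moreover have "integrable unit_leb (\<lambda>x. rep_l2 (weak_deriv u) x * V x)"
    "integrable unit_leb (\<lambda>x. W x * rep_l2 (weak_deriv v) x)"
    by (intro square_integrable_mult square_integrable_rep square_integrable_continuous c)+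
  ultimately show ?thesis
    using is_primitive_integral[OF is_primitive_mult[OF W(1) V(1)]] W(3) V(3) by simp
qed

text \<open>One-sided derivatives at \<open>0\<close> and \<open>1\<close>, as for the coefficient \<open>a\<close>.\<close>
definition C1_unit :: "(real \<Rightarrow> real) \<Rightarrow> (real \<Rightarrow> real) \<Rightarrow> bool" where
  "C1_unit a a' \<longleftrightarrow> (\<forall>x\<in>{0..1}. (a has_real_derivative a' x) (at x within {0..1})) \<and> continuous_on {0..1} a'"

lemma C1_unit_continuous:
  assumes "C1_unit a a'"
  shows "continuous_on {0..1} a" "continuous_on {0..1} a'"
proof -
  show "continuous_on {0..1} a"
    by (rule DERIV_continuous_on[of _ a a']) (use assms in \<open>simp add: C1_unit_def\<close>)
  show "continuous_on {0..1} a'"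
    using assms by (simp add: C1_unit_def)
qed

lemma C1_unit_is_primitive: "C1_unit a a' \<Longrightarrow> is_primitive a a'"
  unfolding C1_unit_def by (rule is_primitive_C1) auto

lemma l2_mult_add:
  assumes "continuous_on {0..1} a"
  shows "l2_mult a (u + v) = l2_mult a u + l2_mult a v"
  by (rule l2_eqI) (use rep_l2_mult[OF assms, of u] rep_l2_mult[OF assms, of v] rep_l2_mult[OF assms, of "u + v"]
    rep_l2_add[of u v] rep_l2_add[of "l2_mult a u" "l2_mult a v"] in \<open>eventually_elim, simp add: distrib_left\<close>)

lemma l2_mult_scaleR:
  assumes "continuous_on {0..1} a"
  shows "l2_mult a (c *\<^sub>R u) = c *\<^sub>R l2_mult a u"
  by (rule l2_eqI) (use rep_l2_mult[OF assms, of u] rep_l2_mult[OF assms, of "c *\<^sub>R u"]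
    rep_l2_scaleR[of c u] rep_l2_scaleR[of c "l2_mult a u"] in \<open>eventually_elim, simp\<close>)

lemma l2_mult_mult:
  assumes "continuous_on {0..1} a" "continuous_on {0..1} b"
  shows "l2_mult a (l2_mult b u) = l2_mult (\<lambda>x. a x * b x) u"
proof (rule l2_eqI)
  show "AE x in unit_leb. rep_l2 (l2_mult a (l2_mult b u)) x = rep_l2 (l2_mult (\<lambda>x. a x * b x) u) x"
    using rep_l2_mult[OF assms(1), of "l2_mult b u"] rep_l2_mult[OF assms(2), of u]
      rep_l2_mult[OF continuous_on_mult[OF assms], of u]
    by eventually_elim (simp add: mult.assoc)
qed

lemma l2_mult_cong:
  assumes "\<And>x. 0 < x \<Longrightarrow> x < 1 \<Longrightarrow> a x = b x" "continuous_on {0..1} a" "continuous_on {0..1} b"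
  shows "l2_mult a u = l2_mult b u"
  by (rule l2_eqI) (use rep_l2_mult[OF assms(2), of u] rep_l2_mult[OF assms(3), of u] AE_unit_leb_in in
      \<open>eventually_elim, simp add: assms(1)\<close>)

lemma l2_mult_inner_swap:
  assumes "continuous_on {0..1} a"
  shows "inner (l2_mult a u) v = inner u (l2_mult a v)"
  unfolding inner_commute[of u "l2_mult a v"] inner_l2_mult[OF assms] by (simp add: mult_ac)

lemma norm_l2_sq: "(norm u)\<^sup>2 = (LINT x|unit_leb. (rep_l2 u x)\<^sup>2)" for u :: l2
  unfolding power2_norm_eq_inner inner_l2_rep by (simp add: power2_eq_square)

lemma inner_l2_mult_mono:
  assumes "continuous_on {0..1} a" "continuous_on {0..1} b" "\<And>x. 0 < x \<Longrightarrow> x < 1 \<Longrightarrow> a x \<le> b x"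
  shows "inner (l2_mult a u) u \<le> inner (l2_mult b u) u"
proof -
  have i: "integrable unit_leb (\<lambda>x. c x * rep_l2 u x * rep_l2 u x)" if "continuous_on {0..1} c" for c
    using that by (intro square_integrable_mult square_integrable_mult_continuous) auto
  show ?thesis
    unfolding inner_l2_mult[OF assms(1)] inner_l2_mult[OF assms(2)]
  proof (rule integral_mono)
    fix x assume "x \<in> space unit_leb"
    then have "a x * (rep_l2 u x * rep_l2 u x) \<le> b x * (rep_l2 u x * rep_l2 u x)"
      using assms(3)[of x] by (intro mult_right_mono) auto
    then show "a x * rep_l2 u x * rep_l2 u x \<le> b x * rep_l2 u x * rep_l2 u x"
      by (simp only: mult.assoc)
  qed (intro i assms)+
qed

lemma l2_mult_const: "l2_mult (\<lambda>x. c) u = c *\<^sub>R u"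
  by (rule l2_eqI) (use rep_l2_mult[OF continuous_on_const, of c u] rep_l2_scaleR[of c u] in \<open>eventually_elim, simp\<close>)

lemma norm_l2_mult_le:
  assumes "continuous_on {0..1} a" "\<And>x. 0 < x \<Longrightarrow> x < 1 \<Longrightarrow> \<bar>a x\<bar> \<le> B"
  shows "norm (l2_mult a u) \<le> B * norm u"
proof -
  have B: "0 \<le> B"
    using order_trans[OF abs_ge_zero assms(2)[of "1/2"]] by simp
  have "(norm (l2_mult a u))\<^sup>2 = inner (l2_mult (\<lambda>x. a x * a x) u) u"
    using l2_mult_inner_swap[OF assms(1), of "l2_mult a u" u] l2_mult_mult[OF assms(1) assms(1), of u]
    by (simp add: power2_norm_eq_inner)
  also have "\<dots> \<le> inner (l2_mult (\<lambda>x. B\<^sup>2) u) u"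
  proof (rule inner_l2_mult_mono)
    fix x :: real assume "0 < x" "x < 1"
    then have "\<bar>a x\<bar>\<^sup>2 \<le> B\<^sup>2"
      using assms(2)[of x] by (intro power_mono) simp_all
    then show "a x * a x \<le> B\<^sup>2"
      by (simp add: power2_eq_square)
  qed (intro continuous_on_mult continuous_on_const assms(1))+
  also have "\<dots> = (B * norm u)\<^sup>2"
    by (simp only: l2_mult_const power_mult_distrib power2_norm_eq_inner inner_scaleR_left)
  finally show ?thesis
    by (rule power2_le_imp_le) (simp add: B)
qed

lemma bounded_linear_l2_mult:
  assumes "continuous_on {0..1} a"
  shows "bounded_linear (l2_mult a)"
proof -
  obtain B where "\<And>x. 0 \<le> x \<Longrightarrow> x \<le> 1 \<Longrightarrow> \<bar>a x\<bar> \<le> B"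
    using continuous_on_unit_bounded[OF assms] by blast
  then have "norm (l2_mult a u) \<le> norm u * B" for u
    using norm_l2_mult_le[OF assms, of B u] by (simp add: mult.commute)
  then show ?thesis
    by (intro bounded_linear_intro[of "l2_mult a" B] l2_mult_add[OF assms] l2_mult_scaleR[OF assms])
qed

lemma l2_mult_C1:
  assumes a: "C1_unit a a'" and u: "u \<in> H1"
  shows "l2_mult a u \<in> H1"
    and "weak_deriv (l2_mult a u) = l2_mult a' u + l2_mult a (weak_deriv u)"
    and "p \<in> {0..1} \<Longrightarrow> point_value (l2_mult a u) p = a p * point_value u p"
proof -
  note ca = C1_unit_continuous[OF a]
  obtain W where W: "is_primitive W (rep_l2 (weak_deriv u))" "AE x in unit_leb. rep_l2 u x = W x"
    "\<And>p. p \<in> {0..1} \<Longrightarrow> point_value u p = W p" using H1_obtain_primitive[OF u] by blast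
  have aW: "AE x in unit_leb. rep_l2 (l2_mult a u) x = a x * W x"
    using W(2) rep_l2_mult[OF ca(1), of u] by eventually_elim simp
  have "has_weak_deriv (l2_mult a u) (l2_mult a' u + l2_mult a (weak_deriv u))"
  proof (rule primitive_has_weak_deriv[OF is_primitive_mult[OF C1_unit_is_primitive[OF a] W(1)] aW])
    show "AE x in unit_leb. rep_l2 (l2_mult a' u + l2_mult a (weak_deriv u)) x = a' x * W x + a x * rep_l2 (weak_deriv u) x"
      using rep_l2_add[of "l2_mult a' u" "l2_mult a (weak_deriv u)"] rep_l2_mult[OF ca(2), of u]
        rep_l2_mult[OF ca(1), of "weak_deriv u"] W(2) by eventually_elim simp
  qed
  then show "l2_mult a u \<in> H1" "weak_deriv (l2_mult a u) = l2_mult a' u + l2_mult a (weak_deriv u)"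
    by (auto simp: H1_def intro: weak_deriv_eqI)
  show "point_value (l2_mult a u) p = a p * point_value u p" if "p \<in> {0..1}"
    using point_value_eqI[OF _ aW that] W(3)[OF that] ca continuous_on_is_primitive[OF W(1)]
    by (simp add: continuous_on_mult)
qed

lemma l2_of_C1:
  assumes a: "C1_unit a a'"
  shows "l2_of a \<in> H1" "weak_deriv (l2_of a) = l2_of a'"
    and "p \<in> {0..1} \<Longrightarrow> point_value (l2_of a) p = a p"
proof -
  note ca = C1_unit_continuous[OF a]
  have r: "AE x in unit_leb. rep_l2 (l2_of a) x = a x" "AE x in unit_leb. rep_l2 (l2_of a') x = a' x"
    using ca by (auto intro: rep_l2_of square_integrable_continuous)
  have "has_weak_deriv (l2_of a) (l2_of a')"
    by (rule primitive_has_weak_deriv[OF C1_unit_is_primitive[OF a] r])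
  then show "l2_of a \<in> H1" "weak_deriv (l2_of a) = l2_of a'"
    by (auto simp: H1_def intro: weak_deriv_eqI)
  show "point_value (l2_of a) p = a p" if "p \<in> {0..1}"
    by (rule point_value_eqI[OF ca(1) r(1) that])
qed

text \<open>The source of all multiplier identities: integration by parts of \<open>\<phi> u\<close> against \<open>u\<close>.\<close>
lemma weighted_energy_identity:
  assumes \<phi>: "C1_unit \<phi> \<phi>'" and u: "u \<in> H1"
  shows "2 * inner (l2_mult \<phi> u) (weak_deriv u) + inner (l2_mult \<phi>' u) u
    = \<phi> 1 * (point_value u 1)\<^sup>2 - \<phi> 0 * (point_value u 0)\<^sup>2"
  using inner_weak_deriv_by_parts[OF l2_mult_C1(1)[OF \<phi> u] u] l2_mult_inner_swap[OF C1_unit_continuous(1)[OF \<phi>], of "weak_deriv u" u]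
  by (simp add: l2_mult_C1[OF \<phi> u] inner_add_left inner_add_right power2_eq_square inner_commute mult.assoc)

lemma l2_integral_weak_deriv:
  assumes "u \<in> H1"
  shows "l2_integral (weak_deriv u) = point_value u 1 - point_value u 0"
proof -
  have c: "C1_unit (\<lambda>x. 1) (\<lambda>x. 0)"
    by (auto simp: C1_unit_def)
  have "l2_of (\<lambda>x. 0) = 0"
    by (rule l2_of_eqI) (use rep_l2_scaleR[of 0 0] in \<open>auto simp: square_integrable_zero\<close>)
  then show ?thesis
    using inner_weak_deriv_by_parts[OF assms l2_of_C1(1)[OF c]]
    by (simp add: l2_of_C1[OF c] l2_integral_eq_inner)
qed

text \<open>Integration by parts against \<open>1 - x\<close>. The right-hand side shows that the trace at \<open>0\<close> is continuous in \<open>H\<^sup>1\<close>.\<close>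
lemma point_value_0_eq:
  assumes "u \<in> H1"
  shows "point_value u 0 = l2_integral u - inner (weak_deriv u) (l2_of (\<lambda>x. 1 - x))"
proof -
  have c: "C1_unit (\<lambda>x. 1 - x) (\<lambda>x. -1)"
    by (auto simp: C1_unit_def intro!: derivative_eq_intros)
  have "inner u (l2_of (\<lambda>x. -1)) = - l2_integral u"
    unfolding l2_integral_def
    by (subst inner_rep_l2_of) (auto intro!: square_integrable_continuous continuous_intros)
  then show ?thesis
    using inner_weak_deriv_by_parts[OF assms l2_of_C1(1)[OF c]] by (simp add: l2_of_C1[OF c])
qed

section \<open>Completeness of the space of square integrable classes\<close>

text \<open>The lemma of Fatou.\<close>
lemma l2_norm_le_of_pointwise_limit:
  assumes L: "L \<in> borel_measurable unit_leb"
    and conv: "AE x in unit_leb. (\<lambda>n. rep_l2 (X n) x) \<longlonglongrightarrow> L x"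
    and B: "\<And>n. norm (X n) \<le> B"
  shows "square_integrable L" "norm (l2_of L) \<le> B"
proof -
  have B0: "0 \<le> B" by (rule order_trans[OF norm_ge_zero B[of 0]])
  have sq: "(\<integral>\<^sup>+x. ennreal ((rep_l2 u x)\<^sup>2) \<partial>unit_leb) = ennreal ((norm u)\<^sup>2)" for u
    using square_integrable_rep[of u] unfolding norm_l2_sq
    by (intro nn_integral_eq_integral) (auto simp: square_integrable_def)
  have "(\<integral>\<^sup>+x. ennreal ((L x)\<^sup>2) \<partial>unit_leb) = (\<integral>\<^sup>+x. liminf (\<lambda>n. ennreal ((rep_l2 (X n) x)\<^sup>2)) \<partial>unit_leb)"
  proof (rule nn_integral_cong_AE)
    show "AE x in unit_leb. ennreal ((L x)\<^sup>2) = liminf (\<lambda>n. ennreal ((rep_l2 (X n) x)\<^sup>2))"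
      using conv
    proof eventually_elim
      case (elim x)
      then have "(\<lambda>n. ennreal ((rep_l2 (X n) x)\<^sup>2)) \<longlonglongrightarrow> ennreal ((L x)\<^sup>2)"
        by (intro tendsto_intros)
      then show ?case
        by (intro lim_imp_Liminf[symmetric]) auto
    qed
  qed
  also have "\<dots> \<le> liminf (\<lambda>n. \<integral>\<^sup>+x. ennreal ((rep_l2 (X n) x)\<^sup>2) \<partial>unit_leb)"
    by (rule nn_integral_liminf) measurable
  also have "\<dots> \<le> liminf (\<lambda>n::nat. ennreal (B\<^sup>2))"
    unfolding sq by (intro Liminf_mono always_eventually allI ennreal_leI power_mono B) auto
  also have "\<dots> = ennreal (B\<^sup>2)"
    by (simp add: Liminf_const)
  finally have le: "(\<integral>\<^sup>+x. ennreal ((L x)\<^sup>2) \<partial>unit_leb) \<le> ennreal (B\<^sup>2)" .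
  have int: "integrable unit_leb (\<lambda>x. (L x)\<^sup>2)"
    using L le by (intro integrableI_nonneg) (auto intro: le_less_trans)
  then show L2: "square_integrable L"
    using L by (simp add: square_integrable_def)
  have "(norm (l2_of L))\<^sup>2 = (LINT x|unit_leb. (L x)\<^sup>2)"
    unfolding power2_norm_eq_inner using L2 by (simp add: inner_l2_of power2_eq_square)
  also have "\<dots> \<le> B\<^sup>2"
    using le int by (subst (asm) nn_integral_eq_integral) auto
  finally show "norm (l2_of L) \<le> B"
    using B0 by (rule power2_le_imp_le)
qed

text \<open>Any constant factor below \<open>9/4\<close> would serve the gliding hump argument, where this bound is used with one
  further factor \<open>1/3\<close> and must stay below \<open>3/4\<close>. The sharp constant is \<open>3/2\<close>.\<close>
lemma geometric_steps_norm_le: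
  fixes X :: "nat \<Rightarrow> 'a::real_normed_vector"
  assumes "\<And>n. norm (X (Suc n) - X n) \<le> C * (1/3) ^ n"
  shows "norm (X (n + k) - X n) \<le> 2 * C * (1/3) ^ n"
proof -
  have C: "0 \<le> C"
    using order_trans[OF norm_ge_zero assms[of 0]] by simp
  have "norm (X (n + k) - X n) \<le> 3/2 * C * (1/3) ^ n * (1 - (1/3) ^ k)"
  proof (induction k)
    case (Suc k)
    have "norm (X (n + Suc k) - X n) \<le> norm (X (Suc (n + k)) - X (n + k)) + norm (X (n + k) - X n)"
      using norm_triangle_ineq[of "X (Suc (n + k)) - X (n + k)" "X (n + k) - X n"] by simp
    also have "\<dots> \<le> C * (1/3) ^ (n + k) + 3/2 * C * (1/3) ^ n * (1 - (1/3) ^ k)"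
      by (intro add_mono assms Suc)
    also have "\<dots> = 3/2 * C * (1/3) ^ n * (1 - (1/3) ^ Suc k)"
    proof -
      have "C * (a * b) + 3/2 * C * a * (1 - b) = 3/2 * C * a * (1 - 1/3 * b)" for a b :: real
        by (simp add: field_simps)
      then show ?thesis
        by (simp only: power_add power_Suc)
    qed
    finally show ?case .
  qed simp
  also have "\<dots> \<le> 3/2 * C * (1/3) ^ n * 1"
    using C by (intro mult_left_mono) auto
  also have "\<dots> \<le> 2 * C * (1/3) ^ n"
    using C by (simp add: mult_right_mono)
  finally show ?thesis .
qed

text \<open>The argument of Riesz and Fischer: the steps are summable in \<open>L\<^sup>1\<close>, so the representatives converge
  almost everywhere, and the bound on the tails passes to the pointwise limit.\<close>
lemma l2_convergent_if_geometric_steps: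
  fixes X :: "nat \<Rightarrow> l2"
  assumes X: "\<And>n. norm (X (Suc n) - X n) \<le> C * (1/3) ^ n"
  shows "convergent X"
proof -
  define d where "d = (\<lambda>n x. \<bar>rep_l2 (X (Suc n) - X n) x\<bar>)"
  have C: "0 \<le> C"
    using order_trans[OF norm_ge_zero X[of 0]] by simp
  have int_d: "(\<integral>\<^sup>+x. ennreal (d n x) \<partial>unit_leb) \<le> ennreal (C * (1/3) ^ n)" for n
  proof -
    have sd: "square_integrable (d n)"
      using square_integrable_rep[of "X (Suc n) - X n"] by (auto simp: square_integrable_def d_def)
    have one: "square_integrable (\<lambda>x. 1)"
      by (intro square_integrable_continuous continuous_intros)
    have "norm (l2_of (\<lambda>x. 1)) = 1"
      by (simp add: norm_eq_sqrt_inner inner_l2_of one measure_restrict_space)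
    have "norm (l2_of (d n)) = norm (X (Suc n) - X n)"
      unfolding norm_eq_sqrt_inner inner_l2_of[OF sd sd] by (simp add: inner_l2_rep d_def)
    have "(\<integral>\<^sup>+x. ennreal (d n x) \<partial>unit_leb) = ennreal (LINT x|unit_leb. d n x)"
      using square_integrable_imp_integrable[OF sd] by (intro nn_integral_eq_integral) (auto simp: d_def)
    also have "(LINT x|unit_leb. d n x) = inner (l2_of (d n)) (l2_of (\<lambda>x. 1))"
      using sd one by (simp add: inner_l2_of)
    also have "\<dots> \<le> norm (l2_of (d n)) * norm (l2_of (\<lambda>x. 1))"
      by (rule norm_cauchy_schwarz)
    also have "\<dots> \<le> C * (1/3) ^ n"
      using X[of n] \<open>norm (l2_of (\<lambda>x. 1)) = 1\<close> \<open>norm (l2_of (d n)) = _\<close> by simp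
    finally show ?thesis
      by (simp add: ennreal_leI)
  qed
  have "(\<integral>\<^sup>+x. (\<Sum>n. ennreal (d n x)) \<partial>unit_leb) = (\<Sum>n. \<integral>\<^sup>+x. ennreal (d n x) \<partial>unit_leb)"
    unfolding d_def by (rule nn_integral_suminf) measurable
  also have "\<dots> \<le> (\<Sum>n. ennreal (C * (1/3) ^ n))"
    by (intro suminf_le int_d) auto
  also have "\<dots> < \<infinity>"
  proof -
    have "summable (\<lambda>n. C * (1/3) ^ n)"
      by (intro summable_mult summable_geometric) simp
    then show ?thesis
      using C by (subst suminf_ennreal2) simp_all
  qed
  finally have "AE x in unit_leb. (\<Sum>n. ennreal (d n x)) \<noteq> \<infinity>"
    unfolding d_def by (intro nn_integral_PInf_AE) (auto simp: infinity_ennreal_def)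
  moreover have "AE x in unit_leb. \<forall>n. rep_l2 (X (Suc n)) x = rep_l2 (X n) x + rep_l2 (X (Suc n) - X n) x"
    unfolding AE_all_countable
  proof
    show "AE x in unit_leb. rep_l2 (X (Suc n)) x = rep_l2 (X n) x + rep_l2 (X (Suc n) - X n) x" for n
      using rep_l2_add[of "X n" "X (Suc n) - X n"] by simp
  qed
  ultimately have "AE x in unit_leb. convergent (\<lambda>n. rep_l2 (X n) x)"
  proof eventually_elim
    case (elim x)
    have "summable (\<lambda>n. d n x)"
      using elim(1) by (intro summable_suminf_not_top) (auto simp: d_def)
    then have "summable (\<lambda>n. rep_l2 (X (Suc n) - X n) x)"
      unfolding d_def by (rule summable_rabs_cancel)
    then have "summable (\<lambda>n. rep_l2 (X (Suc n)) x - rep_l2 (X n) x)"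
      using elim(2) by simp
    then have "convergent (\<lambda>n. rep_l2 (X 0) x + (\<Sum>i<n. rep_l2 (X (Suc i)) x - rep_l2 (X i) x))"
      by (intro convergent_add convergent_const) (simp add: summable_iff_convergent)
    moreover have "rep_l2 (X 0) x + (\<Sum>i<n. rep_l2 (X (Suc i)) x - rep_l2 (X i) x) = rep_l2 (X n) x" for n
      by (subst sum_lessThan_telescope) simp
    ultimately show ?case
      by simp
  qed
  then have conv: "AE x in unit_leb. (\<lambda>n. rep_l2 (X n) x) \<longlonglongrightarrow> lim (\<lambda>n. rep_l2 (X n) x)"
    by eventually_elim (simp add: convergent_LIMSEQ_iff)
  define L where "L = (\<lambda>x. lim (\<lambda>n. rep_l2 (X n) x))"
  have L: "L \<in> borel_measurable unit_leb"
    unfolding L_def by (intro borel_measurable_lim_metric rep_l2_measurable)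
  have L2: "square_integrable L"
  proof (rule l2_norm_le_of_pointwise_limit(1)[OF L])
    show "AE x in unit_leb. (\<lambda>n. rep_l2 (X n) x) \<longlonglongrightarrow> L x"
      unfolding L_def by (rule conv)
    show "norm (X n) \<le> norm (X 0) + 2 * C" for n
      using geometric_steps_norm_le[OF X, of 0 n] norm_triangle_sub[of "X n" "X 0"] by simp
  qed
  have "norm (X n - l2_of L) \<le> 2 * C * (1/3) ^ n" for n
  proof -
    define M where "M = (\<lambda>x. L x - rep_l2 (X n) x)"
    have M: "M \<in> borel_measurable unit_leb"
      unfolding M_def by (intro borel_measurable_diff L rep_l2_measurable)
    have Y: "AE x in unit_leb. \<forall>k. rep_l2 (X (n + k)) x = rep_l2 (X (n + k) - X n) x + rep_l2 (X n) x"
      unfolding AE_all_countable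
    proof
      show "AE x in unit_leb. rep_l2 (X (n + k)) x = rep_l2 (X (n + k) - X n) x + rep_l2 (X n) x" for k
        using rep_l2_add[of "X (n + k) - X n" "X n"] by simp
    qed
    have *: "AE x in unit_leb. (\<lambda>k. rep_l2 (X (n + k) - X n) x) \<longlonglongrightarrow> M x"
      using Y conv
    proof eventually_elim
      case (elim x)
      have "(\<lambda>k. rep_l2 (X (n + k)) x - rep_l2 (X n) x) \<longlonglongrightarrow> L x - rep_l2 (X n) x"
        using LIMSEQ_ignore_initial_segment[OF elim(2), of n]
        by (intro tendsto_diff tendsto_const) (simp add: L_def add.commute)
      then show ?case
        using elim(1) by (simp add: M_def)
    qed
    have "norm (l2_of M) \<le> 2 * C * (1/3) ^ n"
      by (rule l2_norm_le_of_pointwise_limit(2)[OF M *]) (rule geometric_steps_norm_le[OF X])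
    moreover have "l2_of M = l2_of L - X n"
    proof (rule l2_of_eqI)
      show "square_integrable M"
        by (rule l2_norm_le_of_pointwise_limit(1)[OF M *]) (rule geometric_steps_norm_le[OF X])
      show "AE x in unit_leb. rep_l2 (l2_of L - X n) x = M x"
        using rep_l2_add[of "l2_of L - X n" "X n"] rep_l2_of[OF L2]
        by eventually_elim (simp add: M_def)
    qed
    ultimately show ?thesis
      by (simp add: norm_minus_commute)
  qed
  moreover have "(\<lambda>n. 2 * C * (1/3) ^ n) \<longlonglongrightarrow> 0"
    by (rule tendsto_mult_right_zero) (rule LIMSEQ_realpow_zero, simp_all)
  ultimately have "(\<lambda>n. X n - l2_of L) \<longlonglongrightarrow> 0"
    by (rule Lim_null_comparison[OF always_eventually[OF allI]])
  then have "X \<longlonglongrightarrow> l2_of L"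
    by (rule LIM_zero_cancel)
  then show ?thesis
    by (rule convergentI)
qed

section \<open>Decay of dissipative semigroups\<close>

text \<open>Subtract a line of small positive slope \<open>r\<close>. At the last point where the difference is still at most its initial
  value, the right derivative forces it to stay there a little longer, unless that point is the right end.\<close>
lemma nonincreasing_if_right_derivative_nonpos:
  fixes f :: "real \<Rightarrow> real"
  assumes ab: "a \<le> b" and cont: "continuous_on {a..b} f"
    and deriv: "\<And>t. a \<le> t \<Longrightarrow> t < b \<Longrightarrow> \<exists>d\<le>0. ((\<lambda>h. (f (t + h) - f t) / h) \<longlongrightarrow> d) (at_right 0)"
  shows "f b \<le> f a"
proof (rule field_le_epsilon)
  fix e :: real assume e: "0 < e"
  define r where "r = e / (b - a + 1)"
  have r: "0 < r" "r * (b - a) \<le> e"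
    using e ab by (auto simp: r_def field_simps)
  define g where "g = (\<lambda>t. f t - f a - r * (t - a))"
  have contg: "continuous_on {a..b} g"
    unfolding g_def by (intro continuous_on_diff continuous_on_mult continuous_on_const continuous_on_id cont)
  define Z where "Z = {t \<in> {a..b}. g t \<le> 0}"
  have "closed ({a..b} \<inter> g -` {..0})"
    by (rule continuous_closed_preimage[OF contg]) auto
  also have "{a..b} \<inter> g -` {..0} = Z"
    by (auto simp: Z_def)
  finally have "closed Z" .
  moreover have "bounded Z"
    by (rule bounded_subset[of "{a..b}"]) (auto simp: Z_def)
  ultimately have "compact Z"
    by (simp add: compact_eq_bounded_closed)
  moreover have "a \<in> Z"
    using ab by (simp add: Z_def g_def)
  ultimately obtain c where c: "c \<in> Z" "\<And>t. t \<in> Z \<Longrightarrow> t \<le> c"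
    using compact_attains_sup[of Z] by blast
  have "c = b"
  proof (rule ccontr)
    assume "c \<noteq> b"
    then have cb: "a \<le> c" "c < b"
      using c by (auto simp: Z_def)
    obtain d where d: "d \<le> 0" "((\<lambda>h. (f (c + h) - f c) / h) \<longlongrightarrow> d) (at_right 0)"
      using deriv[OF cb] by blast
    have "\<forall>\<^sub>F h in at_right 0. (f (c + h) - f c) / h < r"
      using d r by (intro order_tendstoD(2)[OF d(2)]) simp
    moreover have "\<forall>\<^sub>F h in at_right 0. h \<in> {0<..<b - c}"
      using cb by (intro eventually_at_right_real) simp
    ultimately have "\<forall>\<^sub>F h in at_right (0::real). False"
    proof eventually_elim
      case (elim h)
      then have "f (c + h) - f c < r * h"
        by (simp add: divide_less_eq)
      then have "g (c + h) \<le> g c"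
        by (simp add: g_def algebra_simps)
      also have "\<dots> \<le> 0"
        using c by (simp add: Z_def)
      finally have "c + h \<in> Z"
        using elim cb by (simp add: Z_def)
      then show ?case
        using c(2)[of "c + h"] elim by simp
    qed
    then show False by simp
  qed
  then have "f b \<le> f a + r * (b - a)"
    using c by (simp add: Z_def g_def)
  then show "f b \<le> f a + e"
    using r by simp
qed

text \<open>The norm is pulled back from an inner product space by a map \<open>J\<close> that is linear on \<open>S\<close> only, because
  the norm of the state space depends on parameters and so is not that of its type. Completeness is
  assumed only for sequences with geometrically decreasing steps.\<close>
locale dissipative_semigroup =
  fixes S D :: "'a::real_vector set" and N :: "'a \<Rightarrow> real" and A :: "'a \<Rightarrow> 'a"
    and T :: "real \<Rightarrow> 'a \<Rightarrow> 'a" and J :: "'a \<Rightarrow> 'b::real_inner"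
  assumes S: "subspace S"
    and J_add: "\<And>x y. x \<in> S \<Longrightarrow> y \<in> S \<Longrightarrow> J (x + y) = J x + J y"
    and J_scaleR: "\<And>x c. x \<in> S \<Longrightarrow> J (c *\<^sub>R x) = c *\<^sub>R J x"
    and N_eq: "\<And>x. x \<in> S \<Longrightarrow> N x = norm (J x)"
    and complete: "\<And>X. (\<And>n. X n \<in> S) \<Longrightarrow> (\<And>n. norm (J (X (Suc n)) - J (X n)) \<le> (1/3) ^ n) \<Longrightarrow>
      \<exists>x\<in>S. (\<lambda>n. J (X n)) \<longlonglongrightarrow> J x"
    and gen: "generates S N D A T"
    and A_in_S: "\<And>x. x \<in> D \<Longrightarrow> A x \<in> S"
    and dissipative: "\<And>x. x \<in> D \<Longrightarrow> inner (J (A x)) (J x) \<le> 0"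
begin

lemma D_subset: "x \<in> D \<Longrightarrow> x \<in> S"
  using gen by (auto simp: generates_def)

lemma S_closed: "x \<in> S \<Longrightarrow> y \<in> S \<Longrightarrow> x + y \<in> S" "x \<in> S \<Longrightarrow> y \<in> S \<Longrightarrow> x - y \<in> S" "x \<in> S \<Longrightarrow> c *\<^sub>R x \<in> S" "0 \<in> S"
  using S by (auto simp: subspace_add subspace_diff subspace_scale subspace_0)

lemma J_diff: "x \<in> S \<Longrightarrow> y \<in> S \<Longrightarrow> J (x - y) = J x - J y"
  using J_add[of "x - y" y] S_closed(2)[of x y] by simp

lemma J_zero: "J 0 = 0"
  using J_scaleR[of 0 0] S_closed(4) by simp

lemma semigroup: "C0_semigroup S N T"
  using gen by (simp add: generates_def)

lemma bounded_op: "0 \<le> t \<Longrightarrow> bounded_operator_on S N (T t)"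
  using semigroup by (simp add: C0_semigroup_def)

lemma T_in_S: "0 \<le> t \<Longrightarrow> x \<in> S \<Longrightarrow> T t x \<in> S"
  using bounded_op[of t] by (auto simp: bounded_operator_on_def)

lemma T_add: "0 \<le> t \<Longrightarrow> x \<in> S \<Longrightarrow> y \<in> S \<Longrightarrow> T t (x + y) = T t x + T t y"
  using bounded_op[of t] by (simp add: bounded_operator_on_def)

lemma T_scaleR: "0 \<le> t \<Longrightarrow> x \<in> S \<Longrightarrow> T t (c *\<^sub>R x) = c *\<^sub>R T t x"
  using bounded_op[of t] by (simp add: bounded_operator_on_def)

lemma T_diff: "0 \<le> t \<Longrightarrow> x \<in> S \<Longrightarrow> y \<in> S \<Longrightarrow> T t (x - y) = T t x - T t y"
  using T_add[of t "x - y" y] S_closed(2)[of x y] by simp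

lemma T_0: "x \<in> S \<Longrightarrow> T 0 x = x"
  using semigroup by (simp add: C0_semigroup_def)

lemma T_plus: "0 \<le> s \<Longrightarrow> 0 \<le> t \<Longrightarrow> x \<in> S \<Longrightarrow> T (s + t) x = T s (T t x)"
  using semigroup by (simp add: C0_semigroup_def)

lemma T_bounded:
  assumes "0 \<le> t"
  obtains B where "0 \<le> B" "\<And>x. x \<in> S \<Longrightarrow> norm (J (T t x)) \<le> B * norm (J x)"
proof -
  obtain B where B: "\<And>x. x \<in> S \<Longrightarrow> N (T t x) \<le> B * N x"
    using bounded_op[OF assms] unfolding bounded_operator_on_def by blast
  show thesis
  proof (rule that[of "max B 0"])
    fix x assume x: "x \<in> S"
    have "norm (J (T t x)) \<le> B * norm (J x)"
      using B[OF x] N_eq[OF x] N_eq[OF T_in_S[OF assms x]] by simp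
    also have "\<dots> \<le> max B 0 * norm (J x)"
      by (intro mult_right_mono) auto
    finally show "norm (J (T t x)) \<le> max B 0 * norm (J x)" .
  qed simp
qed

lemma T_continuous_0:
  assumes x: "x \<in> S"
  shows "((\<lambda>h. J (T h x)) \<longlongrightarrow> J x) (at_right 0)"
proof -
  have "((\<lambda>h. N (T h x - x)) \<longlongrightarrow> 0) (at_right 0)"
    using semigroup x by (simp add: C0_semigroup_def)
  moreover have "\<forall>\<^sub>F h in at_right 0. N (T h x - x) = norm (J (T h x) - J x)"
    using eventually_at_right_less[of 0]
  proof eventually_elim
    case (elim h)
    then have "T h x \<in> S"
      using T_in_S x by simp
    then show ?case
      using x by (simp add: N_eq S_closed J_diff)
  qed
  ultimately have "((\<lambda>h. norm (J (T h x) - J x)) \<longlongrightarrow> 0) (at_right 0)"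
    by (rule Lim_transform_eventually)
  then show ?thesis
    by (rule LIM_zero_cancel[OF tendsto_norm_zero_cancel])
qed

definition diffquot :: "real \<Rightarrow> 'a \<Rightarrow> 'a" where
  "diffquot h x = (1 / h) *\<^sub>R (T h x - x)"

lemma diffquot_in_S: "0 \<le> h \<Longrightarrow> x \<in> S \<Longrightarrow> diffquot h x \<in> S"
  by (simp add: diffquot_def S_closed T_in_S)

lemma J_diffquot: "0 \<le> h \<Longrightarrow> x \<in> S \<Longrightarrow> J (diffquot h x) = (1 / h) *\<^sub>R (J (T h x) - J x)"
  by (simp add: diffquot_def S_closed T_in_S J_scaleR J_diff)

lemma T_diffquot:
  assumes "0 \<le> t" "0 \<le> h" "x \<in> S"
  shows "T t (diffquot h x) = diffquot h (T t x)"
proof -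
  have "T t (T h x) = T h (T t x)"
    using T_plus[of t h x] T_plus[of h t x] assms by (simp add: add.commute)
  then show ?thesis
    using assms by (simp add: diffquot_def T_scaleR T_diff S_closed T_in_S)
qed

lemma generator_iff:
  assumes x: "x \<in> S" and w: "w \<in> S"
  shows "((\<lambda>h. J (diffquot h x)) \<longlongrightarrow> J w) (at_right 0) \<longleftrightarrow> x \<in> D \<and> w = A x"
proof -
  have ev: "\<forall>\<^sub>F h in at_right 0. N ((1 / h) *\<^sub>R (T h x - x) - w) = norm (J (diffquot h x) - J w)"
    using eventually_at_right_less[of 0]
  proof eventually_elim
    case (elim h)
    then show ?case
      using diffquot_in_S[of h x] x w by (simp add: diffquot_def[symmetric] N_eq S_closed J_diff)
  qed
  have "((\<lambda>h. J (diffquot h x)) \<longlongrightarrow> J w) (at_right 0) \<longleftrightarrow>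
      ((\<lambda>h. norm (J (diffquot h x) - J w)) \<longlongrightarrow> 0) (at_right 0)"
    by (simp add: tendsto_norm_zero_iff LIM_zero_iff)
  also have "\<dots> \<longleftrightarrow> ((\<lambda>h. N ((1 / h) *\<^sub>R (T h x - x) - w)) \<longlongrightarrow> 0) (at_right 0)"
    using tendsto_cong[OF ev] by simp
  also have "\<dots> \<longleftrightarrow> x \<in> D \<and> w = A x"
    using gen x w by (simp add: generates_def)
  finally show ?thesis .
qed

lemma diffquot_tendsto: "x \<in> D \<Longrightarrow> ((\<lambda>h. J (diffquot h x)) \<longlongrightarrow> J (A x)) (at_right 0)"
  using generator_iff[of x "A x"] D_subset A_in_S by simp

text \<open>The bounded operator \<open>T t\<close> commutes with difference quotients, so it maps their limit to the limit.\<close>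
lemma T_in_D:
  assumes x: "x \<in> D" and t: "0 \<le> t"
  shows "T t x \<in> D" "A (T t x) = T t (A x)"
proof -
  note xS = D_subset[OF x] and AS = A_in_S[OF x]
  obtain B where B: "0 \<le> B" "\<And>x. x \<in> S \<Longrightarrow> norm (J (T t x)) \<le> B * norm (J x)"
    using T_bounded[OF t] by blast
  have "((\<lambda>h. J (diffquot h (T t x)) - J (T t (A x))) \<longlongrightarrow> 0) (at_right 0)"
  proof (rule Lim_null_comparison)
    show "\<forall>\<^sub>F h in at_right 0. norm (J (diffquot h (T t x)) - J (T t (A x))) \<le> B * norm (J (diffquot h x) - J (A x))"
      using eventually_at_right_less[of 0]
    proof eventually_elim
      case (elim h)
      then have h: "0 \<le> h" by simp
      have "J (diffquot h (T t x)) - J (T t (A x)) = J (T t (diffquot h x - A x))"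
        using T_diffquot[OF t h xS] diffquot_in_S[OF h xS] AS t h xS by (simp add: T_diff J_diff T_in_S diffquot_in_S)
      also have "norm \<dots> \<le> B * norm (J (diffquot h x - A x))"
        by (intro B S_closed diffquot_in_S h xS AS)
      also have "J (diffquot h x - A x) = J (diffquot h x) - J (A x)"
        by (intro J_diff diffquot_in_S h xS AS)
      finally show ?case .
    qed
    have "((\<lambda>h. B * norm (J (diffquot h x) - J (A x))) \<longlongrightarrow> B * norm (J (A x) - J (A x))) (at_right 0)"
      by (intro tendsto_intros diffquot_tendsto x)
    then show "((\<lambda>h. B * norm (J (diffquot h x) - J (A x))) \<longlongrightarrow> 0) (at_right 0)"
      by simp
  qed
  then have "((\<lambda>h. J (diffquot h (T t x))) \<longlongrightarrow> J (T t (A x))) (at_right 0)"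
    by (rule LIM_zero_cancel)
  then show "T t x \<in> D" "A (T t x) = T t (A x)"
    using generator_iff[OF T_in_S[OF t xS] T_in_S[OF t AS]] by auto
qed

lemma D_scaleR_diff:
  assumes x: "x \<in> D" and y: "y \<in> D"
  shows "c *\<^sub>R (x - y) \<in> D" 
proof -
  note xS = D_subset[OF x] and yS = D_subset[OF y]
  have "((\<lambda>h. J (diffquot h (c *\<^sub>R (x - y)))) \<longlongrightarrow> c *\<^sub>R (J (A x) - J (A y))) (at_right 0)"
  proof (rule Lim_transform_eventually)
    show "((\<lambda>h. c *\<^sub>R (J (diffquot h x) - J (diffquot h y))) \<longlongrightarrow> c *\<^sub>R (J (A x) - J (A y))) (at_right 0)"
      by (intro tendsto_intros diffquot_tendsto x y)
    show "\<forall>\<^sub>F h in at_right 0. c *\<^sub>R (J (diffquot h x) - J (diffquot h y)) = J (diffquot h (c *\<^sub>R (x - y)))"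
      using eventually_at_right_less[of 0]
    proof eventually_elim
      case (elim h)
      then have h: "0 \<le> h" by simp
      have "J (T h (c *\<^sub>R (x - y))) = c *\<^sub>R (J (T h x) - J (T h y))"
        using h xS yS by (simp add: T_scaleR T_diff S_closed J_scaleR J_diff T_in_S)
      moreover have "J (c *\<^sub>R (x - y)) = c *\<^sub>R (J x - J y)"
        using xS yS by (simp add: S_closed J_scaleR J_diff)
      ultimately have "J (diffquot h (c *\<^sub>R (x - y))) = (1 / h) *\<^sub>R (c *\<^sub>R (J (T h x) - J (T h y)) - c *\<^sub>R (J x - J y))"
        using J_diffquot[OF h, of "c *\<^sub>R (x - y)"] xS yS by (simp only: S_closed)
      then show ?case
        unfolding J_diffquot[OF h xS] J_diffquot[OF h yS] by (simp only:) (simp add: algebra_simps)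
    qed
  qed
  moreover have "J (c *\<^sub>R (A x - A y)) = c *\<^sub>R (J (A x) - J (A y))"
    using A_in_S[OF x] A_in_S[OF y] by (simp add: S_closed J_scaleR J_diff)
  ultimately show ?thesis
    using generator_iff[of "c *\<^sub>R (x - y)" "c *\<^sub>R (A x - A y)"] xS yS A_in_S[OF x] A_in_S[OF y]
    by (simp add: S_closed)
qed

lemma diffquot_in_D: "x \<in> D \<Longrightarrow> 0 \<le> h \<Longrightarrow> diffquot h x \<in> D"
  unfolding diffquot_def by (intro D_scaleR_diff T_in_D)

text \<open>The number \<open>k\<close> is the operator norm of \<open>T t\<close>; the vector \<open>x0\<close> witnesses that it is at least \<open>B\<close>.\<close>
lemma near_maximizer:
  assumes t: "0 \<le> t" and x0: "x0 \<in> S" "B * norm (J x0) < norm (J (T t x0))" and B: "0 < B"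
  obtains k v where "B \<le> k" "v \<in> S" "norm (J v) \<le> 1" "3/4 * k \<le> norm (J (T t v))"
    "\<And>x. x \<in> S \<Longrightarrow> norm (J (T t x)) \<le> k * norm (J x)"
proof -
  obtain L where L: "0 \<le> L" "\<And>x. x \<in> S \<Longrightarrow> norm (J (T t x)) \<le> L * norm (J x)"
    using T_bounded[OF t] by blast
  define R where "R = (\<lambda>x. norm (J (T t x))) ` {x \<in> S. norm (J x) \<le> 1}"
  define k where "k = Sup R"
  have bdd: "bdd_above R"
  proof (rule bdd_aboveI[of _ L])
    fix r assume "r \<in> R"
    then obtain x where x: "x \<in> S" "norm (J x) \<le> 1" "r = norm (J (T t x))"
      by (auto simp: R_def)
    have "L * norm (J x) \<le> L * 1"
      using x L by (intro mult_left_mono) auto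
    then show "r \<le> L"
      using L(2)[OF x(1)] x by simp
  qed
  have le: "norm (J (T t x)) \<le> k * norm (J x)" if x: "x \<in> S" for x
  proof (cases "J x = 0")
    case True
    then show ?thesis using L(2)[OF x] by simp
  next
    case False
    define y where "y = (1 / norm (J x)) *\<^sub>R x"
    have "norm (J (T t y)) \<in> R"
      unfolding R_def using x False by (intro imageI) (simp add: y_def S_closed J_scaleR)
    then have "norm (J (T t y)) \<le> k"
      unfolding k_def using bdd by (rule cSup_upper)
    then show ?thesis
      using x t False by (simp add: y_def T_scaleR J_scaleR T_in_S field_simps)
  qed
  have "B * norm (J x0) < k * norm (J x0)"
    using le[OF x0(1)] x0(2) by simp
  then have Bk: "B \<le> k"
    using mult_right_mono[of k B "norm (J x0)"] by (cases "B \<le> k") auto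
  have "3/4 * k < Sup R"
    using Bk B by (simp add: k_def)
  moreover have "R \<noteq> {}"
    using S_closed(4) by (auto simp: R_def J_zero intro!: exI[of _ 0])
  ultimately obtain r where "r \<in> R" "3/4 * k < r"
    using less_cSup_iff[OF _ bdd] by blast
  then obtain v where v: "v \<in> S" "norm (J v) \<le> 1" "3/4 * k \<le> norm (J (T t v))"
    by (auto simp: R_def)
  show thesis
    by (rule that[OF Bk v le])
qed

text \<open>A gliding hump. If the operator norms \<open>k n\<close> of \<open>T (t n)\<close> grow like \<open>4 ^ n\<close> along times \<open>t n\<close> tending to \<open>0\<close>,
  one adds up near-maximizers scaled by \<open>(1/3) ^ n\<close>, choosing each sign so that \<open>T (t n)\<close> does not lose size. The
  later terms cannot undo this, and \<open>T (t n)\<close> applied to the limit is unbounded, against strong continuity at \<open>0\<close>.\<close>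
lemma locally_bounded:
  "\<exists>\<delta>>0. \<exists>B. \<forall>t\<in>{0..\<delta>}. \<forall>x\<in>S. norm (J (T t x)) \<le> B * norm (J x)"
proof (rule ccontr)
  assume neg: "\<not> ?thesis"
  define Q where "Q = (\<lambda>n t k v. 0 \<le> t \<and> t \<le> 1 / real (Suc n) \<and> 12 * 4 ^ n \<le> k \<and> v \<in> S \<and> norm (J v) \<le> 1 \<and>
      3/4 * k \<le> norm (J (T t v)) \<and> (\<forall>x\<in>S. norm (J (T t x)) \<le> k * norm (J x)))"
  have "\<exists>t k v. Q n t k v" for n
  proof -
    have "0 < 1 / real (Suc n)"
      by simp
    with neg have "\<not> (\<forall>t\<in>{0..1 / real (Suc n)}. \<forall>x\<in>S. norm (J (T t x)) \<le> 12 * 4 ^ n * norm (J x))"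
      by blast
    then obtain t x where "t \<in> {0..1 / real (Suc n)}" "x \<in> S" "\<not> norm (J (T t x)) \<le> 12 * 4 ^ n * norm (J x)"
      by blast
    then have tx: "0 \<le> t" "t \<le> 1 / real (Suc n)" "x \<in> S" "12 * 4 ^ n * norm (J x) < norm (J (T t x))"
      by simp_all
    obtain k v where "12 * 4 ^ n \<le> k" "v \<in> S" "norm (J v) \<le> 1" "3/4 * k \<le> norm (J (T t v))"
        "\<And>x. x \<in> S \<Longrightarrow> norm (J (T t x)) \<le> k * norm (J x)"
      using near_maximizer[OF tx(1,3,4)] by auto
    then show ?thesis
      using tx(1,2) unfolding Q_def by blast
  qed
  then obtain t k v where Q: "\<And>n. Q n (t n) (k n) (v n)"
    by metis
  have t: "\<And>n. 0 \<le> t n" "\<And>n. t n \<le> 1 / real (Suc n)"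
    and k: "\<And>n. 12 * 4 ^ n \<le> k n" and v: "\<And>n. v n \<in> S" "\<And>n. norm (J (v n)) \<le> 1"
    and max: "\<And>n. 3/4 * k n \<le> norm (J (T (t n) (v n)))"
    and op: "\<And>n x. x \<in> S \<Longrightarrow> norm (J (T (t n) x)) \<le> k n * norm (J x)"
    using Q unfolding Q_def by blast+
  define w where "w = (\<lambda>n. (1/3) ^ n *\<^sub>R v n)"
  have w: "w n \<in> S" "norm (J (w n)) \<le> (1/3) ^ n" for n
    using v(1)[of n] v(2)[of n] by (auto simp: w_def S_closed J_scaleR mult_left_le)
  have Tw: "(1/3) ^ n * (3/4 * k n) \<le> norm (J (T (t n) (w n)))" for n
    using max[of n] v(1)[of n] t(1)[of n] by (simp add: w_def T_scaleR J_scaleR T_in_S mult_left_mono del: times_divide_eq_left)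
  define y where "y = rec_nat 0 (\<lambda>n y. if norm (J (T (t n) (w n))) \<le> norm (J (T (t n) (y + w n))) then y + w n else y - w n)"
  have y0: "y 0 = 0" and ySuc: "y (Suc n) = (if norm (J (T (t n) (w n))) \<le> norm (J (T (t n) (y n + w n))) then y n + w n else y n - w n)" for n
    by (simp_all add: y_def)
  have yS: "y n \<in> S" for n
    by (induction n) (simp_all add: y0 ySuc S_closed w)
  have step: "norm (J (y (Suc n)) - J (y n)) \<le> (1/3) ^ n" for n
    using w[of n] yS[of n] by (simp add: ySuc J_add J_diff)
  \<comment> \<open>one of \<open>p + q\<close> and \<open>p - q\<close> is at least as long as \<open>q\<close>\<close>
  have big: "norm (J (T (t n) (w n))) \<le> norm (J (T (t n) (y (Suc n))))" for n
  proof (cases "norm (J (T (t n) (w n))) \<le> norm (J (T (t n) (y n + w n)))")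
    case False
    define p q where "p = J (T (t n) (y n))" and "q = J (T (t n) (w n))"
    have "norm (p + q) < norm q"
      using False t(1) yS w by (simp add: p_def q_def T_add J_add T_in_S)
    moreover have "norm (2 *\<^sub>R q) \<le> norm (p + q) + norm (p - q)"
      using norm_triangle_ineq4[of "p + q" "p - q"] by (simp add: scaleR_2)
    ultimately have "norm q \<le> norm (p - q)"
      by simp
    then show ?thesis
      using False t(1) yS w by (simp add: ySuc p_def q_def T_diff J_diff T_in_S)
  qed (simp add: ySuc)
  obtain z where z: "z \<in> S" "(\<lambda>n. J (y n)) \<longlonglongrightarrow> J z"
    using complete[of y, OF yS step] by blast
  have tail: "norm (J z - J (y n)) \<le> 2 * (1/3) ^ n" for n
  proof (rule tendsto_upperbound[where F = sequentially])
    show "(\<lambda>k. norm (J (y (n + k)) - J (y n))) \<longlonglongrightarrow> norm (J z - J (y n))"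
      using LIMSEQ_ignore_initial_segment[OF z(2), of n] by (intro tendsto_intros) (simp add: add.commute)
    show "\<forall>\<^sub>F k in sequentially. norm (J (y (n + k)) - J (y n)) \<le> 2 * (1/3) ^ n"
      using geometric_steps_norm_le[of "\<lambda>n. J (y n)" 1 n] step by simp
  qed simp
  have lower: "(4/3) ^ n \<le> norm (J (T (t n) z))" for n
  proof -
    have k0: "0 < k n"
      using k[of n] by (rule less_le_trans[rotated]) simp
    have "norm (J (T (t n) (y (Suc n)))) \<le> norm (J (T (t n) z)) + norm (J (T (t n) (z - y (Suc n))))"
      using t(1)[of n] z(1) yS[of "Suc n"] norm_triangle_ineq4[of "J (T (t n) z)" "J (T (t n) (z - y (Suc n)))"]
      by (simp add: T_diff J_diff T_in_S)
    also have "norm (J (T (t n) (z - y (Suc n)))) \<le> k n * norm (J (z - y (Suc n)))"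
      by (intro op S_closed z yS)
    also have "\<dots> \<le> k n * (2 * (1/3) ^ Suc n)"
      using k0 tail[of "Suc n"] z(1) yS[of "Suc n"] by (intro mult_left_mono) (simp_all add: J_diff)
    finally have "(1/3) ^ n * (3/4 * k n) \<le> norm (J (T (t n) z)) + k n * (2 * (1/3) ^ Suc n)"
      using Tw[of n] big[of n] by simp
    \<comment> \<open>the hump contributes \<open>3/4\<close>, the tail at most \<open>2/3\<close>; the gap \<open>1/12\<close> is the reason for the factor \<open>12\<close> in \<open>Q\<close>\<close>
    then have "3/4 * ((1/3) ^ n * k n) \<le> norm (J (T (t n) z)) + 2/3 * ((1/3) ^ n * k n)"
      by (simp add: mult_ac)
    then have "(1/3) ^ n * k n / 12 \<le> norm (J (T (t n) z))"
      by linarith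
    moreover have "(1/3) ^ n * (12 * 4 ^ n) \<le> (1/3) ^ n * k n"
      using k[of n] by (intro mult_left_mono) auto
    moreover have "(1/3) ^ n * (12 * 4 ^ n) = 12 * (4/3 :: real) ^ n"
      by (simp flip: power_mult_distrib)
    ultimately show ?thesis by linarith
  qed
  have "\<forall>\<^sub>F h in at_right 0. norm (J (T h z)) < norm (J z) + 1"
    using tendsto_norm[OF T_continuous_0[OF z(1)]] by (rule order_tendstoD) simp
  then obtain d where d: "0 < d" "\<And>h. 0 < h \<Longrightarrow> h < d \<Longrightarrow> norm (J (T h z)) < norm (J z) + 1"
    by (auto simp: eventually_at_right_field)
  have tb: "norm (J (T h z)) < norm (J z) + 1" if "0 \<le> h" "h < d" for h
    using d(2)[of h] that T_0[OF z(1)] by (cases "h = 0") auto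
  obtain n1 where n1: "norm (J z) + 1 < (4/3 :: real) ^ n1"
    using real_arch_pow[of "4/3" "norm (J z) + 1"] by auto
  obtain n2 where n2: "1 / real (Suc n2) < d"
    using nat_approx_posE[OF d(1)] by blast
  define n where "n = max n1 n2"
  have "1 / real (Suc n) \<le> 1 / real (Suc n2)"
    by (intro divide_left_mono) (auto simp: n_def)
  then have "t n < d"
    using t(2)[of n] n2 by simp
  moreover have "(4/3 :: real) ^ n1 \<le> (4/3) ^ n"
    by (intro power_increasing) (auto simp: n_def)
  ultimately show False
    using tb[OF t(1)[of n]] lower[of n] n1 by linarith
qed

end

context dissipative_semigroup
begin

lemma orbit_right_continuous:
  assumes x: "x \<in> S" and t: "0 \<le> t"
  shows "((\<lambda>s. J (T s x)) \<longlongrightarrow> J (T t x)) (at_right t)"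
proof -
  have "((\<lambda>h. J (T h (T t x))) \<longlongrightarrow> J (T t x)) (at_right 0)"
    by (rule T_continuous_0[OF T_in_S[OF t x]])
  then have "((\<lambda>h. J (T (h + t) x)) \<longlongrightarrow> J (T t x)) (at_right 0)"
  proof (rule Lim_transform_eventually)
    show "\<forall>\<^sub>F h in at_right 0. J (T h (T t x)) = J (T (h + t) x)"
      using eventually_at_right_less[of 0] by eventually_elim (simp add: T_plus t x)
  qed
  then show ?thesis
    by (simp only: filterlim_at_right_to_0[of _ _ t])
qed

text \<open>Just before \<open>t\<close> the orbit is reached from a fixed earlier time by an operator \<open>T r\<close> with small \<open>r\<close>, and such
  operators are uniformly bounded.\<close>
lemma orbit_left_continuous:
  assumes x: "x \<in> S" and t: "0 < t"
  shows "((\<lambda>s. J (T s x)) \<longlongrightarrow> J (T t x)) (at_left t)"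
proof -
  obtain \<delta> B where \<delta>: "0 < \<delta>" and B: "\<And>r x. 0 \<le> r \<Longrightarrow> r \<le> \<delta> \<Longrightarrow> x \<in> S \<Longrightarrow> norm (J (T r x)) \<le> B * norm (J x)"
  proof -
    obtain \<delta> B where "0 < \<delta>" "\<forall>r\<in>{0..\<delta>}. \<forall>x\<in>S. norm (J (T r x)) \<le> B * norm (J x)"
      using locally_bounded by blast
    then show thesis
      by (intro that[of \<delta> B]) simp_all
  qed
  define e where "e = min \<delta> t"
  have e: "0 < e" "e \<le> \<delta>" "e \<le> t"
    using \<delta> t by (auto simp: e_def)
  obtain B' where B': "0 \<le> B'" "\<And>x. x \<in> S \<Longrightarrow> norm (J (T (t - e) x)) \<le> B' * norm (J x)"
    using T_bounded[of "t - e"] e by auto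
  have bound: "norm (J (T s x) - J (T t x)) \<le> \<bar>B\<bar> * (B' * norm (J (T (t - s) x) - J x))"
    if s: "t - e < s" "s < t" for s
  proof -
    define y where "y = T (t - s) x - x"
    have yS: "y \<in> S"
      unfolding y_def using s x by (intro S_closed T_in_S) auto
    have "T t x = T s (T (t - s) x)"
      using T_plus[of s "t - s" x] s e x by simp
    then have "J (T t x) - J (T s x) = J (T s y)"
      using s e x by (simp add: y_def T_diff J_diff T_in_S)
    also have "T s y = T (s - (t - e)) (T (t - e) y)"
      using T_plus[of "s - (t - e)" "t - e" y] s e yS by simp
    finally have "norm (J (T s x) - J (T t x)) = norm (J (T (s - (t - e)) (T (t - e) y)))"
      by (metis norm_minus_commute)
    also have "\<dots> \<le> B * norm (J (T (t - e) y))"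
      using s e yS by (intro B T_in_S) auto
    also have "\<dots> \<le> \<bar>B\<bar> * norm (J (T (t - e) y))"
      by (intro mult_right_mono) auto
    also have "\<dots> \<le> \<bar>B\<bar> * (B' * norm (J y))"
      by (intro mult_left_mono B' yS) auto
    also have "J y = J (T (t - s) x) - J x"
      using s x by (simp add: y_def J_diff T_in_S)
    finally show ?thesis .
  qed
  have "((\<lambda>s. J (T s x) - J (T t x)) \<longlongrightarrow> 0) (at_left t)"
  proof (rule Lim_null_comparison)
    have "\<forall>\<^sub>F s in at_left t. s \<in> {t - e<..<t}"
      using e by (intro eventually_at_left_real) simp
    then show "\<forall>\<^sub>F s in at_left t. norm (J (T s x) - J (T t x)) \<le> \<bar>B\<bar> * (B' * norm (J (T (t - s) x) - J x))"
      by eventually_elim (use bound in simp)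
    have "filterlim (\<lambda>s. t - s) (at_right 0) (at_left t)"
      unfolding filterlim_at
    proof
      show "\<forall>\<^sub>F s in at_left t. t - s \<in> {0<..} \<and> t - s \<noteq> 0"
        using eventually_at_left_real[OF t] by eventually_elim simp
      have "((\<lambda>s. t - s) \<longlongrightarrow> t - t) (at_left t)"
        by (intro tendsto_diff tendsto_const tendsto_ident_at)
      then show "((\<lambda>s. t - s) \<longlongrightarrow> 0) (at_left t)" by simp
    qed
    from filterlim_compose[OF T_continuous_0[OF x] this]
    have "((\<lambda>s. J (T (t - s) x)) \<longlongrightarrow> J x) (at_left t)" .
    then have "((\<lambda>s. \<bar>B\<bar> * (B' * norm (J (T (t - s) x) - J x))) \<longlongrightarrow> \<bar>B\<bar> * (B' * norm (J x - J x))) (at_left t)"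
      by (intro tendsto_mult tendsto_const tendsto_norm tendsto_diff)
    then show "((\<lambda>s. \<bar>B\<bar> * (B' * norm (J (T (t - s) x) - J x))) \<longlongrightarrow> 0) (at_left t)"
      by simp
  qed
  then show ?thesis
    by (rule LIM_zero_cancel)
qed

lemma orbit_continuous_on:
  assumes x: "x \<in> S"
  shows "continuous_on {0..} (\<lambda>t. J (T t x))"
  unfolding continuous_on_def
proof
  fix t :: real assume "t \<in> {0..}"
  then consider "t = 0" | "0 < t" by force
  then show "((\<lambda>s. J (T s x)) \<longlongrightarrow> J (T t x)) (at t within {0..})"
  proof cases
    case 1
    then show ?thesis
      using orbit_right_continuous[OF x, of 0] by (simp add: at_within_Ici_at_right)
  next
    case 2
    then have "((\<lambda>s. J (T s x)) \<longlongrightarrow> J (T t x)) (at t)"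
      using orbit_left_continuous[OF x] orbit_right_continuous[OF x] by (intro filterlim_split_at) auto
    then show ?thesis
      by (rule tendsto_within_subset) simp
  qed
qed

lemma right_derivative_bilinear:
  assumes b: "bounded_bilinear b" and x: "x \<in> D" and t: "0 \<le> t"
  shows "((\<lambda>h. (b (J (T (t + h) x)) (J (T (t + h) x)) - b (J (T t x)) (J (T t x))) /\<^sub>R h)
    \<longlongrightarrow> b (J (A (T t x))) (J (T t x)) + b (J (T t x)) (J (A (T t x)))) (at_right 0)"
proof -
  interpret b: bounded_bilinear b by fact
  define u where "u = (\<lambda>s. J (T s x))"
  define d where "d = (\<lambda>h. J (diffquot h (T t x)))"
  note xS = D_subset[OF x]
  have d: "(d \<longlongrightarrow> J (A (T t x))) (at_right 0)"
    unfolding d_def by (intro diffquot_tendsto T_in_D x t)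
  have u: "((\<lambda>h. u (t + h)) \<longlongrightarrow> u t) (at_right 0)"
    using orbit_right_continuous[OF xS t] unfolding u_def filterlim_at_right_to_0[of _ _ t]
    by (simp add: add.commute)
  have "((\<lambda>h. b (d h) (u (t + h)) + b (u t) (d h)) \<longlongrightarrow> b (J (A (T t x))) (u t) + b (u t) (J (A (T t x)))) (at_right 0)"
    by (intro tendsto_add b.tendsto d u tendsto_const)
  then have "((\<lambda>h. (b (u (t + h)) (u (t + h)) - b (u t) (u t)) /\<^sub>R h)
      \<longlongrightarrow> b (J (A (T t x))) (u t) + b (u t) (J (A (T t x)))) (at_right 0)"
  proof (rule Lim_transform_eventually)
    show "\<forall>\<^sub>F h in at_right 0. b (d h) (u (t + h)) + b (u t) (d h) = (b (u (t + h)) (u (t + h)) - b (u t) (u t)) /\<^sub>R h"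
      using eventually_at_right_less[of 0]
    proof eventually_elim
      case (elim h)
      have "d h = (1 / h) *\<^sub>R (u (t + h) - u t)"
        using J_diffquot[of h "T t x"] T_in_S[OF t xS] elim T_plus[of h t x] t xS
        by (simp add: d_def u_def add.commute)
      then show ?case
        by (simp add: b.scaleR_left b.scaleR_right b.diff_left b.diff_right inverse_eq_divide flip: scaleR_add_right)
    qed
  qed
  then show ?thesis
    by (simp only: u_def)
qed

lemma contraction:
  assumes x: "x \<in> D" and st: "0 \<le> s" "s \<le> t"
  shows "norm (J (T t x)) \<le> norm (J (T s x))"
proof -
  define f where "f = (\<lambda>t. inner (J (T t x)) (J (T t x)))"
  have "f t \<le> f s"
  proof (rule nonincreasing_if_right_derivative_nonpos[OF st(2), of f])
    show "continuous_on {s..t} f"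
      unfolding f_def using st
      by (intro continuous_on_inner continuous_on_subset[OF orbit_continuous_on[OF D_subset[OF x]]]) auto
    fix r assume r: "s \<le> r" "r < t"
    then have r0: "0 \<le> r" using st by simp
    have "((\<lambda>h. (f (r + h) - f r) / h) \<longlongrightarrow> inner (J (A (T r x))) (J (T r x)) + inner (J (T r x)) (J (A (T r x)))) (at_right 0)"
      using right_derivative_bilinear[OF bounded_bilinear_inner x r0] by (simp add: f_def divide_inverse mult.commute)
    moreover have "inner (J (A (T r x))) (J (T r x)) + inner (J (T r x)) (J (A (T r x))) \<le> 0"
      using dissipative[OF T_in_D(1)[OF x r0]] by (simp add: inner_commute)
    ultimately show "\<exists>d\<le>0. ((\<lambda>h. (f (r + h) - f r) / h) \<longlongrightarrow> d) (at_right 0)"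
      by blast
  qed
  then show ?thesis
    by (simp add: f_def norm_le)
qed

text \<open>The velocity of an orbit need not lie in \<open>D\<close>, so this is the limit of the contraction property for
  difference quotients.\<close>
lemma contraction_derivative:
  assumes x: "x \<in> D" and t: "0 \<le> t"
  shows "norm (J (A (T t x))) \<le> norm (J (A x))"
proof (rule tendsto_le)
  show "((\<lambda>k. norm (J (diffquot k (T t x)))) \<longlongrightarrow> norm (J (A (T t x)))) (at_right 0)"
    by (intro tendsto_norm diffquot_tendsto T_in_D x t)
  show "((\<lambda>k. norm (J (diffquot k x))) \<longlongrightarrow> norm (J (A x))) (at_right 0)"
    by (intro tendsto_norm diffquot_tendsto x)
  show "\<forall>\<^sub>F k in at_right 0. norm (J (diffquot k (T t x))) \<le> norm (J (diffquot k x))"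
    using eventually_at_right_less[of 0]
  proof eventually_elim
    case (elim k)
    then have "diffquot k x \<in> D"
      using x by (intro diffquot_in_D) auto
    then show ?case
      using contraction[of "diffquot k x" 0 t] T_diffquot[of t k x] t elim D_subset x
      by (simp add: T_0)
  qed
qed simp

text \<open>The differentiated orbit is approximated by difference quotients uniformly in time. This follows from
  the contraction property of differences of two difference quotients, letting the second step size tend to \<open>0\<close>.\<close>
lemma diffquot_derivative_close:
  assumes x: "x \<in> D" and t: "0 \<le> t" and h: "0 \<le> h"
  shows "norm (J (diffquot h (T t x)) - J (A (T t x))) \<le> norm (J (diffquot h x) - J (A x))"
proof (rule tendsto_le)
  show "((\<lambda>k. norm (J (diffquot h (T t x)) - J (diffquot k (T t x)))) \<longlongrightarrow> norm (J (diffquot h (T t x)) - J (A (T t x)))) (at_right 0)"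
    by (intro tendsto_norm tendsto_diff tendsto_const diffquot_tendsto T_in_D x t)
  show "((\<lambda>k. norm (J (diffquot h x) - J (diffquot k x))) \<longlongrightarrow> norm (J (diffquot h x) - J (A x))) (at_right 0)"
    by (intro tendsto_norm tendsto_diff tendsto_const diffquot_tendsto x)
  show "\<forall>\<^sub>F k in at_right 0. norm (J (diffquot h (T t x)) - J (diffquot k (T t x))) \<le> norm (J (diffquot h x) - J (diffquot k x))"
    using eventually_at_right_less[of 0]
  proof eventually_elim
    case (elim k)
    then have k: "0 \<le> k" by simp
    note xS = D_subset[OF x]
    define y where "y = diffquot h x - diffquot k x"
    have dS: "diffquot h x \<in> S" "diffquot k x \<in> S"
      using xS h k by (auto intro: diffquot_in_S)
    have yD: "y \<in> D"
      using D_scaleR_diff[OF diffquot_in_D[OF x h] diffquot_in_D[OF x k], of 1] by (simp add: y_def)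
    have "J (T t y) = J (T t (diffquot h x)) - J (T t (diffquot k x))"
      using dS t by (simp add: y_def T_diff J_diff T_in_S)
    then have "J (T t y) = J (diffquot h (T t x)) - J (diffquot k (T t x))"
      using T_diffquot[OF t h xS] T_diffquot[OF t k xS] by simp
    moreover have "J (T 0 y) = J (diffquot h x) - J (diffquot k x)"
      using dS by (simp add: T_0 D_subset[OF yD]) (simp add: y_def J_diff)
    ultimately show ?case
      using contraction[OF yD order_refl t] by simp
  qed
qed simp

text \<open>The dissipation of an orbit controls \<open>q\<close> on it; that of its difference quotient \<open>v\<close>, with weight \<open>C / 2\<close>,
  controls \<open>q\<close> on the velocity up to an error that vanishes with the step size. So the functional
  \<open>F\<close> of the proof has right derivative at most \<open>\<kappa> h - (norm u)\<^sup>2\<close>, and \<open>norm u\<close> does not increase.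
  Integrating up to time \<open>t\<close> and letting \<open>h\<close> tend to \<open>0\<close> bounds \<open>t * (norm (u t))\<^sup>2\<close>.\<close>
theorem inverse_sqrt_decay:
  fixes b :: "'b \<Rightarrow> 'b \<Rightarrow> real" and q :: "'b \<Rightarrow> real"
  assumes q: "bounded_linear q" and b: "bounded_bilinear b" and C: "0 \<le> C"
    and obs: "\<And>x. x \<in> D \<Longrightarrow> (q (J x))\<^sup>2 \<le> - inner (J (A x)) (J x)"
    and lyap: "\<And>x. x \<in> D \<Longrightarrow> b (J (A x)) (J x) + b (J x) (J (A x)) + (norm (J x))\<^sup>2
        \<le> C * (- inner (J (A x)) (J x) + (q (J (A x)))\<^sup>2)"
  shows "\<exists>c>0. \<forall>t>0. \<forall>x\<in>D. N (T t x) \<le> c / sqrt t * (N x + N (A x))"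
proof -
  interpret q: bounded_linear q by fact
  interpret b: bounded_bilinear b by fact
  obtain Q where Q: "0 \<le> Q" "\<And>p. \<bar>q p\<bar> \<le> norm p * Q"
    using q.nonneg_bounded by auto
  obtain B where B: "0 \<le> B" "\<And>p r. \<bar>b p r\<bar> \<le> norm p * norm r * B"
    using b.nonneg_bounded by auto
  define M where "M = 2 * B + C / 2"
  have decay: "t * (norm (J (T t x)))\<^sup>2 \<le> M * (norm (J x) + norm (J (A x)))\<^sup>2" if t: "0 < t" and x: "x \<in> D" for t x
  proof -
    note xS = D_subset[OF x]
    define u where "u = (\<lambda>s. J (T s x))"
    define w where "w = (\<lambda>s. J (A (T s x)))"
    define \<epsilon> where "\<epsilon> = (\<lambda>h. norm (J (diffquot h x) - J (A x)))"
    define \<kappa> where "\<kappa> = (\<lambda>h. C * (Q * \<epsilon> h * (Q * (2 * norm (J (A x)) + \<epsilon> h))))"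
    define R where "R = (\<lambda>h. (2 * B + C / 2) * (norm (J x))\<^sup>2 + C / 2 * (norm (J (diffquot h x)))\<^sup>2)"
    have main: "t * ((norm (u t))\<^sup>2 - \<kappa> h) \<le> R h" if h: "0 < h" for h
    proof -
      define y where "y = diffquot h x"
      have yD: "y \<in> D"
        unfolding y_def using x h by (intro diffquot_in_D) auto
      note yS = D_subset[OF yD]
      define v where "v = (\<lambda>s. J (T s y))"
      \<comment> \<open>the share \<open>B\<close> makes \<open>F\<close> nonnegative; the shares \<open>C / 2\<close> absorb the two terms on the right of the hypothesis \<open>lyap\<close>\<close>
      define F where "F = (\<lambda>s. b (u s) (u s) + (B + C / 2) * inner (u s) (u s) + C / 2 * inner (v s) (v s))"
      define f where "f = (\<lambda>s. F s + ((norm (u t))\<^sup>2 - \<kappa> h) * s)"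
      have "f t \<le> f 0"
      proof (rule nonincreasing_if_right_derivative_nonpos[of 0 t f])
        have cu: "continuous_on {0..t} u"
          unfolding u_def by (rule continuous_on_subset[OF orbit_continuous_on[OF xS]]) simp
        have cv: "continuous_on {0..t} v"
          unfolding v_def by (rule continuous_on_subset[OF orbit_continuous_on[OF yS]]) simp
        show "continuous_on {0..t} f"
          unfolding f_def F_def
          by (intro continuous_on_add continuous_on_mult continuous_on_inner continuous_on_const continuous_on_id
              b.continuous_on cu cv)
        fix s assume s: "0 \<le> s" "s < t"
        define db where "db = b (w s) (u s) + b (u s) (w s)"
        define du where "du = inner (w s) (u s)"
        define dv where "dv = inner (J (A (T s y))) (v s)"
        have lim: "((\<lambda>h. (f (s + h) - f s) / h) \<longlongrightarrow> db + (B + C / 2) * (2 * du) + C / 2 * (2 * dv) + ((norm (u t))\<^sup>2 - \<kappa> h)) (at_right 0)"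
        proof (rule Lim_transform_eventually)
          have "((\<lambda>h. (b (u (s + h)) (u (s + h)) - b (u s) (u s)) / h) \<longlongrightarrow> db) (at_right 0)"
            using right_derivative_bilinear[OF b x s(1)] by (simp add: u_def w_def db_def divide_inverse mult.commute)
          moreover have "((\<lambda>h. (inner (u (s + h)) (u (s + h)) - inner (u s) (u s)) / h) \<longlongrightarrow> 2 * du) (at_right 0)"
            using right_derivative_bilinear[OF bounded_bilinear_inner x s(1)]
            by (simp add: u_def w_def du_def divide_inverse mult.commute inner_commute)
          moreover have "((\<lambda>h. (inner (v (s + h)) (v (s + h)) - inner (v s) (v s)) / h) \<longlongrightarrow> 2 * dv) (at_right 0)"
            using right_derivative_bilinear[OF bounded_bilinear_inner yD s(1)]
            by (simp add: v_def dv_def divide_inverse mult.commute inner_commute)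
          ultimately show "((\<lambda>r. (b (u (s + r)) (u (s + r)) - b (u s) (u s)) / r
               + (B + C / 2) * ((inner (u (s + r)) (u (s + r)) - inner (u s) (u s)) / r)
               + C / 2 * ((inner (v (s + r)) (v (s + r)) - inner (v s) (v s)) / r) + ((norm (u t))\<^sup>2 - \<kappa> h))
            \<longlongrightarrow> db + (B + C / 2) * (2 * du) + C / 2 * (2 * dv) + ((norm (u t))\<^sup>2 - \<kappa> h)) (at_right 0)"
            by (intro tendsto_add tendsto_mult tendsto_const)
          show "\<forall>\<^sub>F r in at_right 0. (b (u (s + r)) (u (s + r)) - b (u s) (u s)) / r
               + (B + C / 2) * ((inner (u (s + r)) (u (s + r)) - inner (u s) (u s)) / r)
               + C / 2 * ((inner (v (s + r)) (v (s + r)) - inner (v s) (v s)) / r) + ((norm (u t))\<^sup>2 - \<kappa> h)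
              = (f (s + r) - f s) / r"
            using eventually_at_right_less[of 0]
          proof eventually_elim
            case (elim r)
            have eq: "a1 / r + c1 * (a2 / r) + c2 * (a3 / r) + c3 = (a1 + c1 * a2 + c2 * a3 + c3 * r) / r" for a1 a2 a3 c1 c2 c3
              using elim by (simp add: field_simps)
            show ?case
              unfolding eq by (simp add: f_def F_def algebra_simps)
          qed
        qed
        have xs: "T s x \<in> D" "T s y \<in> D"
          using x yD s by (auto intro: T_in_D)
        have 1: "db + (norm (u s))\<^sup>2 \<le> C * (- du + (q (w s))\<^sup>2)"
          using lyap[OF xs(1)] by (simp add: db_def du_def u_def w_def)
        have 2: "du \<le> 0"
          using dissipative[OF xs(1)] by (simp add: du_def u_def w_def)
        have 3: "dv \<le> - (q (v s))\<^sup>2"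
          using obs[OF xs(2)] by (simp add: dv_def v_def)
        have 4: "(norm (u t))\<^sup>2 \<le> (norm (u s))\<^sup>2"
          using contraction[OF x s(1), of t] s by (intro power_mono) (auto simp: u_def)
        have vw: "norm (v s - w s) \<le> \<epsilon> h"
          using diffquot_derivative_close[OF x s(1), of h] T_diffquot[OF s(1) _ xS, of h] h
          by (simp add: v_def w_def \<epsilon>_def y_def)
        have w: "norm (w s) \<le> norm (J (A x))"
          using contraction_derivative[OF x s(1)] by (simp add: w_def)
        have v: "norm (v s) \<le> norm (J (A x)) + \<epsilon> h"
          using vw w norm_triangle_sub[of "v s" "w s"] by simp
        have 5: "(q (w s))\<^sup>2 - (q (v s))\<^sup>2 \<le> Q * \<epsilon> h * (Q * (2 * norm (J (A x)) + \<epsilon> h))"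
        proof -
          have "(q (w s))\<^sup>2 - (q (v s))\<^sup>2 = q (w s - v s) * q (w s + v s)"
            by (simp add: q.diff q.add power2_eq_square algebra_simps)
          also have "\<dots> \<le> \<bar>q (w s - v s)\<bar> * \<bar>q (w s + v s)\<bar>"
            by (simp flip: abs_mult)
          also have "\<dots> \<le> (norm (w s - v s) * Q) * (norm (w s + v s) * Q)"
            by (intro mult_mono Q) (auto simp: Q)
          also have "\<dots> \<le> (\<epsilon> h * Q) * ((2 * norm (J (A x)) + \<epsilon> h) * Q)"
          proof (intro mult_mono)
            show "norm (w s - v s) \<le> \<epsilon> h"
              using vw by (simp add: norm_minus_commute)
            show "norm (w s + v s) \<le> 2 * norm (J (A x)) + \<epsilon> h"
              using v w norm_triangle_ineq[of "w s" "v s"] by simp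
          qed (use Q in \<open>auto simp: \<epsilon>_def\<close>)
          finally show ?thesis by (simp add: mult_ac)
        qed
        have 6: "B * (2 * du) \<le> 0"
          using B 2 by (simp add: mult_nonneg_nonpos)
        have 7: "C * dv \<le> C * (- (q (v s))\<^sup>2)"
          using C 3 by (intro mult_left_mono) auto
        have 8: "C * ((q (w s))\<^sup>2 - (q (v s))\<^sup>2) \<le> \<kappa> h"
          unfolding \<kappa>_def using C 5 by (intro mult_left_mono) auto
        have "db + (B + C / 2) * (2 * du) + C / 2 * (2 * dv) + ((norm (u t))\<^sup>2 - \<kappa> h) \<le> 0"
          using 1 4 6 7 8 unfolding ring_distribs by linarith
        with lim show "\<exists>d\<le>0. ((\<lambda>h. (f (s + h) - f s) / h) \<longlongrightarrow> d) (at_right 0)"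
          by blast
      qed (use t in simp)
      moreover have "0 \<le> F t"
      proof -
        have "- b (u t) (u t) \<le> B * inner (u t) (u t)"
          using B(2)[of "u t" "u t"] by (simp add: abs_le_iff mult_ac power2_eq_square[symmetric] power2_norm_eq_inner)
        moreover have "0 \<le> C / 2 * inner (u t) (u t)" "0 \<le> C / 2 * inner (v t) (v t)"
          using C by auto
        ultimately show ?thesis
          by (simp add: F_def distrib_right)
      qed
      moreover have "F 0 \<le> R h"
      proof -
        have "b (u 0) (u 0) \<le> B * (norm (u 0))\<^sup>2"
          using B(2)[of "u 0" "u 0"] by (simp add: abs_le_iff mult_ac power2_eq_square)
        moreover have "u 0 = J x" "v 0 = J y"
          using xS yS by (simp_all add: u_def v_def T_0)
        ultimately show ?thesis
          by (simp add: F_def R_def y_def power2_norm_eq_inner algebra_simps)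
      qed
      ultimately show ?thesis
        by (simp add: f_def mult.commute)
    qed
    have "t * ((norm (u t))\<^sup>2 - C * (Q * 0 * (Q * (2 * norm (J (A x)) + 0))))
        \<le> (2 * B + C / 2) * (norm (J x))\<^sup>2 + C / 2 * (norm (J (A x)))\<^sup>2"
    proof (rule tendsto_le)
      have "(\<epsilon> \<longlongrightarrow> norm (J (A x) - J (A x))) (at_right 0)"
        unfolding \<epsilon>_def by (intro tendsto_norm tendsto_diff tendsto_const diffquot_tendsto x)
      then have "(\<epsilon> \<longlongrightarrow> 0) (at_right 0)" by simp
      then show "((\<lambda>h. t * ((norm (u t))\<^sup>2 - \<kappa> h)) \<longlongrightarrow>
          t * ((norm (u t))\<^sup>2 - C * (Q * 0 * (Q * (2 * norm (J (A x)) + 0))))) (at_right 0)"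
        unfolding \<kappa>_def by (intro tendsto_mult tendsto_diff tendsto_add tendsto_const)
      show "(R \<longlongrightarrow> (2 * B + C / 2) * (norm (J x))\<^sup>2 + C / 2 * (norm (J (A x)))\<^sup>2) (at_right 0)"
        unfolding R_def
        by (intro tendsto_mult tendsto_add tendsto_const tendsto_power tendsto_norm diffquot_tendsto x)
      show "\<forall>\<^sub>F h in at_right 0. t * ((norm (u t))\<^sup>2 - \<kappa> h) \<le> R h"
        using eventually_at_right_less[of 0] by eventually_elim (rule main)
    qed simp
    then have "t * (norm (u t))\<^sup>2 \<le> (2 * B + C / 2) * (norm (J x))\<^sup>2 + C / 2 * (norm (J (A x)))\<^sup>2"
      by simp
    also have "\<dots> \<le> M * (norm (J x))\<^sup>2 + M * (norm (J (A x)))\<^sup>2"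
      using B C by (intro add_mono mult_right_mono) (auto simp: M_def)
    also have "\<dots> = M * ((norm (J x))\<^sup>2 + (norm (J (A x)))\<^sup>2)"
      by (simp add: distrib_left)
    also have "\<dots> \<le> M * (norm (J x) + norm (J (A x)))\<^sup>2"
      using B C by (intro mult_left_mono) (auto simp: M_def power2_sum)
    finally show ?thesis
      by (simp add: u_def)
  qed
  have M: "0 \<le> M"
    using B C by (simp add: M_def)
  show ?thesis
  proof (intro exI[of _ "sqrt M + 1"] conjI allI impI ballI)
    fix t :: real and x assume t: "0 < t" and x: "x \<in> D"
    define n where "n = norm (J x) + norm (J (A x))"
    have "(sqrt t * norm (J (T t x)))\<^sup>2 \<le> (sqrt M * n)\<^sup>2"
    proof -
      have "(sqrt t * norm (J (T t x)))\<^sup>2 = t * (norm (J (T t x)))\<^sup>2" "(sqrt M * n)\<^sup>2 = M * n\<^sup>2"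
        using t M by (simp_all add: power_mult_distrib)
      then show ?thesis
        using decay[OF t x] by (simp only: n_def)
    qed
    then have "sqrt t * norm (J (T t x)) \<le> sqrt M * n"
      by (rule power2_le_imp_le) (simp add: n_def M)
    also have "\<dots> \<le> (sqrt M + 1) * n"
      by (rule mult_right_mono) (simp_all add: n_def)
    finally have "norm (J (T t x)) \<le> (sqrt M + 1) / sqrt t * n"
      using t by (simp add: field_simps)
    then show "N (T t x) \<le> (sqrt M + 1) / sqrt t * (N x + N (A x))"
      using x t T_in_S[of t x] by (simp add: n_def N_eq D_subset A_in_S)
  qed (use M in \<open>simp add: add_nonneg_pos\<close>)
qed

end

section \<open>The wave equation with delayed boundary feedback\<close>

lemma real_convergent_if_geometric_steps:
  fixes X :: "nat \<Rightarrow> real"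
  assumes "\<And>n. \<bar>X (Suc n) - X n\<bar> \<le> C * (1/3) ^ n"
  shows "convergent X"
proof -
  have "summable (\<lambda>n. C * (1/3) ^ n)"
    by (intro summable_mult summable_geometric) simp
  then have "summable (\<lambda>n. X (Suc n) - X n)"
    by (rule summable_comparison_test'[where N = 0]) (use assms in simp)
  then have "convergent (\<lambda>n. \<Sum>i<n. X (Suc i) - X i)"
    by (simp add: summable_iff_convergent)
  then obtain L where "(\<lambda>n. \<Sum>i<n. X (Suc i) - X i) \<longlonglongrightarrow> L"
    by (auto simp: convergent_def)
  then have "(\<lambda>n. X n - X 0) \<longlonglongrightarrow> L"
    by (simp only: sum_lessThan_telescope)
  then have "(\<lambda>n. (X n - X 0) + X 0) \<longlonglongrightarrow> L + X 0"
    by (intro tendsto_add tendsto_const)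
  then show ?thesis
    by (auto simp: convergent_def)
qed

lemma l2_integral_add: "l2_integral (u + v) = l2_integral u + l2_integral v"
  by (simp add: l2_integral_eq_inner inner_add_left)

lemma l2_integral_scaleR: "l2_integral (c *\<^sub>R u) = c * l2_integral u"
  by (simp add: l2_integral_eq_inner)

lemma X_product_norm_ge:
  "norm y \<le> X_product_norm (y, z, u, \<xi>, \<eta>)"
  "norm (weak_deriv y) \<le> X_product_norm (y, z, u, \<xi>, \<eta>)"
  "norm z \<le> X_product_norm (y, z, u, \<xi>, \<eta>)"
  "norm u \<le> X_product_norm (y, z, u, \<xi>, \<eta>)"
  "\<bar>\<xi>\<bar> \<le> X_product_norm (y, z, u, \<xi>, \<eta>)"
  "\<bar>\<eta>\<bar> \<le> X_product_norm (y, z, u, \<xi>, \<eta>)"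
  by (auto simp: X_product_norm_def intro!: real_le_rsqrt)

lemma bounded_bilinear_plus:
  assumes "bounded_bilinear f" "bounded_bilinear g"
  shows "bounded_bilinear (\<lambda>x y. f x y + g x y)"
proof -
  interpret f: bounded_bilinear f by fact
  interpret g: bounded_bilinear g by fact
  obtain F where F: "\<And>x y. norm (f x y) \<le> norm x * norm y * F"
    using f.bounded by blast
  obtain G where G: "\<And>x y. norm (g x y) \<le> norm x * norm y * G"
    using g.bounded by blast
  show ?thesis
  proof
    show "\<exists>K. \<forall>x y. norm (f x y + g x y) \<le> norm x * norm y * K"
    proof (intro exI allI)
      show "norm (f x y + g x y) \<le> norm x * norm y * (F + G)" for x y
        using norm_triangle_ineq[of "f x y" "g x y"] F[of x y] G[of x y] by (simp add: distrib_left)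
    qed
  qed (simp_all add: f.add_left f.add_right f.scaleR_left f.scaleR_right
      g.add_left g.add_right g.scaleR_left g.scaleR_right scaleR_add_right ac_simps)
qed

text \<open>On \<open>X_dot\<close> this is an isometry onto its image in the product of the standard inner product spaces. It
  forgets \<open>y\<close> apart from its derivative, but on \<open>X_dot\<close> the vanishing of \<open>ell\<close> and the equivalence of norms still
  make it injective.\<close>
definition energy_map :: "(real \<Rightarrow> real) \<Rightarrow> real \<Rightarrow> real \<Rightarrow> real \<Rightarrow> real \<Rightarrow> state \<Rightarrow> state" where
  "energy_map a m M \<tau> K = (\<lambda>(y, z, u, \<xi>, \<eta>).
     (l2_mult (\<lambda>x. sqrt (a x)) (weak_deriv y), z, sqrt (K * \<tau>) *\<^sub>R u, sqrt m * \<xi>, sqrt M * \<eta>))"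

locale delayed_wave =
  fixes a a' :: "real \<Rightarrow> real" and a0 m M \<tau> \<alpha> \<beta> K \<omega> :: real
  assumes pos: "m > 0" "M > 0" "\<tau> > 0" "K > 0"
    and a: "C1_unit a a'" and a0: "a0 > 0" "\<And>x. 0 \<le> x \<Longrightarrow> x \<le> 1 \<Longrightarrow> a0 \<le> a x"
    and a'_nonneg: "\<And>x. 0 \<le> x \<Longrightarrow> x \<le> 1 \<Longrightarrow> 0 \<le> a' x"
    and delay: "\<bar>\<alpha>\<bar> < K" "K < 2 * \<beta> - \<bar>\<alpha>\<bar>"
    and weight: "admissible_weight a m M \<tau> \<alpha> \<beta> K \<omega>"
begin

abbreviation "S \<equiv> X_dot m M \<tau> \<alpha> \<beta>"
abbreviation "D \<equiv> A_dot_dom m M \<tau> \<alpha> \<beta>"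
abbreviation "N \<equiv> X_norm a m M \<tau> \<alpha> \<beta> K \<omega>"
abbreviation "A \<equiv> A_op a m M \<tau> \<alpha> \<beta>"
abbreviation "J \<equiv> energy_map a m M \<tau> K"
abbreviation "L \<equiv> ell m M \<tau> \<alpha> \<beta>"

lemma a_continuous: "continuous_on {0..1} a" "continuous_on {0..1} (\<lambda>x. sqrt (a x))" "continuous_on {0..1} (\<lambda>x. 1 / a x)"
proof -
  show "continuous_on {0..1} a"
    by (rule C1_unit_continuous(1)[OF a])
  then show "continuous_on {0..1} (\<lambda>x. sqrt (a x))"
    by (rule continuous_on_real_sqrt)
  show "continuous_on {0..1} (\<lambda>x. 1 / a x)"
    using \<open>continuous_on {0..1} a\<close>
    by (rule continuous_on_divide[OF continuous_on_const]) (use a0 in force)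
qed

lemma a_pos: "0 \<le> x \<Longrightarrow> x \<le> 1 \<Longrightarrow> 0 < a x"
  using a0 less_le_trans by blast

lemma mem_S_iff: "(y, z, u, \<xi>, \<eta>) \<in> S \<longleftrightarrow> y \<in> H1 \<and> L (y, z, u, \<xi>, \<eta>) = 0"
  by (auto simp: X_dot_def X_space_def ell_def algebra_simps)

lemma S_cases:
  assumes "v \<in> S"
  obtains y z u \<xi> \<eta> where "v = (y, z, u, \<xi>, \<eta>)" "y \<in> H1" "L (y, z, u, \<xi>, \<eta>) = 0"
  using assms by (cases v) (auto simp: mem_S_iff)

lemma subspace_S: "subspace S"
proof (rule subspaceI)
  have "(0::l2) \<in> H1"
    by (auto simp: H1_def has_weak_deriv_iff_inner intro: exI[of _ 0])
  moreover have "point_value 0 0 = 0"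
    using point_value_scaleR[OF \<open>0 \<in> H1\<close>, of 0 0] by simp
  ultimately show "0 \<in> S"
    by (simp add: zero_prod_def mem_S_iff ell_def l2_integral_eq_inner)
  show "v + w \<in> S" if "v \<in> S" "w \<in> S" for v w
    using that
    by (elim S_cases) (simp add: mem_S_iff H1_add ell_def point_value_add l2_integral_add algebra_simps)
  show "c *\<^sub>R v \<in> S" if "v \<in> S" for c v
    using that
  proof (elim S_cases)
    fix y z u \<xi> \<eta> assume v: "v = (y, z, u, \<xi>, \<eta>)" "y \<in> H1" "L (y, z, u, \<xi>, \<eta>) = 0"
    have "L (c *\<^sub>R v) = c * L v"
      unfolding v(1) using v(2) by (simp add: ell_def point_value_scaleR l2_integral_scaleR distrib_left right_diff_distrib left_diff_distrib mult_ac)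
    then show ?thesis
      using v by (simp add: mem_S_iff H1_scaleR)
  qed
qed

lemma J_add: "v \<in> S \<Longrightarrow> w \<in> S \<Longrightarrow> J (v + w) = J v + J w"
  by (elim S_cases) (simp add: energy_map_def weak_deriv_add l2_mult_add[OF a_continuous(2)] algebra_simps)

lemma J_scaleR: "v \<in> S \<Longrightarrow> J (c *\<^sub>R v) = c *\<^sub>R J v"
  by (elim S_cases) (simp add: energy_map_def weak_deriv_scaleR l2_mult_scaleR[OF a_continuous(2)])

lemma inner_sqrt_mult: "inner (l2_mult (\<lambda>x. sqrt (a x)) f) (l2_mult (\<lambda>x. sqrt (a x)) g) = inner (l2_mult a f) g"
proof -
  have "inner (l2_mult (\<lambda>x. sqrt (a x)) f) (l2_mult (\<lambda>x. sqrt (a x)) g)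
      = inner (l2_mult (\<lambda>x. sqrt (a x)) (l2_mult (\<lambda>x. sqrt (a x)) f)) g"
    by (rule l2_mult_inner_swap[OF a_continuous(2), symmetric])
  also have "l2_mult (\<lambda>x. sqrt (a x)) (l2_mult (\<lambda>x. sqrt (a x)) f) = l2_mult (\<lambda>x. sqrt (a x) * sqrt (a x)) f"
    by (rule l2_mult_mult[OF a_continuous(2) a_continuous(2)])
  also have "\<dots> = l2_mult a f"
  proof (rule l2_mult_cong)
    show "sqrt (a x) * sqrt (a x) = a x" if "0 < x" "x < 1" for x
      using a_pos[of x] that by simp
  qed (intro continuous_on_mult a_continuous)+
  finally show ?thesis .
qed

lemma inner_J:
  "inner (J (y, z, u, \<xi>, \<eta>)) (J (y', z', u', \<xi>', \<eta>')) =
     inner (l2_mult a (weak_deriv y)) (weak_deriv y') + inner z z' + K * \<tau> * inner u u' + m * \<xi> * \<xi>' + M * \<eta> * \<eta>'"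
proof -
  have "sqrt c * (sqrt c * x) = c * x" if "c > 0" for c x
    using that by (simp flip: mult.assoc)
  then show ?thesis
    using pos by (simp add: energy_map_def inner_sqrt_mult mult_ac)
qed

lemma N_eq: "v \<in> S \<Longrightarrow> N v = norm (J v)"
  by (elim S_cases) (simp add: X_norm_def norm_eq_sqrt_inner inner_J X_inner_def)

text \<open>Convergence is proved in the product norm; \<open>X_dot\<close> is closed because the weak derivative is closed and \<open>ell\<close> is
  continuous: integrals and, by \<open>point_value_0_eq\<close>, the trace at \<open>0\<close> are inner products with fixed functions.\<close>
lemma complete:
  assumes X: "\<And>n. X n \<in> S" and step: "\<And>n. norm (J (X (Suc n)) - J (X n)) \<le> (1/3) ^ n"
  shows "\<exists>v\<in>S. (\<lambda>n. J (X n)) \<longlonglongrightarrow> J v"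
proof -
  obtain c where c: "0 < c" "\<And>v. v \<in> X_space \<Longrightarrow> c * X_product_norm v \<le> N v"
    using weight unfolding admissible_weight_def by blast
  define y z u \<xi> \<eta> where "y = (\<lambda>n. fst (X n))" and "z = (\<lambda>n. fst (snd (X n)))" and "u = (\<lambda>n. fst (snd (snd (X n))))"
    and "\<xi> = (\<lambda>n. fst (snd (snd (snd (X n)))))" and "\<eta> = (\<lambda>n. snd (snd (snd (snd (X n)))))"
  have Xn: "X n = (y n, z n, u n, \<xi> n, \<eta> n)" for n
    by (simp add: y_def z_def u_def \<xi>_def \<eta>_def)
  have yH1: "y n \<in> H1" and ell0: "L (y n, z n, u n, \<xi> n, \<eta> n) = 0" for n
    using X[of n] by (simp_all add: Xn mem_S_iff)
  have diff: "X (Suc n) - X n = (y (Suc n) - y n, z (Suc n) - z n, u (Suc n) - u n, \<xi> (Suc n) - \<xi> n, \<eta> (Suc n) - \<eta> n)" for n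
    by (simp add: Xn)
  have P: "X_product_norm (X (Suc n) - X n) \<le> 1 / c * (1/3) ^ n" for n
  proof -
    have dS: "X (Suc n) - X n \<in> S"
      by (rule subspace_diff[OF subspace_S X X])
    then have "X (Suc n) - X n \<in> X_space"
      by (auto simp: X_dot_def)
    then have "c * X_product_norm (X (Suc n) - X n) \<le> N (X (Suc n) - X n)"
      by (rule c)
    also have "\<dots> = norm (J (X (Suc n) - X n))"
      by (rule N_eq[OF dS])
    also have "J (X (Suc n) - X n) = J (X (Suc n)) - J (X n)"
      using J_add[OF dS X[of n]] by (simp add: algebra_simps)
    also have "norm \<dots> \<le> (1/3) ^ n"
      by (rule step)
    finally show ?thesis
      using c(1) by (simp add: field_simps)
  qed
  have wd: "weak_deriv (y (Suc n) - y n) = weak_deriv (y (Suc n)) - weak_deriv (y n)" for n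
    using weak_deriv_add[OF yH1[of "Suc n"] H1_scaleR[OF yH1[of n], of "-1"]] weak_deriv_scaleR[OF yH1[of n], of "-1"] by simp
  note ge = X_product_norm_ge[where y = "y (Suc n) - y n" and z = "z (Suc n) - z n" and u = "u (Suc n) - u n"
      and \<xi> = "\<xi> (Suc n) - \<xi> n" and \<eta> = "\<eta> (Suc n) - \<eta> n" for n, folded diff]
  have "convergent y" "convergent (\<lambda>n. weak_deriv (y n))" "convergent z" "convergent u"
    by (rule l2_convergent_if_geometric_steps[of _ "1 / c"]; rule order_trans[OF _ P];
        simp only: ge flip: wd)+
  then obtain y' d' z' u' where lim: "y \<longlonglongrightarrow> y'" "(\<lambda>n. weak_deriv (y n)) \<longlonglongrightarrow> d'" "z \<longlonglongrightarrow> z'" "u \<longlonglongrightarrow> u'"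
    unfolding convergent_def by blast
  have "convergent \<xi>" "convergent \<eta>"
    by (rule real_convergent_if_geometric_steps[of _ "1 / c"]; rule order_trans[OF _ P]; simp only: ge)+
  then obtain \<xi>' \<eta>' where lim': "\<xi> \<longlonglongrightarrow> \<xi>'" "\<eta> \<longlonglongrightarrow> \<eta>'"
    unfolding convergent_def by blast
  have wd': "has_weak_deriv y' d'"
    by (rule has_weak_deriv_limit[OF H1_has_weak_deriv[OF yH1] lim(1,2)])
  then have y'H1: "y' \<in> H1" and d': "weak_deriv y' = d'"
    by (auto simp: H1_def intro: weak_deriv_eqI)
  have ell_eq: "L (f, g, h, r, s) = inner g (l2_of (\<lambda>x. 1)) + m * r + M * s
      + (\<beta> - \<alpha>) * (inner f (l2_of (\<lambda>x. 1)) - inner (weak_deriv f) (l2_of (\<lambda>x. 1 - x))) + \<tau> * \<alpha> * inner h (l2_of (\<lambda>x. 1))"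
    if "f \<in> H1" for f g h r s
    using point_value_0_eq[OF that] by (simp add: ell_def l2_integral_eq_inner)
  have "(\<lambda>n. L (y n, z n, u n, \<xi> n, \<eta> n)) \<longlonglongrightarrow> L (y', z', u', \<xi>', \<eta>')"
    unfolding ell_eq[OF yH1] ell_eq[OF y'H1] d'
    by (intro tendsto_add tendsto_mult tendsto_diff tendsto_inner tendsto_const lim lim')
  then have "L (y', z', u', \<xi>', \<eta>') = 0"
    by (simp add: ell0 LIMSEQ_const_iff)
  then have "(y', z', u', \<xi>', \<eta>') \<in> S"
    using y'H1 by (simp add: mem_S_iff)
  moreover have "(\<lambda>n. J (X n)) \<longlonglongrightarrow> J (y', z', u', \<xi>', \<eta>')"
    unfolding Xn energy_map_def prod.case d'
    by (intro tendsto_Pair tendsto_scaleR tendsto_mult tendsto_const lim lim'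
        bounded_linear.tendsto[OF bounded_linear_l2_mult[OF a_continuous(2)]])
  ultimately show ?thesis by blast
qed

text \<open>Names the stress \<open>\<sigma> = a y\<^sub>x\<close>, whose membership in \<open>H1\<close> makes its traces in \<open>A_op\<close> meaningful.\<close>
lemma D_cases:
  assumes "v \<in> D"
  obtains y z u \<sigma> \<xi> \<eta> where "v = (y, z, u, \<xi>, \<eta>)" "y \<in> H1" "z \<in> H1" "u \<in> H1"
    "\<sigma> = l2_mult a (weak_deriv y)" "\<sigma> \<in> H1" "\<xi> = point_value u 0" "\<xi> = point_value z 0" "\<eta> = point_value z 1"
    "A v = (z, weak_deriv \<sigma>, - (1 / \<tau>) *\<^sub>R weak_deriv u,
         1 / m * (point_value \<sigma> 0 - \<beta> * \<xi> + \<alpha> * point_value u 1), - (point_value \<sigma> 1 / M))"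
    "L v = 0"
proof -
  obtain y z u \<xi> \<eta> where v: "v = (y, z, u, \<xi>, \<eta>)"
    by (cases v) auto
  have "y \<in> H1" "weak_deriv y \<in> H1"
    using assms by (auto simp: v A_dot_dom_def A_dom_def H2_def)
  then show thesis
    using assms l2_mult_C1(1)[OF a, of "weak_deriv y"]
    by (intro that[of y z u \<xi> \<eta> "l2_mult a (weak_deriv y)"])
      (auto simp: v A_dot_dom_def A_dom_def mem_S_iff A_op_def Let_def)
qed

text \<open>Each boundary equation cancels a boundary term of \<open>ell (A v)\<close>.\<close>
lemma A_in_S: "v \<in> D \<Longrightarrow> A v \<in> S"
proof (elim D_cases)
  fix y z u \<sigma> \<xi> \<eta>
  assume H: "z \<in> H1" "u \<in> H1" "\<sigma> \<in> H1" and \<xi>: "\<xi> = point_value u 0" "\<xi> = point_value z 0"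
    and Av: "A v = (z, weak_deriv \<sigma>, - (1 / \<tau>) *\<^sub>R weak_deriv u,
         1 / m * (point_value \<sigma> 0 - \<beta> * \<xi> + \<alpha> * point_value u 1), - (point_value \<sigma> 1 / M))"
  have "l2_integral (- (1 / \<tau>) *\<^sub>R weak_deriv u) = - (1 / \<tau>) * (point_value u 1 - point_value u 0)"
    by (simp only: l2_integral_scaleR l2_integral_weak_deriv H)
  then have "L (A v) = 0"
    using pos H \<xi> by (simp add: Av ell_def l2_integral_weak_deriv) (simp add: algebra_simps)
  then show "A v \<in> S"
    using H by (simp add: Av mem_S_iff)
qed

text \<open>Its positivity is the content of the hypotheses on \<open>\<alpha>\<close>, \<open>\<beta>\<close> and \<open>K\<close>.\<close>
definition damping :: real where
  "damping = min (\<beta> - \<bar>\<alpha>\<bar> / 2 - K / 2) (K / 2 - \<bar>\<alpha>\<bar> / 2)"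

lemma damping_pos: "0 < damping"
  using delay by (auto simp: damping_def)

text \<open>All interior terms integrate to boundary terms. What is left is a quadratic form in \<open>\<xi>\<close> and \<open>u(1)\<close>,
  which the inequality of the means makes negative definite.\<close>
lemma dissipation:
  assumes "v \<in> D" "v = (y, z, u, \<xi>, \<eta>)"
  shows "inner (J (A v)) (J v) \<le> - damping * (\<xi>\<^sup>2 + (point_value u 1)\<^sup>2)"
  using assms(1)
proof (rule D_cases)
  fix y1 z1 u1 \<sigma> \<xi>1 \<eta>1
  assume "v = (y1, z1, u1, \<xi>1, \<eta>1)" and H: "y1 \<in> H1" "z1 \<in> H1" "u1 \<in> H1" "\<sigma> \<in> H1" and \<sigma>: "\<sigma> = l2_mult a (weak_deriv y1)"
    and pv: "\<xi>1 = point_value u1 0" "\<xi>1 = point_value z1 0" "\<eta>1 = point_value z1 1"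
    and Av: "A v = (z1, weak_deriv \<sigma>, - (1 / \<tau>) *\<^sub>R weak_deriv u1,
         1 / m * (point_value \<sigma> 0 - \<beta> * \<xi>1 + \<alpha> * point_value u1 1), - (point_value \<sigma> 1 / M))"
  then have v: "v = (y, z, u, \<xi>, \<eta>)" and eq: "y1 = y" "z1 = z" "u1 = u" "\<xi>1 = \<xi>" "\<eta>1 = \<eta>"
    using assms(2) by auto
  note H = H[unfolded eq] and pv = pv[unfolded eq] and Av = Av[unfolded eq] and \<sigma> = \<sigma>[unfolded eq]
  define r where "r = point_value u 1"
  have 1: "inner (l2_mult a (weak_deriv z)) (weak_deriv y) = inner (weak_deriv z) \<sigma>"
    unfolding \<sigma> by (rule l2_mult_inner_swap[OF a_continuous(1)])
  have 2: "inner (weak_deriv z) \<sigma> + inner z (weak_deriv \<sigma>) = \<eta> * point_value \<sigma> 1 - \<xi> * point_value \<sigma> 0"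
    using inner_weak_deriv_by_parts[OF H(2,4)] pv by simp
  have 3: "2 * inner (weak_deriv u) u = r\<^sup>2 - \<xi>\<^sup>2"
    using inner_weak_deriv_by_parts[OF H(3) H(3)] pv by (simp add: r_def power2_eq_square inner_commute)
  have "inner (J (A v)) (J v) = inner (J (z, weak_deriv \<sigma>, - (1 / \<tau>) *\<^sub>R weak_deriv u,
         1 / m * (point_value \<sigma> 0 - \<beta> * \<xi> + \<alpha> * point_value u 1), - (point_value \<sigma> 1 / M))) (J (y, z, u, \<xi>, \<eta>))"
    unfolding Av by (simp only: v)
  also have "\<dots> = inner (weak_deriv z) \<sigma> + inner (weak_deriv \<sigma>) z + K * \<tau> * (- (1 / \<tau>) * inner (weak_deriv u) u)
      + m * (1 / m * (point_value \<sigma> 0 - \<beta> * \<xi> + \<alpha> * r)) * \<xi> + M * (- (point_value \<sigma> 1 / M)) * \<eta>"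
    by (simp only: inner_J 1 r_def inner_scaleR_left)
  also have "\<dots> = \<eta> * point_value \<sigma> 1 - \<xi> * point_value \<sigma> 0 - K * inner (weak_deriv u) u
      + (point_value \<sigma> 0 - \<beta> * \<xi> + \<alpha> * r) * \<xi> - point_value \<sigma> 1 * \<eta>"
    using 2 pos by (simp add: inner_commute)
  also have "\<dots> = - \<beta> * \<xi>\<^sup>2 + \<alpha> * (r * \<xi>) - K / 2 * (r\<^sup>2 - \<xi>\<^sup>2)"
  proof -
    have "K * inner (weak_deriv u) u = K / 2 * (r\<^sup>2 - \<xi>\<^sup>2)"
      unfolding 3[symmetric] by simp
    then show ?thesis
      by (simp add: power2_eq_square algebra_simps)
  qed
  also have "\<alpha> * (r * \<xi>) \<le> \<bar>\<alpha>\<bar> / 2 * (\<xi>\<^sup>2 + r\<^sup>2)"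
  proof -
    have "2 * (\<bar>r\<bar> * \<bar>\<xi>\<bar>) \<le> \<xi>\<^sup>2 + r\<^sup>2"
      using sum_squares_bound[of "\<bar>r\<bar>" "\<bar>\<xi>\<bar>"] by (simp add: mult.assoc add.commute)
    then have "\<bar>\<alpha>\<bar> * (2 * (\<bar>r\<bar> * \<bar>\<xi>\<bar>)) \<le> \<bar>\<alpha>\<bar> * (\<xi>\<^sup>2 + r\<^sup>2)"
      by (intro mult_left_mono) auto
    moreover have "\<alpha> * (r * \<xi>) \<le> \<bar>\<alpha>\<bar> * (\<bar>r\<bar> * \<bar>\<xi>\<bar>)"
      by (metis abs_ge_self abs_mult)
    ultimately show ?thesis by simp
  qed
  also have "- \<beta> * \<xi>\<^sup>2 + \<bar>\<alpha>\<bar> / 2 * (\<xi>\<^sup>2 + r\<^sup>2) - K / 2 * (r\<^sup>2 - \<xi>\<^sup>2)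
      = - ((\<beta> - \<bar>\<alpha>\<bar> / 2 - K / 2) * \<xi>\<^sup>2 + (K / 2 - \<bar>\<alpha>\<bar> / 2) * r\<^sup>2)"
    by (simp add: algebra_simps)
  also have "\<dots> \<le> - (damping * \<xi>\<^sup>2 + damping * r\<^sup>2)"
    unfolding neg_le_iff_le by (intro add_mono mult_right_mono) (auto simp: damping_def)
  finally show ?thesis
    by (simp add: r_def distrib_left)
qed

text \<open>In terms of states, \<open>lyapunov_form (J v) (J v)\<close> is \<open>\<tau>\<close> times \<open>K \<tau> \<integral>(2 - x) u\<^sup>2\<close> minus \<open>2 + 2 * M\<close> times \<open>\<integral>(2 - x) y\<^sub>x z\<close>;
  the first integral treats the delay line, the second the string. The factor \<open>2 + 2 * M\<close> lets the
  string term dominate both the interior energy and the energy \<open>M \<eta>\<^sup>2\<close> of the right mass.\<close>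
definition lyapunov_form :: "state \<Rightarrow> state \<Rightarrow> real" where
  "lyapunov_form p r = inner (\<tau> *\<^sub>R l2_mult (\<lambda>x. 2 - x) (fst (snd (snd p)))) (fst (snd (snd r)))
     + inner (- (2 + 2 * M) *\<^sub>R l2_mult (\<lambda>x. (2 - x) / sqrt (a x)) (fst p)) (fst (snd r))"

lemma weight_continuous: "continuous_on {0..1} (\<lambda>x::real. 2 - x)" "continuous_on {0..1} (\<lambda>x. (2 - x) / sqrt (a x))"
proof -
  show "continuous_on {0..1} (\<lambda>x::real. 2 - x)"
    by (intro continuous_on_diff continuous_on_const continuous_on_id)
  then show "continuous_on {0..1} (\<lambda>x. (2 - x) / sqrt (a x))"
    by (rule continuous_on_divide[OF _ a_continuous(2)]) (use a_pos in force)
qed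

lemma bounded_bilinear_lyapunov_form: "bounded_bilinear lyapunov_form"
proof -
  have mult: "bounded_linear (\<lambda>p. c *\<^sub>R l2_mult f (g p))" if "continuous_on {0..1} f" "bounded_linear g"
    for c f and g :: "state \<Rightarrow> l2"
    using bounded_linear_compose[OF bounded_linear_scaleR_right bounded_linear_compose[OF bounded_linear_l2_mult[OF that(1)] that(2)]] .
  have proj: "bounded_linear (\<lambda>p::state. fst (snd (snd p)))" "bounded_linear (\<lambda>p::state. fst p)" "bounded_linear (\<lambda>p::state. fst (snd p))"
    by (intro bounded_linear_fst_comp bounded_linear_snd_comp bounded_linear_ident)+
  have inner_comp: "bounded_bilinear (\<lambda>p r. inner (f p) (g r))" if "bounded_linear f" "bounded_linear g"
    for f g :: "state \<Rightarrow> l2"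
    by (rule bounded_bilinear.comp[OF bounded_bilinear_inner that])
  have "bounded_bilinear (\<lambda>(p::state) (r::state). inner (\<tau> *\<^sub>R l2_mult (\<lambda>x. 2 - x) (fst (snd (snd p)))) (fst (snd (snd r))))"
    by (rule inner_comp[OF mult[OF weight_continuous(1) proj(1)] proj(1)])
  moreover have "bounded_bilinear (\<lambda>(p::state) (r::state). inner (- (2 + 2 * M) *\<^sub>R l2_mult (\<lambda>x. (2 - x) / sqrt (a x)) (fst p)) (fst (snd r)))"
    by (rule inner_comp[OF mult[OF weight_continuous(2) proj(2)] proj(3)])
  ultimately show ?thesis
    unfolding lyapunov_form_def[abs_def] by (rule bounded_bilinear_plus)
qed

text \<open>The weight \<open>(2 - x) / a x\<close> has derivative at most \<open>- 1 / a x\<close> because \<open>a\<close> is nondecreasing, and at \<open>x = 1\<close>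
  its boundary term has the favourable sign.\<close>
lemma weighted_wave_estimate:
  assumes \<sigma>: "\<sigma> \<in> H1"
  shows "inner (l2_mult (\<lambda>x. 1 / a x) \<sigma>) \<sigma> - 2 * (point_value \<sigma> 0)\<^sup>2 / a0
    \<le> 2 * inner (l2_mult (\<lambda>x. (2 - x) / a x) \<sigma>) (weak_deriv \<sigma>)"
proof -
  define \<psi> where "\<psi> = (\<lambda>x. (2 - x) / a x)"
  define \<psi>' where "\<psi>' = (\<lambda>x. (- a x - (2 - x) * a' x) / (a x * a x))"
  have "C1_unit \<psi> \<psi>'"
    unfolding C1_unit_def
  proof (intro conjI ballI)
    fix x :: real assume x: "x \<in> {0..1}"
    have "(a has_real_derivative a' x) (at x within {0..1})"
      using a x by (simp add: C1_unit_def)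
    moreover have "((\<lambda>x. 2 - x) has_real_derivative - 1) (at x within {0..1})"
      by (auto intro!: derivative_eq_intros)
    ultimately have "((\<lambda>x. (2 - x) / a x) has_real_derivative (- 1 * a x - (2 - x) * a' x) / (a x * a x)) (at x within {0..1})"
      using a_pos[of x] x by (intro DERIV_divide) auto
    then show "(\<psi> has_real_derivative \<psi>' x) (at x within {0..1})"
      by (simp add: \<psi>_def \<psi>'_def)
  next
    show c: "continuous_on {0..1} \<psi>'"
      unfolding \<psi>'_def
      by (intro continuous_on_divide continuous_on_diff continuous_on_minus continuous_on_mult weight_continuous(1)
          C1_unit_continuous[OF a] ballI) (use a_pos in force)
  qed
  note \<psi> = this
  have "2 * inner (l2_mult \<psi> \<sigma>) (weak_deriv \<sigma>) + inner (l2_mult \<psi>' \<sigma>) \<sigma>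
      = \<psi> 1 * (point_value \<sigma> 1)\<^sup>2 - \<psi> 0 * (point_value \<sigma> 0)\<^sup>2"
    by (rule weighted_energy_identity[OF \<psi> \<sigma>])
  moreover have "0 \<le> \<psi> 1 * (point_value \<sigma> 1)\<^sup>2"
    using a_pos[of 1] by (simp add: \<psi>_def)
  moreover have "\<psi> 0 * (point_value \<sigma> 0)\<^sup>2 \<le> 2 * (point_value \<sigma> 0)\<^sup>2 / a0"
    using a0 a_pos[of 0] by (simp add: \<psi>_def frac_le)
  moreover have "inner (l2_mult \<psi>' \<sigma>) \<sigma> \<le> inner (l2_mult (\<lambda>x. - 1 * (1 / a x)) \<sigma>) \<sigma>"
  proof (rule inner_l2_mult_mono)
    fix x :: real assume x: "0 < x" "x < 1"
    then have "0 \<le> (2 - x) * a' x"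
      using a'_nonneg[of x] by (intro mult_nonneg_nonneg) auto
    then have "(- a x - (2 - x) * a' x) / (a x * a x) \<le> - a x / (a x * a x)"
      using a_pos[of x] x by (intro divide_right_mono) auto
    then show "\<psi>' x \<le> - 1 * (1 / a x)"
      using a_pos[of x] x by (simp add: \<psi>'_def)
  qed (intro continuous_on_mult continuous_on_const a_continuous(3) C1_unit_continuous(2)[OF \<psi>])+
  moreover have "l2_mult (\<lambda>x. - 1 * (1 / a x)) \<sigma> = - 1 *\<^sub>R l2_mult (\<lambda>x. 1 / a x) \<sigma>"
    using l2_mult_mult[OF continuous_on_const a_continuous(3), of "- 1" \<sigma>] by (simp only: l2_mult_const)
  ultimately show ?thesis
    by (simp add: \<psi>_def)
qed

lemma decreasing_weight_identity:
  assumes "w \<in> H1"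
  shows "2 * inner (l2_mult (\<lambda>x. 2 - x) w) (weak_deriv w) = (point_value w 1)\<^sup>2 - 2 * (point_value w 0)\<^sup>2 + (norm w)\<^sup>2"
proof -
  have "C1_unit (\<lambda>x::real. 2 - x) (\<lambda>x. - 1)"
    by (auto simp: C1_unit_def intro!: derivative_eq_intros)
  from weighted_energy_identity[OF this assms] show ?thesis
    by (simp add: l2_mult_const power2_norm_eq_inner)
qed

text \<open>The boundary terms with the unfavourable sign involve \<open>\<xi>\<close> and the stress \<open>\<sigma>(0)\<close>. The stress is expressed through
  \<open>\<xi>\<close>, \<open>u(1)\<close> and the acceleration \<open>\<zeta>\<close> of the left mass.\<close>
lemma lyapunov_estimate:
  assumes vD: "v \<in> D" and v: "v = (y, z, u, \<xi>, \<eta>)"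
    and Av: "A v = (z, f, g, \<zeta>, \<theta>)"
  shows "lyapunov_form (J (A v)) (J v) + lyapunov_form (J v) (J (A v)) + (norm (J v))\<^sup>2
    \<le> (2 * K * \<tau> + m + (2 + 2 * M) + 3 * (2 + 2 * M) / a0 * (m\<^sup>2 + \<beta>\<^sup>2 + \<alpha>\<^sup>2)) * (\<xi>\<^sup>2 + (point_value u 1)\<^sup>2 + \<zeta>\<^sup>2)"
  using vD
proof (rule D_cases)
  fix y1 z1 u1 \<sigma> \<xi>1 \<eta>1
  assume "v = (y1, z1, u1, \<xi>1, \<eta>1)" and H: "y1 \<in> H1" "z1 \<in> H1" "u1 \<in> H1" "\<sigma> \<in> H1" and \<sigma>: "\<sigma> = l2_mult a (weak_deriv y1)"
    and pv: "\<xi>1 = point_value u1 0" "\<xi>1 = point_value z1 0" "\<eta>1 = point_value z1 1"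
    and A1: "A v = (z1, weak_deriv \<sigma>, - (1 / \<tau>) *\<^sub>R weak_deriv u1,
         1 / m * (point_value \<sigma> 0 - \<beta> * \<xi>1 + \<alpha> * point_value u1 1), - (point_value \<sigma> 1 / M))"
  then have eq: "y1 = y" "z1 = z" "u1 = u" "\<xi>1 = \<xi>" "\<eta>1 = \<eta>"
    using v by auto
  note H = H[unfolded eq] and pv = pv[unfolded eq] and \<sigma> = \<sigma>[unfolded eq]
  have f: "f = weak_deriv \<sigma>" and g: "g = - (1 / \<tau>) *\<^sub>R weak_deriv u"
    and \<zeta>: "\<zeta> = 1 / m * (point_value \<sigma> 0 - \<beta> * \<xi> + \<alpha> * point_value u 1)"
    using A1 Av eq by auto
  define r where "r = point_value u 1"
  define \<sigma>0 where "\<sigma>0 = point_value \<sigma> 0"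
  define e where "e = inner (l2_mult a (weak_deriv y)) (weak_deriv y)"
  define G where "G = inner (l2_mult (\<lambda>x. 2 - x) u) (weak_deriv u)"
  define F1 where "F1 = inner (l2_mult (\<lambda>x. 2 - x) z) (weak_deriv z)"
  define F2 where "F2 = inner (l2_mult (\<lambda>x. (2 - x) / a x) \<sigma>) (weak_deriv \<sigma>)"
  define k where "k = 2 + 2 * M"
  have k: "0 < k"
    using pos by (simp add: k_def)
  have undo: "l2_mult (\<lambda>x. (2 - x) / sqrt (a x)) (l2_mult (\<lambda>x. sqrt (a x)) w) = l2_mult (\<lambda>x. 2 - x) w" for w
    unfolding l2_mult_mult[OF weight_continuous(2) a_continuous(2)]
  proof (rule l2_mult_cong)
    show "(2 - x) / sqrt (a x) * sqrt (a x) = 2 - x" if "0 < x" "x < 1" for x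
      using a_pos[of x] that by simp
  qed (intro continuous_on_mult weight_continuous a_continuous)+
  have swap: "inner (l2_mult (\<lambda>x. 2 - x) w) w' = inner (l2_mult (\<lambda>x. 2 - x) w') w" for w w'
    by (rule trans[OF l2_mult_inner_swap[OF weight_continuous(1)] inner_commute])
  have s: "sqrt (K * \<tau>) * (x * sqrt (K * \<tau>) * w) = K * \<tau> * (x * w)" for x w
    using pos by (simp add: mult.left_commute[of _ "sqrt (K * \<tau>)"] flip: mult.assoc)
  have "lyapunov_form (J (A v)) (J v) = \<tau> * (K * \<tau>) * inner (l2_mult (\<lambda>x. 2 - x) g) u
      - k * inner (l2_mult (\<lambda>x. 2 - x) (weak_deriv z)) z"
    unfolding Av unfolding v by (simp add: lyapunov_form_def energy_map_def undo k_def l2_mult_scaleR[OF weight_continuous(1)] s) (simp add: algebra_simps)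
  also have "\<dots> = - (K * \<tau>) * G - k * F1"
    unfolding g l2_mult_scaleR[OF weight_continuous(1)] G_def F1_def swap[of "weak_deriv u"] swap[of "weak_deriv z"]
      inner_scaleR_left using pos by simp
  finally have b1: "lyapunov_form (J (A v)) (J v) = - (K * \<tau>) * G - k * F1" .
  have "lyapunov_form (J v) (J (A v)) = \<tau> * (K * \<tau>) * inner (l2_mult (\<lambda>x. 2 - x) u) g
      - k * inner (l2_mult (\<lambda>x. 2 - x) (weak_deriv y)) f"
    unfolding Av unfolding v by (simp add: lyapunov_form_def energy_map_def undo k_def l2_mult_scaleR[OF weight_continuous(1)] s) (simp add: algebra_simps)
  also have "l2_mult (\<lambda>x. 2 - x) (weak_deriv y) = l2_mult (\<lambda>x. (2 - x) / a x) \<sigma>"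
    unfolding \<sigma>
  proof (subst l2_mult_mult)
    show c: "continuous_on {0..1} (\<lambda>x. (2 - x) / a x)"
      by (rule continuous_on_divide[OF weight_continuous(1) a_continuous(1)]) (use a_pos in force)
    show "l2_mult (\<lambda>x. 2 - x) (weak_deriv y) = l2_mult (\<lambda>x. (2 - x) / a x * a x) (weak_deriv y)"
    proof (rule l2_mult_cong)
      show "2 - x = (2 - x) / a x * a x" if "0 < x" "x < 1" for x
        using a_pos[of x] that by simp
    qed (intro continuous_on_mult c weight_continuous a_continuous)+
  qed (rule a_continuous)
  finally have b2: "lyapunov_form (J v) (J (A v)) = - (K * \<tau>) * G - k * F2"
    using pos by (simp add: f g G_def F2_def)
  have n: "(norm (J v))\<^sup>2 = e + (norm z)\<^sup>2 + K * \<tau> * (norm u)\<^sup>2 + m * \<xi>\<^sup>2 + M * \<eta>\<^sup>2"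
    unfolding v power2_norm_eq_inner inner_J e_def by (simp add: power2_eq_square)
  have 1: "2 * G = r\<^sup>2 - 2 * \<xi>\<^sup>2 + (norm u)\<^sup>2"
    using decreasing_weight_identity[OF H(3)] pv by (simp add: G_def r_def)
  have 2: "2 * F1 = \<eta>\<^sup>2 - 2 * \<xi>\<^sup>2 + (norm z)\<^sup>2"
    using decreasing_weight_identity[OF H(2)] pv by (simp add: F1_def)
  have "l2_mult (\<lambda>x. 1 / a x) \<sigma> = weak_deriv y"
    unfolding \<sigma> l2_mult_mult[OF a_continuous(3,1)]
  proof -
    have "l2_mult (\<lambda>x. 1 / a x * a x) (weak_deriv y) = l2_mult (\<lambda>x. 1) (weak_deriv y)"
    proof (rule l2_mult_cong)
      show "1 / a x * a x = 1" if "0 < x" "x < 1" for x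
        using a_pos[of x] that by simp
    qed (intro continuous_on_mult continuous_on_const a_continuous)+
    then show "l2_mult (\<lambda>x. 1 / a x * a x) (weak_deriv y) = weak_deriv y"
      by (simp add: l2_mult_const)
  qed
  then have 3: "e - 2 * \<sigma>0\<^sup>2 / a0 \<le> 2 * F2"
    using weighted_wave_estimate[OF H(4)] by (simp add: e_def F2_def \<sigma>0_def \<sigma> inner_commute)
  have e0: "0 \<le> e"
    using inner_sqrt_mult[of "weak_deriv y" "weak_deriv y"] by (simp add: e_def flip: inner_sqrt_mult)
  have "lyapunov_form (J (A v)) (J v) + lyapunov_form (J v) (J (A v)) + (norm (J v))\<^sup>2
    = - (K * \<tau>) * (2 * G) - k / 2 * (2 * F1) - k / 2 * (2 * F2) + (norm (J v))\<^sup>2"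
    using b1 b2 by (simp add: algebra_simps)
  also have "\<dots> \<le> - (K * \<tau>) * (2 * G) - k / 2 * (2 * F1) - k / 2 * (e - 2 * \<sigma>0\<^sup>2 / a0) + (norm (J v))\<^sup>2"
    using 3 k by (intro add_right_mono diff_left_mono mult_left_mono) auto
  also have "\<dots> = - (K * \<tau>) * r\<^sup>2 + (2 * K * \<tau> + m + k) * \<xi>\<^sup>2 + k / a0 * \<sigma>0\<^sup>2 - M * e - M * (norm z)\<^sup>2 - \<eta>\<^sup>2"
    unfolding 1 2 n by (simp add: k_def field_simps)
  also have "\<dots> \<le> (2 * K * \<tau> + m + k) * \<xi>\<^sup>2 + k / a0 * \<sigma>0\<^sup>2"
  proof -
    have "0 \<le> K * \<tau> * r\<^sup>2" "0 \<le> M * e" "0 \<le> M * (norm z)\<^sup>2" "0 \<le> \<eta>\<^sup>2"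
      using pos e0 by simp_all
    then show ?thesis
      unfolding mult_minus_left by linarith
  qed
  also have "\<dots> \<le> (2 * K * \<tau> + m + k) * (\<xi>\<^sup>2 + r\<^sup>2 + \<zeta>\<^sup>2) + k / a0 * (3 * (m\<^sup>2 + \<beta>\<^sup>2 + \<alpha>\<^sup>2) * (\<xi>\<^sup>2 + r\<^sup>2 + \<zeta>\<^sup>2))"
  proof (intro add_mono mult_left_mono)
    \<comment> \<open>the equation of motion of the left mass, solved for \<open>\<sigma>(0)\<close>\<close>
    have "\<sigma>0 = m * \<zeta> + \<beta> * \<xi> - \<alpha> * r"
      using pos by (simp add: \<zeta> \<sigma>0_def r_def)
    moreover have "(p + q - w)\<^sup>2 \<le> 3 * (p\<^sup>2 + q\<^sup>2 + w\<^sup>2)" for p q w :: real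
    proof -
      have "0 \<le> (p - q)\<^sup>2 + (p + w)\<^sup>2 + (q + w)\<^sup>2" by simp
      then show ?thesis by (simp add: power2_eq_square algebra_simps)
    qed
    ultimately have "\<sigma>0\<^sup>2 \<le> 3 * ((m * \<zeta>)\<^sup>2 + (\<beta> * \<xi>)\<^sup>2 + (\<alpha> * r)\<^sup>2)"
      by simp
    also have "\<dots> \<le> 3 * (m\<^sup>2 + \<beta>\<^sup>2 + \<alpha>\<^sup>2) * (\<xi>\<^sup>2 + r\<^sup>2 + \<zeta>\<^sup>2)"
      by (simp add: power_mult_distrib algebra_simps)
    finally show "\<sigma>0\<^sup>2 \<le> 3 * (m\<^sup>2 + \<beta>\<^sup>2 + \<alpha>\<^sup>2) * (\<xi>\<^sup>2 + r\<^sup>2 + \<zeta>\<^sup>2)" .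
  qed (use pos k a0 in auto)
  also have "\<dots> = (2 * K * \<tau> + m + k + 3 * k / a0 * (m\<^sup>2 + \<beta>\<^sup>2 + \<alpha>\<^sup>2)) * (\<xi>\<^sup>2 + r\<^sup>2 + \<zeta>\<^sup>2)"
    unfolding distrib_right[of "2 * K * \<tau> + m + k"] by simp
  finally show ?thesis
    by (simp only: k_def r_def)
qed

text \<open>The velocity \<open>\<xi>\<close> of the left mass, scaled so that its square is below the dissipation.\<close>
definition observation :: "state \<Rightarrow> real" where
  "observation p = sqrt (damping / m) * fst (snd (snd (snd p)))"

lemma bounded_linear_observation: "bounded_linear observation"
  unfolding observation_def
  by (intro bounded_linear_const_mult bounded_linear_fst_comp bounded_linear_snd_comp bounded_linear_ident)

lemma observation_J: "(observation (J (y, z, u, \<xi>, \<eta>)))\<^sup>2 = damping * \<xi>\<^sup>2"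
  using pos damping_pos by (simp add: observation_def energy_map_def power_mult_distrib)

lemma decay:
  assumes gen: "generates S N D A T"
  shows "\<exists>c>0. \<forall>t>0. \<forall>v\<in>D. N (T t v) \<le> c / sqrt t * (N v + N (A v))"
proof -
  have diss: "damping * (\<xi>\<^sup>2 + (point_value u 1)\<^sup>2) \<le> - inner (J (A (y, z, u, \<xi>, \<eta>))) (J (y, z, u, \<xi>, \<eta>))"
    if "(y, z, u, \<xi>, \<eta>) \<in> D" for y z u \<xi> \<eta>
    using dissipation[OF that refl] by simp
  have obs: "(observation (J v))\<^sup>2 \<le> - inner (J (A v)) (J v)" if "v \<in> D" for v
  proof -
    obtain y z u \<xi> \<eta> where v: "v = (y, z, u, \<xi>, \<eta>)"
      by (cases v) auto
    have "damping * \<xi>\<^sup>2 \<le> damping * (\<xi>\<^sup>2 + (point_value u 1)\<^sup>2)"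
      using damping_pos by simp
    then show ?thesis
      using diss[OF that[unfolded v]] by (simp only: v observation_J)
  qed
  interpret dissipative_semigroup S D N A T J
  proof
    show "inner (J (A v)) (J v) \<le> 0" if "v \<in> D" for v
      using order_trans[OF zero_le_power2 obs[OF that]] by simp
  qed (fact subspace_S J_add J_scaleR N_eq gen A_in_S | rule complete, assumption, assumption)+
  define C where "C = (2 * K * \<tau> + m + (2 + 2 * M) + 3 * (2 + 2 * M) / a0 * (m\<^sup>2 + \<beta>\<^sup>2 + \<alpha>\<^sup>2)) / damping"
  have C: "0 \<le> C"
    using pos a0 damping_pos by (simp add: C_def)
  have lyap: "lyapunov_form (J (A v)) (J v) + lyapunov_form (J v) (J (A v)) + (norm (J v))\<^sup>2
      \<le> C * (- inner (J (A v)) (J v) + (observation (J (A v)))\<^sup>2)" if vD: "v \<in> D" for v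
  proof -
    obtain y z u \<xi> \<eta> where v: "v = (y, z, u, \<xi>, \<eta>)"
      by (cases v) auto
    obtain f g \<zeta> \<theta> where Av: "A v = (z, f, g, \<zeta>, \<theta>)"
      by (simp add: v A_op_def Let_def)
    have "lyapunov_form (J (A v)) (J v) + lyapunov_form (J v) (J (A v)) + (norm (J v))\<^sup>2
        \<le> C * damping * (\<xi>\<^sup>2 + (point_value u 1)\<^sup>2 + \<zeta>\<^sup>2)"
      using lyapunov_estimate[OF vD v Av] damping_pos by (simp add: C_def)
    also have "\<dots> = C * (damping * (\<xi>\<^sup>2 + (point_value u 1)\<^sup>2) + (observation (J (A v)))\<^sup>2)"
      by (simp add: Av observation_J algebra_simps)
    also have "\<dots> \<le> C * (- inner (J (A v)) (J v) + (observation (J (A v)))\<^sup>2)"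
      using diss[of y z u \<xi> \<eta>] vD C by (intro mult_left_mono add_right_mono) (simp_all add: v)
    finally show ?thesis .
  qed
  show ?thesis
    by (rule inverse_sqrt_decay[OF bounded_linear_observation bounded_bilinear_lyapunov_form C obs lyap])
qed

end

theorem theorem5:
  fixes a a' :: "real \<Rightarrow> real" and a0 a1 m M \<tau> \<alpha> \<beta> K \<omega> :: real
    and T :: "real \<Rightarrow> state \<Rightarrow> state"
  assumes "m > 0" "M > 0" "\<tau> > 0" "\<beta> > 0" "K > 0"
    and "\<And>x. x \<in> {0..1} \<Longrightarrow> (a has_real_derivative a' x) (at x within {0..1})"
    and "continuous_on {0..1} a'"
    and "a0 > 0" "a1 > 0"
    and "\<And>x. x \<in> {0..1} \<Longrightarrow> a x \<ge> a0"
    and "\<And>x. x \<in> {0..1} \<Longrightarrow> a' x \<ge> a1"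
    and "\<bar>\<alpha>\<bar> < \<beta>" "\<bar>\<alpha>\<bar> < K" "K < 2 * \<beta> - \<bar>\<alpha>\<bar>"
    and "admissible_weight a m M \<tau> \<alpha> \<beta> K \<omega>"
    and "generates (X_dot m M \<tau> \<alpha> \<beta>) (X_norm a m M \<tau> \<alpha> \<beta> K \<omega>)
           (A_dot_dom m M \<tau> \<alpha> \<beta>) (A_op a m M \<tau> \<alpha> \<beta>) T"
  shows "\<exists>C>0. \<forall>t>0.
    op_norm (A_dot_dom m M \<tau> \<alpha> \<beta>)
      (graph_norm (X_norm a m M \<tau> \<alpha> \<beta> K \<omega>) (A_op a m M \<tau> \<alpha> \<beta>))
      (X_norm a m M \<tau> \<alpha> \<beta> K \<omega>) (T t) \<le> ereal (C / sqrt t)"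
proof -
  interpret delayed_wave a a' a0 m M \<tau> \<alpha> \<beta> K \<omega>
  proof
    show "C1_unit a a'"
      using assms by (simp add: C1_unit_def)
    show "0 \<le> a' x" if "0 \<le> x" "x \<le> 1" for x
      using assms(9) assms(11)[of x] that by simp
  qed (use assms in auto)
  obtain C where C: "C > 0" "\<And>t v. t > 0 \<Longrightarrow> v \<in> D \<Longrightarrow> N (T t v) \<le> C / sqrt t * (N v + N (A v))"
    using decay[OF assms(16)] by blast
  have "op_norm D (graph_norm N A) N (T t) \<le> ereal (C / sqrt t)" if t: "t > 0" for t
    unfolding op_norm_def
  proof (rule SUP_least)
    fix v assume v: "v \<in> D"
    then have "0 \<le> N v" "0 \<le> N (A v)"
      using N_eq[of v] N_eq[OF A_in_S[OF v]] by (simp_all add: A_dot_dom_def)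
    then have "0 \<le> graph_norm N A v"
      by (simp add: graph_norm_def)
    moreover have "N (T t v) \<le> C / sqrt t * graph_norm N A v"
      using C(2)[OF t v] by (simp add: graph_norm_def)
    ultimately have "N (T t v) / graph_norm N A v \<le> C / sqrt t"
      using C(1) t by (cases "graph_norm N A v = 0") (simp_all add: divide_le_eq)
    then show "ereal (N (T t v) / graph_norm N A v) \<le> ereal (C / sqrt t)"
      by simp
  qed
  then show ?thesis
    using C(1) by blast
qed

end
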